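(* There exists a constant $\delta>0$ such that for every local minimizer $\boldsymbol{u}=(u_0,\dots,u_n)\in\mathcal{A}_m$ of $E$ for the $L^\infty(\Omega)^{n+1}$ topology, it holds that $$\delta\le u_i\quad\text{a.e. in }\Omega,\ \text{for all } i=0,\dots,n,$$ which, together with the constraint $\sum_{j=0}^n u_j=1$, implies the upper bound $$u_i\le 1-n\delta\quad\text{a.e. in }\Omega,\ \text{for all } i=0,\dots,n.$$
   Context: Let $n\ge1$, let $\Omega\subset\mathbb{R}^d$, $d\in\{1,2,3\}$, be an open, smooth and bounded domain, and let $\varepsilon,\beta>0$. Fix masses $m_0,\dots,m_n>0$ with $\sum_{j=0}^n m_j=|\Omega|$. The admissible set is $$\mathcal{A}_m=\Big\{\boldsymbol{u}=(u_0,\dots,u_n)\in(L^\infty(\Omega))^{n+1}:\ u_i\ge0,\ \int_\Omega u_i\,dx=m_i\ (i=0,\dots,n),\ \sum_{j=0}^n u_j=1\text{ a.e. in }\Omega,\ u_0\in H^1(\Omega)\Big\}.$$ The energy functional $E:\mathcal{A}_m\to\mathbb{R}$ is $$E(\boldsymbol{u})=\int_\Omega\Big[\sum_{i=0}^n(u_i\ln u_i-u_i+1)+\frac{\varepsilon}{2}|\nabla u_0|^2+\beta u_0(1-u_0)\Big]dx,$$ with the convention $0\ln0=0$. A function $\boldsymbol{u}\in\mathcal{A}_m$ is a local minimizer of $E$ for the $L^\infty(\Omega)^{n+1}$ topology if there exists $\epsilon>0$ such that $E(\boldsymbol{v})\ge E(\boldsymbol{u})$ for all $\boldsymbol{v}\in\mathcal{A}_m$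 with $\max_{i=0,\dots,n}\|v_i-u_i\|_{L^\infty(\Omega)}\le\epsilon$. *)

theory Defs
  imports "HOL-Analysis.Analysis" "HOL-Probability.Essential_Supremum"
begin

primrec C_k :: "nat \<Rightarrow> ('a::euclidean_space \<Rightarrow> real) \<Rightarrow> bool" where
  "C_k 0 f \<longleftrightarrow> continuous_on UNIV f"
| "C_k (Suc k) f \<longleftrightarrow> f differentiable_on UNIV
     \<and> (\<forall>v. C_k k (\<lambda>x. frechet_derivative f (at x) v))"

definition C_infinity :: "('a::euclidean_space \<Rightarrow> real) \<Rightarrow> bool" where
  "C_infinity f \<longleftrightarrow> (\<forall>k. C_k k f)"

definition test_function :: "'a::euclidean_space set \<Rightarrow> ('a \<Rightarrow> real) \<Rightarrow> bool" where
  "test_function \<Omega> \<phi> \<longleftrightarrow>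
     C_infinity \<phi> \<and> compact (closure {x. \<phi> x \<noteq> 0}) \<and> closure {x. \<phi> x \<noteq> 0} \<subseteq> \<Omega>"

(* Near each boundary point the set is the strict supergraph of a smooth function, in
   coordinates rotated so that e is the last axis.  A function on the hyperplane
   orthogonal to e is represented by a function \<gamma> on the whole space that is only
   evaluated at orthogonal projections x - (x \<bullet> e) e. *)
definition smooth_boundary :: "'a::euclidean_space set \<Rightarrow> bool" where
  "smooth_boundary \<Omega> \<longleftrightarrow>
     (\<forall>p\<in>frontier \<Omega>. \<exists>r>0. \<exists>e \<gamma>. norm e = 1 \<and> C_infinity \<gamma> \<and>
        \<Omega> \<inter> ball p r = {x \<in> ball p r. x \<bullet> e > \<gamma> (x - (x \<bullet> e) *\<^sub>R e)})"

definition smooth_bounded_domain :: "'a::euclidean_space set \<Rightarrow> bool" where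
  "smooth_bounded_domain \<Omega> \<longleftrightarrow>
     open \<Omega> \<and> connected \<Omega> \<and> bounded \<Omega> \<and> smooth_boundary \<Omega>"

(* Elements of the function spaces below are represented by functions on the whole
   space; only their values almost everywhere in \<Omega> matter. *)

definition Linf_norm :: "'a::euclidean_space set \<Rightarrow> ('a \<Rightarrow> real) \<Rightarrow> ereal" where
  "Linf_norm \<Omega> f = esssup (lebesgue_on \<Omega>) (\<lambda>x. ereal \<bar>f x\<bar>)"

definition Linf :: "'a::euclidean_space set \<Rightarrow> ('a \<Rightarrow> real) set" where
  "Linf \<Omega> = {f \<in> borel_measurable (lebesgue_on \<Omega>). Linf_norm \<Omega> f < \<infinity>}"

definition L2 :: "'a::euclidean_space set \<Rightarrow> ('a \<Rightarrow> 'b::euclidean_space) set" where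
  "L2 \<Omega> = {f \<in> borel_measurable (lebesgue_on \<Omega>).
             integrable (lebesgue_on \<Omega>) (\<lambda>x. (norm (f x))\<^sup>2)}"

definition locally_integrable ::
    "'a::euclidean_space set \<Rightarrow> ('a \<Rightarrow> 'b::euclidean_space) \<Rightarrow> bool" where
  "locally_integrable \<Omega> f \<longleftrightarrow>
     (\<forall>K. compact K \<and> K \<subseteq> \<Omega> \<longrightarrow> integrable (lebesgue_on K) f)"

definition has_weak_gradient ::
    "'a::euclidean_space set \<Rightarrow> ('a \<Rightarrow> real) \<Rightarrow> ('a \<Rightarrow> 'a) \<Rightarrow> bool" where
  "has_weak_gradient \<Omega> f g \<longleftrightarrow>
     locally_integrable \<Omega> f \<and> locally_integrable \<Omega> g \<and>
     (\<forall>\<phi>. test_function \<Omega> \<phi> \<longrightarrow> (\<forall>b\<in>Basis.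
        (LINT x|lebesgue_on \<Omega>. f x * frechet_derivative \<phi> (at x) b)
          = - (LINT x|lebesgue_on \<Omega>. (g x \<bullet> b) * \<phi> x)))"

definition H1 :: "'a::euclidean_space set \<Rightarrow> ('a \<Rightarrow> real) set" where
  "H1 \<Omega> = {f \<in> L2 \<Omega>. \<exists>g\<in>L2 \<Omega>. has_weak_gradient \<Omega> f g}"

(* A representative of the weak gradient, which is unique up to null sets. *)
definition weak_gradient ::
    "'a::euclidean_space set \<Rightarrow> ('a \<Rightarrow> real) \<Rightarrow> 'a \<Rightarrow> 'a" where
  "weak_gradient \<Omega> f = (SOME g. has_weak_gradient \<Omega> f g)"

(* A tuple (u_0, ..., u_n) is a function of type nat => _ of which only the components
   with index at most n are constrained. *)
definition admissible ::
    "nat \<Rightarrow> 'a::euclidean_space set \<Rightarrow> (nat \<Rightarrow> real) \<Rightarrow> (nat \<Rightarrow> 'a \<Rightarrow> real) set" where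
  "admissible n \<Omega> m = {u.
     (\<forall>i\<le>n. u i \<in> Linf \<Omega>
         \<and> (AE x in lebesgue_on \<Omega>. u i x \<ge> 0)
         \<and> (LINT x|lebesgue_on \<Omega>. u i x) = m i)
     \<and> (AE x in lebesgue_on \<Omega>. (\<Sum>j\<le>n. u j x) = 1)
     \<and> u 0 \<in> H1 \<Omega>}"

(* The convention 0 ln 0 = 0 is automatic, as 0 * ln 0 = 0. *)
definition energy ::
    "nat \<Rightarrow> 'a::euclidean_space set \<Rightarrow> real \<Rightarrow> real \<Rightarrow> (nat \<Rightarrow> 'a \<Rightarrow> real) \<Rightarrow> real" where
  "energy n \<Omega> \<epsilon> \<beta> u =
     (LINT x|lebesgue_on \<Omega>.
        (\<Sum>i\<le>n. u i x * ln (u i x) - u i x + 1)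
        + \<epsilon> / 2 * (norm (weak_gradient \<Omega> (u 0) x))\<^sup>2
        + \<beta> * u 0 x * (1 - u 0 x))"

definition Linf_local_minimizer ::
    "nat \<Rightarrow> 'a::euclidean_space set \<Rightarrow> (nat \<Rightarrow> real) \<Rightarrow> real \<Rightarrow> real \<Rightarrow> (nat \<Rightarrow> 'a \<Rightarrow> real) \<Rightarrow> bool"
  where
  "Linf_local_minimizer n \<Omega> m \<epsilon> \<beta> u \<longleftrightarrow>
     u \<in> admissible n \<Omega> m \<and>
     (\<exists>\<eta>>0. \<forall>v\<in>admissible n \<Omega> m.
        (MAX i\<in>{..n}. Linf_norm \<Omega> (\<lambda>x. v i x - u i x)) \<le> ereal \<eta>
          \<longrightarrow> energy n \<Omega> \<epsilon> \<beta> v \<ge> energy n \<Omega> \<epsilon> \<beta> u)"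

end

theory Submission
  imports Defs "HOL-Real_Asymp.Real_Asymp"
begin

text \<open>
  The entropy is infinitely steep where a component vanishes, so a minimizer profits from moving a
  little mass to the places where a component is almost absent.  Three things have to be checked:
  that this can be done without raising the Dirichlet energy of \<open>u\<^sub>0\<close>, that it respects the masses,
  and that it yields a bound independent of the minimizer.

  The components \<open>u\<^sub>1, \<dots>, u\<^sub>n\<close> enter the energy only through the entropy.  For fixed \<open>u\<^sub>0\<close> the energy
  is convex in them, so a local minimizer is at least as good as the proportional distribution
  \<open>u\<^sub>i = c\<^sub>i (1 - u\<^sub>0)\<close>, \<open>c\<^sub>i = m\<^sub>i / (m\<^sub>1 + \<dots> + m\<^sub>n)\<close>, which has the same masses.  Under the mass
  constraints the difference of the two entropies is the integral of a relative entropy, hence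
  nonnegative, and it vanishes only if both distributions agree almost everywhere
  (\<open>minimizer_split_profile\<close>).  What remains is a problem for \<open>u\<^sub>0\<close> alone, with the bulk energy
  \<open>F(x) = x ln x + (1 - x) ln (1 - x) + \<beta> x (1 - x)\<close> (\<open>mixing_density\<close>).

  The competitors for \<open>u\<^sub>0\<close> are \<open>p(u\<^sub>0)\<close> for polynomials \<open>p\<close> that map the unit interval to itself,
  are close to the identity, preserve the mass of \<open>u\<^sub>0\<close> and satisfy \<open>\<bar>p'\<bar> \<le> 1\<close> there.  By the chain
  rule \<open>\<nabla>p(u\<^sub>0) = p'(u\<^sub>0) \<nabla>u\<^sub>0\<close> they do not raise the Dirichlet energy, whence
  \<open>\<integral>F(u\<^sub>0) \<le> \<integral>F(p(u\<^sub>0))\<close> (\<open>minimizer_poly_stable\<close>).  The polynomial used is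
  \<open>p(x) = x + t ((1 - x)^N - B x)\<close>, with \<open>B\<close> fixed by the mass constraint and \<open>t\<close> small.  For large
  \<open>N\<close> the power adds mass where \<open>u\<^sub>0\<close> is smallest, which pays roughly \<open>- ln u\<^sub>0\<close> per unit of mass;
  the term \<open>B x\<close> takes it back in proportion to \<open>u\<^sub>0\<close>, at a cost per unit of mass that is bounded in
  terms of \<open>\<beta>\<close>, the volume and the mass of \<open>u\<^sub>0\<close>, since \<open>x F'(x)\<close> is bounded below on the unit interval.
  So \<open>u\<^sub>0\<close> cannot go below an explicit threshold on a set of positive measure
  (\<open>poly_stable_power_estimate\<close>, \<open>poly_stable_lower_bound\<close>).  As \<open>F(x) = F(1 - x)\<close>, the same
  argument bounds \<open>1 - u\<^sub>0\<close>, and with it the other components.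

  Weak gradients are defined through smooth test functions and a choice of representative.  The
  argument therefore rests on two facts about them: uniqueness (\<open>has_weak_gradient_unique\<close>) and the
  chain rule for polynomials (\<open>has_weak_gradient_poly\<close>), which follows from the product rule
  (\<open>weak_partial_mult\<close>).  Uniqueness and product rule are obtained by mollification, with limits
  justified by the continuity of translations in \<open>L\<^sup>1\<close>.
\<close>

section \<open>Smooth functions and mollifiers\<close>

text \<open>
  The recursion in \<open>C_k\<close> speaks about the \<open>frechet_derivative\<close> of a function that is differentiable;
  this rule establishes both parts at once from an explicitly given derivative.
\<close>

lemma C_k_SucI:
  assumes "\<And>x. (f has_derivative f' x) (at x)" "\<And>v. C_k k (\<lambda>x. f' x v)"
  shows "C_k (Suc k) f"
proof -
  have "frechet_derivative f (at x) = f' x" for x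
    using frechet_derivative_at[OF assms(1)] by simp
  moreover have "f differentiable_on UNIV"
    using assms(1) by (auto simp: differentiable_on_def differentiable_def)
  ultimately show ?thesis
    using assms(2) by simp
qed

lemma C_k_SucD:
  assumes "C_k (Suc k) f"
  shows "(f has_derivative frechet_derivative f (at x)) (at x)"
    and "C_k k (\<lambda>x. frechet_derivative f (at x) v)"
  using assms frechet_derivative_works
  by (auto simp: differentiable_on_def)

lemma C_k_Suc_imp: "C_k (Suc k) f \<Longrightarrow> C_k k f"
proof (induction k arbitrary: f)
  case 0
  then show ?case by (auto intro: differentiable_imp_continuous_on)
next
  case (Suc k)
  then show ?case
    by (meson C_k.simps(2))
qed

lemma C_k_const: "C_k k (\<lambda>x. c)"
proof (induction k arbitrary: c)
  case (Suc k)
  show ?case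
    by (rule C_k_SucI[where f' = "\<lambda>x v. 0"]) (use Suc in \<open>auto intro!: derivative_eq_intros\<close>)
qed simp

lemma C_k_add: "C_k k f \<Longrightarrow> C_k k g \<Longrightarrow> C_k k (\<lambda>x. f x + g x)"
proof (induction k arbitrary: f g)
  case 0
  then show ?case by (auto intro: continuous_intros)
next
  case (Suc k)
  show ?case
    by (rule C_k_SucI[OF has_derivative_add[OF C_k_SucD(1)[OF Suc.prems(1)] C_k_SucD(1)[OF Suc.prems(2)]]])
       (intro Suc.IH C_k_SucD(2) Suc.prems)
qed

lemma C_k_mult: "C_k k f \<Longrightarrow> C_k k g \<Longrightarrow> C_k k (\<lambda>x. f x * g x)"
proof (induction k arbitrary: f g)
  case 0
  then show ?case by (auto intro: continuous_intros)
next
  case (Suc k)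
  show ?case
    by (rule C_k_SucI[OF has_derivative_mult[OF C_k_SucD(1)[OF Suc.prems(1)] C_k_SucD(1)[OF Suc.prems(2)]]])
       (intro C_k_add Suc.IH C_k_SucD(2) Suc.prems C_k_Suc_imp[OF Suc.prems(1)] C_k_Suc_imp[OF Suc.prems(2)])
qed

lemma C_k_affine:
  fixes f :: "'a::euclidean_space \<Rightarrow> real"
  shows "C_k k f \<Longrightarrow> C_k k (\<lambda>x. f (c *\<^sub>R x + p))"
proof (induction k arbitrary: f)
  case 0
  then have "continuous_on UNIV f" by simp
  then show ?case
    by (auto intro!: continuous_on_compose2[of UNIV f] continuous_intros)
next
  case (Suc k)
  have d: "((\<lambda>x. f (c *\<^sub>R x + p)) has_derivative (\<lambda>v. frechet_derivative f (at (c *\<^sub>R x + p)) (c *\<^sub>R v))) (at x)"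
    for x
    by (rule has_derivative_compose[OF _ C_k_SucD(1)[OF Suc.prems], where f = "\<lambda>x. c *\<^sub>R x + p" and f' = "\<lambda>v. c *\<^sub>R v"])
       (auto intro!: derivative_eq_intros)
  show ?case
    by (rule C_k_SucI[OF d]) (rule Suc.IH[OF C_k_SucD(2)[OF Suc.prems]])
qed

lemma C_k_inner: "C_k k (\<lambda>x::'a::euclidean_space. x \<bullet> w)"
proof (cases k)
  case (Suc j)
  show ?thesis
    unfolding Suc
    by (rule C_k_SucI[where f' = "\<lambda>x v. v \<bullet> w"]) (auto intro!: derivative_eq_intros C_k_const)
qed (auto intro: continuous_intros)

text \<open>
  The derivatives of \<open>exp (-1/t)\<close> are combinations of the functions \<open>exp (-1/t) / t ^ n\<close>, so this family
  is closed under differentiation and smoothness follows by induction.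
\<close>

definition flat :: "nat \<Rightarrow> real \<Rightarrow> real" where
  "flat n t = (if t > 0 then exp (- 1 / t) / t ^ n else 0)"

lemma flat_tendsto_0: "(flat n \<longlongrightarrow> 0) (at 0)"
proof -
  have "((\<lambda>t::real. exp (- 1 / t) / t ^ n) \<longlongrightarrow> 0) (at_right 0)"
    by real_asymp
  then have "(flat n \<longlongrightarrow> 0) (at_right 0)"
    by (rule Lim_transform_eventually)
       (auto simp: flat_def eventually_at_filter)
  moreover have "(flat n \<longlongrightarrow> 0) (at_left 0)"
    by (rule Lim_transform_eventually[OF tendsto_const])
       (auto simp: flat_def eventually_at_filter)
  ultimately show ?thesis
    by (simp add: filterlim_split_at)
qed

lemma flat_has_derivative:
  "(flat n has_real_derivative flat (n + 2) t - real n * flat (n + 1) t) (at t)"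
proof -
  consider "t > 0" | "t = 0" | "t < 0" by linarith
  then show ?thesis
  proof cases
    case 1
    have "((\<lambda>t. exp (- 1 / t) / t ^ n) has_real_derivative flat (n + 2) t - real n * flat (n + 1) t) (at t)"
      using 1
      apply (auto intro!: derivative_eq_intros simp: flat_def)
      apply (cases n)
       apply (auto simp: field_simps power2_eq_square)
      done
    then show ?thesis
      by (rule has_field_derivative_transform_within_open[where S = "{0<..}"])
         (use 1 in \<open>auto simp: flat_def\<close>)
  next
    case 2
    have "((\<lambda>h. (flat n (0 + h) - flat n 0) / h) \<longlongrightarrow> 0) (at 0)"
      by (rule Lim_transform_eventually[OF flat_tendsto_0[of "Suc n"]])
         (auto simp: flat_def eventually_at_filter field_simps)
    then show ?thesis
      using 2 by (simp add: DERIV_def flat_def)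
  next
    case 3
    have "((\<lambda>t. 0) has_real_derivative flat (n + 2) t - real n * flat (n + 1) t) (at t)"
      using 3 by (auto intro!: derivative_eq_intros simp: flat_def)
    then show ?thesis
      by (rule has_field_derivative_transform_within_open[where S = "{..<0}"])
         (use 3 in \<open>auto simp: flat_def\<close>)
  qed
qed

lemma C_k_flat: "C_k k (\<lambda>x::'a::euclidean_space. flat n (1 - x \<bullet> x))"
proof (induction k arbitrary: n)
  case 0
  have "continuous_on UNIV (flat n)"
    by (meson DERIV_isCont continuous_at_imp_continuous_on flat_has_derivative)
  then show ?case
    by (auto intro!: continuous_on_compose2[of UNIV "flat n"] continuous_intros)
next
  case (Suc k)
  have d: "((\<lambda>x::'a. flat n (1 - x \<bullet> x)) has_derivative
          (\<lambda>v. (flat (n + 2) (1 - x \<bullet> x) + (- real n) * flat (n + 1) (1 - x \<bullet> x)) * ((- 2) * (x \<bullet> v)))) (at x)" for x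
  proof -
    have "((\<lambda>x::'a. 1 - x \<bullet> x) has_derivative (\<lambda>v. (- 2) * (x \<bullet> v))) (at x)"
      by (auto intro!: derivative_eq_intros simp: inner_commute)
    from has_derivative_compose[OF this flat_has_derivative[of n, THEN has_field_derivative_imp_has_derivative]]
    show ?thesis by (simp add: algebra_simps)
  qed
  show ?case
    by (rule C_k_SucI[OF d]) (intro C_k_mult C_k_add C_k_const C_k_inner Suc.IH)
qed


lemma C_infinity_mult: "C_infinity f \<Longrightarrow> C_infinity g \<Longrightarrow> C_infinity (\<lambda>x. f x * g x)"
  by (simp add: C_infinity_def C_k_mult)

lemma C_infinity_affine: "C_infinity f \<Longrightarrow> C_infinity (\<lambda>x. f (c *\<^sub>R x + p))"
  by (simp add: C_infinity_def C_k_affine)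

lemma C_infinity_continuous: "C_infinity f \<Longrightarrow> continuous_on UNIV f"
  using C_k.simps(1) C_infinity_def by blast

lemma C_infinity_has_derivative:
  "C_infinity f \<Longrightarrow> (f has_derivative frechet_derivative f (at x)) (at x)"
  using C_k_SucD(1) C_infinity_def by blast

lemma C_infinity_continuous_derivative:
  "C_infinity f \<Longrightarrow> continuous_on UNIV (\<lambda>x. frechet_derivative f (at x) v)"
  using C_k_SucD(2)[of 0 f] C_infinity_def C_k.simps(1) by blast

lemma frechet_derivative_mult:
  assumes "C_infinity f" "C_infinity g"
  shows "frechet_derivative (\<lambda>x. f x * g x) (at x) v
      = f x * frechet_derivative g (at x) v + frechet_derivative f (at x) v * g x"
  using frechet_derivative_at[OF has_derivative_mult[OF C_infinity_has_derivative[OF assms(1)] C_infinity_has_derivative[OF assms(2)]], of x, symmetric]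
  by simp

lemma frechet_derivative_affine:
  assumes "C_infinity f"
  shows "frechet_derivative (\<lambda>x. f (c *\<^sub>R x + p)) (at x) v = c * frechet_derivative f (at (c *\<^sub>R x + p)) v"
proof -
  have "((\<lambda>x. f (c *\<^sub>R x + p)) has_derivative (\<lambda>v. frechet_derivative f (at (c *\<^sub>R x + p)) (c *\<^sub>R v))) (at x)"
    by (rule has_derivative_compose[OF _ C_infinity_has_derivative[OF assms], where f = "\<lambda>x. c *\<^sub>R x + p" and f' = "\<lambda>v. c *\<^sub>R v"])
       (auto intro!: derivative_eq_intros)
  from frechet_derivative_at[OF this]
  have "frechet_derivative (\<lambda>x. f (c *\<^sub>R x + p)) (at x) v = frechet_derivative f (at (c *\<^sub>R x + p)) (c *\<^sub>R v)"
    by metis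
  moreover have "linear (frechet_derivative f (at (c *\<^sub>R x + p)))"
    using C_infinity_has_derivative[OF assms] by (rule has_derivative_linear)
  ultimately show ?thesis
    by (simp add: linear_cmul)
qed

lemma test_functionI:
  assumes "C_infinity \<phi>" "compact K" "K \<subseteq> \<Omega>" "\<And>x. x \<notin> K \<Longrightarrow> \<phi> x = 0"
  shows "test_function \<Omega> \<phi>"
proof -
  have "closure {x. \<phi> x \<noteq> 0} \<subseteq> K"
    using assms by (intro closure_minimal compact_imp_closed) auto
  then show ?thesis
    using assms compact_closure bounded_subset[OF compact_imp_bounded[OF assms(2)]]
    unfolding test_function_def by (meson bounded_subset closure_subset order_trans compact_imp_bounded)
qed

lemma derivative_eq_0_outside_support:
  assumes "x \<notin> closure {x. f x \<noteq> 0}"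
  shows "frechet_derivative f (at x) v = (0::real)"
proof -
  have "((\<lambda>x. 0::real) has_derivative (\<lambda>v. 0)) (at x)" by simp
  then have "(f has_derivative (\<lambda>v. 0)) (at x)"
    by (rule has_derivative_transform_within_open[where s = "- closure {x. f x \<noteq> 0}"])
       (use assms closure_subset[of "{x. f x \<noteq> 0}"] in \<open>auto simp: open_Compl\<close>)
  from frechet_derivative_at[OF this] show ?thesis by metis
qed

lemma continuous_compact_support_bounded:
  fixes f :: "'a::euclidean_space \<Rightarrow> real"
  assumes "continuous_on UNIV f" "compact K" "\<And>x. x \<notin> K \<Longrightarrow> f x = 0"
  obtains B where "B > 0" "\<And>x. \<bar>f x\<bar> \<le> B"
proof -
  have "compact (f ` K)"
    using assms by (meson compact_continuous_image continuous_on_subset top_greatest)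
  then obtain B where "B > 0" "\<And>x. x \<in> K \<Longrightarrow> norm (f x) \<le> B"
    using compact_imp_bounded[of "f ` K"] unfolding bounded_pos by auto
  then show ?thesis
    using assms(3) that[of B] by (metis abs_zero less_imp_le real_norm_def)
qed

lemma continuous_compact_support_integrable:
  fixes f :: "'a::euclidean_space \<Rightarrow> real"
  assumes "continuous_on UNIV f" "compact K" "\<And>x. x \<notin> K \<Longrightarrow> f x = 0"
  shows "integrable lborel f"
proof -
  have "integrable lborel (\<lambda>x. indicator K x *\<^sub>R f x)"
    by (rule borel_integrable_compact) (use assms continuous_on_subset in blast)+
  also have "(\<lambda>x. indicator K x *\<^sub>R f x) = f"
    by (rule ext) (use assms(3) in \<open>auto simp: indicator_def\<close>)
  finally show ?thesis .
qed

text \<open>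
  The symmetry makes convolution with \<open>\<rho>\<close> self-adjoint, so that it does not matter which of the two
  factors of a pairing is regarded as the mollified one.
\<close>

definition mollifier :: "real \<Rightarrow> ('a::euclidean_space \<Rightarrow> real) \<Rightarrow> bool" where
  "mollifier r \<rho> \<longleftrightarrow> C_infinity \<rho> \<and> (\<forall>x. 0 \<le> \<rho> x) \<and> (\<forall>x. \<rho> (- x) = \<rho> x) \<and> (\<forall>x. r \<le> norm x \<longrightarrow> \<rho> x = 0)
     \<and> (LINT x|lborel. \<rho> x) = 1"

lemma mollifier_exists:
  assumes "r > 0"
  shows "\<exists>\<rho> :: 'a::euclidean_space \<Rightarrow> real. mollifier r \<rho>"
proof -
  define \<sigma> :: "'a \<Rightarrow> real" where "\<sigma> = (\<lambda>x. flat 0 (1 - ((1 / r) *\<^sub>R x + 0) \<bullet> ((1 / r) *\<^sub>R x + 0)))"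
  have smooth: "C_infinity \<sigma>"
    unfolding \<sigma>_def C_infinity_def by (intro allI C_k_affine[of _ "\<lambda>x. flat 0 (1 - x \<bullet> x)"] C_k_flat)
  have nn: "0 \<le> \<sigma> x" for x
    by (simp add: \<sigma>_def flat_def)
  have eq: "((1 / r) *\<^sub>R x + 0) \<bullet> ((1 / r) *\<^sub>R x + 0) = (norm x / r)\<^sup>2" for x :: 'a
    by (simp add: dot_square_norm power_divide power2_eq_square)
  have out: "\<sigma> x = 0" if "r \<le> norm x" for x
  proof -
    have "1 \<le> norm x / r" using that assms by simp
    then have "1 \<le> (norm x / r)\<^sup>2" by (simp add: one_le_power)
    then show ?thesis unfolding \<sigma>_def eq flat_def by simp
  qed
  have pos: "\<sigma> x > 0" if "norm x < r" for x
  proof -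
    have "norm x / r < 1" using that assms by simp
    then have "(norm x / r)\<^sup>2 < 1" using assms by (simp add: power_less_one_iff abs_square_less_1)
    then show ?thesis unfolding \<sigma>_def eq flat_def by simp
  qed
  have even: "\<sigma> (- x) = \<sigma> x" for x
    unfolding \<sigma>_def eq by simp
  have int: "integrable lborel \<sigma>"
    by (rule continuous_compact_support_integrable[OF C_infinity_continuous[OF smooth], of "cball 0 r"])
       (use out in auto)
  have "(LINT x|lborel. \<sigma> x) \<noteq> 0"
  proof
    assume "(LINT x|lborel. \<sigma> x) = 0"
    then have "AE x in lborel. \<sigma> x = 0"
      using integral_nonneg_eq_0_iff_AE[OF int] nn by simp
    then have "AE x in lborel. x \<notin> ball (0::'a) r"
      by eventually_elim (use pos in force)
    then have "emeasure lborel (ball (0::'a) r) = 0"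
      by (subst (asm) AE_iff_measurable[of "ball 0 r"]) auto
    then have "measure lebesgue (ball (0::'a) r) = 0"
      by (simp add: measure_def)
    then show False
      using content_ball_pos[of r "0::'a"] assms by simp
  qed
  then have I: "(LINT x|lborel. \<sigma> x) > 0"
    using integral_nonneg_AE[of \<sigma> lborel] nn by fastforce
  have "mollifier r (\<lambda>x. inverse (LINT x|lborel. \<sigma> x) * \<sigma> x)"
    unfolding mollifier_def
    using nn out even I smooth C_k_const by (auto simp: C_infinity_def intro!: C_k_mult)
  then show ?thesis by blast
qed

section \<open>Continuity of translations in the space of integrable functions\<close>

lemma
  fixes f :: "'a::euclidean_space \<Rightarrow> real"
  shows integrable_translate_iff: "f \<in> borel_measurable borel \<Longrightarrow> integrable lborel (\<lambda>x. f (x + z)) \<longleftrightarrow> integrable lborel f"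
    and integral_translate: "f \<in> borel_measurable borel \<Longrightarrow> (LINT x|lborel. f (x + z)) = (LINT x|lborel. f x)"
proof -
  assume f: "f \<in> borel_measurable borel"
  show "integrable lborel (\<lambda>x. f (x + z)) \<longleftrightarrow> integrable lborel f"
    using integrable_distr_eq[of "(+) z" lborel borel f] f by (simp add: lborel_distr_plus add.commute)
  show "(LINT x|lborel. f (x + z)) = (LINT x|lborel. f x)"
    using integral_distr[of "(+) z" lborel borel f] f by (simp add: lborel_distr_plus add.commute)
qed

lemma integrable_translate:
  fixes f :: "'a::euclidean_space \<Rightarrow> real"
  shows "integrable lborel f \<Longrightarrow> integrable lborel (\<lambda>x. f (x + z))"
  using integrable_translate_iff[of f z] borel_measurable_integrable[of lborel f] by simp

definition L1_shift :: "('a::euclidean_space \<Rightarrow> real) \<Rightarrow> 'a \<Rightarrow> real" where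
  "L1_shift a z = (LINT x|lborel. \<bar>a (x + z) - a x\<bar>)"

lemma L1_shift_triangle:
  assumes "integrable lborel a" "integrable lborel b"
  shows "L1_shift a z \<le> L1_shift b z + 2 * (LINT x|lborel. \<bar>a x - b x\<bar>)"
proof -
  have i: "integrable lborel (\<lambda>x. a (x + z))" "integrable lborel (\<lambda>x. b (x + z))"
    using assms integrable_translate by blast+
  have "L1_shift a z \<le> (LINT x|lborel. \<bar>b (x + z) - b x\<bar> + (\<bar>a (x + z) - b (x + z)\<bar> + \<bar>a x - b x\<bar>))"
    unfolding L1_shift_def
    by (rule integral_mono) (use assms i in auto)
  also have "\<dots> = L1_shift b z + ((LINT x|lborel. \<bar>a (x + z) - b (x + z)\<bar>) + (LINT x|lborel. \<bar>a x - b x\<bar>))"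
    using assms i by (simp add: L1_shift_def)
  also have "(LINT x|lborel. \<bar>a (x + z) - b (x + z)\<bar>) = (LINT x|lborel. \<bar>a x - b x\<bar>)"
    using integral_translate[of "\<lambda>x. \<bar>a x - b x\<bar>" z] assms by simp
  finally show ?thesis by simp
qed

lemma L1_shift_nonneg: "0 \<le> L1_shift a z"
  unfolding L1_shift_def by simp

lemma L1_shift_tendsto_approx:
  assumes a: "integrable lborel a"
    and appr: "\<And>e. e > 0 \<Longrightarrow> \<exists>b. integrable lborel b \<and> (\<lambda>n. L1_shift b (z n)) \<longlonglongrightarrow> 0
          \<and> (LINT x|lborel. \<bar>a x - b x\<bar>) < e"
  shows "(\<lambda>n. L1_shift a (z n)) \<longlonglongrightarrow> 0"
proof (rule LIMSEQ_I)
  fix r :: real assume "r > 0"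
  then obtain b where b: "integrable lborel b" "(\<lambda>n. L1_shift b (z n)) \<longlonglongrightarrow> 0"
    "(LINT x|lborel. \<bar>a x - b x\<bar>) < r / 4"
    using appr[of "r / 4"] by auto
  obtain N where N: "\<And>n. n \<ge> N \<Longrightarrow> norm (L1_shift b (z n) - 0) < r / 2"
    using LIMSEQ_D[OF b(2), of "r / 2"] \<open>r > 0\<close> by auto
  have "norm (L1_shift a (z n) - 0) < r" if "n \<ge> N" for n
    using L1_shift_triangle[OF a b(1), of "z n"] b(3) N[OF that] L1_shift_nonneg[of a "z n"] by simp
  then show "\<exists>no. \<forall>n\<ge>no. norm (L1_shift a (z n) - 0) < r" by blast
qed

text \<open>
  Openness gives \<open>indicator U (x + z n) \<longlonglongrightarrow> indicator U x\<close> for every \<open>x \<in> U\<close>, which controls only the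
  overlap of \<open>U\<close> and its translates.  That is enough: \<open>U\<close> and its translates have equal measure,
  so the symmetric difference is small when the overlap is almost all of \<open>U\<close>.
\<close>

lemma L1_shift_indicator_open:
  fixes U :: "'a::euclidean_space set"
  assumes U: "open U" "emeasure lborel U < \<infinity>" and z: "z \<longlonglongrightarrow> 0"
  shows "(\<lambda>n. L1_shift (indicator U) (z n)) \<longlonglongrightarrow> 0"
proof -
  let ?i = "indicator U :: 'a \<Rightarrow> real"
  have [measurable]: "U \<in> sets borel" using U by auto
  have int: "integrable lborel ?i" using U by simp
  have int2: "integrable lborel (\<lambda>x. ?i (x + y))" for y
    using integrable_translate[OF int] .
  have int3: "integrable lborel (\<lambda>x. ?i (x + y) * ?i x)" for y
    by (rule Bochner_Integration.integrable_bound[OF int]) (auto simp: indicator_def)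
  have eq: "L1_shift ?i y = 2 * (LINT x|lborel. ?i x) - 2 * (LINT x|lborel. ?i (x + y) * ?i x)" for y
  proof -
    have "L1_shift ?i y = (LINT x|lborel. ?i (x + y) + ?i x - 2 * (?i (x + y) * ?i x))"
      unfolding L1_shift_def by (rule Bochner_Integration.integral_cong) (auto simp: indicator_def)
    also have "\<dots> = (LINT x|lborel. ?i (x + y)) + (LINT x|lborel. ?i x) - 2 * (LINT x|lborel. ?i (x + y) * ?i x)"
      using int int2 int3 by simp
    also have "(LINT x|lborel. ?i (x + y)) = (LINT x|lborel. ?i x)"
      by (rule integral_translate) simp
    finally show ?thesis by simp
  qed
  have "(\<lambda>n. LINT x|lborel. ?i (x + z n) * ?i x) \<longlonglongrightarrow> (LINT x|lborel. ?i x)"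
  proof (rule integral_dominated_convergence[where w = ?i])
    show "AE x in lborel. (\<lambda>n. ?i (x + z n) * ?i x) \<longlonglongrightarrow> ?i x"
    proof (rule AE_I2)
      fix x :: 'a
      show "(\<lambda>n. ?i (x + z n) * ?i x) \<longlonglongrightarrow> ?i x"
      proof (cases "x \<in> U")
        case True
        have "(\<lambda>n. x + z n) \<longlonglongrightarrow> x + 0" by (intro tendsto_intros z)
        then have "eventually (\<lambda>n. x + z n \<in> U) sequentially"
          using U(1) True by (simp add: topological_tendstoD)
        then have "eventually (\<lambda>n. 1 = ?i (x + z n) * ?i x) sequentially"
          by eventually_elim (use True in simp)
        from Lim_transform_eventually[OF tendsto_const this] show ?thesis using True by simp
      qed simp
    qed
  qed (use int in \<open>auto simp: indicator_def\<close>)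
  from tendsto_diff[OF tendsto_const tendsto_mult[OF tendsto_const this], of "2 * (LINT x|lborel. ?i x)" 2]
  show ?thesis unfolding eq by simp
qed

text \<open>
  Indicators of Borel sets are approximated by those of open sets through outer regularity; sums and
  dominated limits preserve the property.
\<close>

lemma L1_shift_tendsto:
  fixes a :: "'a::euclidean_space \<Rightarrow> real"
  assumes "integrable lborel a" and z: "z \<longlonglongrightarrow> 0"
  shows "(\<lambda>n. L1_shift a (z n)) \<longlonglongrightarrow> 0"
  using assms(1)
proof (induction a rule: integrable_induct)
  case (base A c)
  then have [measurable]: "A \<in> sets borel" by simp
  have fin: "emeasure lborel A < \<infinity>" using base by simp
  show ?case
  proof (rule L1_shift_tendsto_approx)
    show int: "integrable lborel (\<lambda>x. indicat_real A x *\<^sub>R c)" using fin by simp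
    fix e :: real assume e: "e > 0"
    define e' where "e' = e / (\<bar>c\<bar> + 1)"
    have e': "e' > 0" using e by (simp add: e'_def)
    obtain U where U: "open U" "A \<subseteq> U" "emeasure lborel (U - A) < e'"
      using outer_regular_lborel[of A e'] e' by auto
    have [measurable]: "U \<in> sets borel" using U by auto
    have "emeasure lborel U = emeasure lborel (U - A) + emeasure lborel A"
      using U(2) by (subst plus_emeasure) (auto intro!: arg_cong[where f = "emeasure lborel"])
    then have finU: "emeasure lborel U < \<infinity>"
      using U(3) fin by (metis ennreal_add_less_top less_top_ennreal infinity_ennreal_def less_trans ennreal_less_top)
    have "L1_shift (\<lambda>x. indicat_real U x *\<^sub>R c) y = L1_shift (indicat_real U) y * \<bar>c\<bar>" for y
      unfolding L1_shift_def
      by (subst integral_mult_left_zero[symmetric]) (auto simp: abs_mult[symmetric] left_diff_distrib)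
    then have lim: "(\<lambda>n. L1_shift (\<lambda>x. indicat_real U x *\<^sub>R c) (z n)) \<longlonglongrightarrow> 0"
      using tendsto_mult_right[OF L1_shift_indicator_open[OF U(1) finU z], of "\<bar>c\<bar>"] by simp
    have "(LINT x|lborel. \<bar>indicat_real A x *\<^sub>R c - indicat_real U x *\<^sub>R c\<bar>)
        = (LINT x|lborel. indicat_real (U - A) x * \<bar>c\<bar>)"
      using U(2) by (intro Bochner_Integration.integral_cong) (auto simp: indicator_def)
    also have "\<dots> = measure lborel (U - A) * \<bar>c\<bar>" by simp
    also have "\<dots> \<le> e' * \<bar>c\<bar>"
    proof -
      have "measure lborel (U - A) \<le> e'"
        using U(3) e' unfolding measure_def
        by (metis enn2real_leI less_imp_le)
      then show ?thesis by (simp add: mult_right_mono)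
    qed
    also have "\<dots> < e"
      using e by (simp add: e'_def field_simps)
    finally show "\<exists>b. integrable lborel b \<and> (\<lambda>n. L1_shift b (z n)) \<longlonglongrightarrow> 0 \<and>
          (LINT x|lborel. \<bar>indicat_real A x *\<^sub>R c - b x\<bar>) < e"
      using finU lim by (intro exI[of _ "\<lambda>x. indicat_real U x *\<^sub>R c"]) simp
  qed
next
  case (add f g)
  have "L1_shift (\<lambda>x. f x + g x) y \<le> L1_shift f y + L1_shift g y" for y
  proof -
    have i: "integrable lborel (\<lambda>x. f (x + y))" "integrable lborel (\<lambda>x. g (x + y))"
      using add integrable_translate by blast+
    have "L1_shift (\<lambda>x. f x + g x) y \<le> (LINT x|lborel. \<bar>f (x + y) - f x\<bar> + \<bar>g (x + y) - g x\<bar>)"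
      unfolding L1_shift_def by (rule integral_mono) (use add i in auto)
    also have "\<dots> = L1_shift f y + L1_shift g y"
      using add i by (simp add: L1_shift_def)
    finally show ?thesis .
  qed
  moreover have "(\<lambda>n. L1_shift f (z n) + L1_shift g (z n)) \<longlonglongrightarrow> 0"
    using tendsto_add[OF add.IH] by simp
  ultimately show ?case
    using tendsto_sandwich[of "\<lambda>n. 0" "\<lambda>n. L1_shift (\<lambda>x. f x + g x) (z n)" sequentially "\<lambda>n. L1_shift f (z n) + L1_shift g (z n)" 0]
    by (simp add: L1_shift_nonneg)
next
  case (lim f s)
  show ?case
  proof (rule L1_shift_tendsto_approx[OF \<open>integrable lborel f\<close>])
    fix e :: real assume e: "e > 0"
    have "(\<lambda>i. LINT x|lborel. \<bar>f x - s i x\<bar>) \<longlonglongrightarrow> (LINT (x::'a)|lborel. 0::real)"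
    proof (rule integral_dominated_convergence[where w = "\<lambda>x. 3 * \<bar>f x\<bar>"])
      show "AE x in lborel. (\<lambda>i. \<bar>f x - s i x\<bar>) \<longlonglongrightarrow> 0"
      proof (rule AE_I2)
        fix x :: 'a
        have "(\<lambda>i. s i x) \<longlonglongrightarrow> f x" using lim by simp
        from tendsto_rabs[OF tendsto_diff[OF tendsto_const this], of "f x"]
        show "(\<lambda>i. \<bar>f x - s i x\<bar>) \<longlonglongrightarrow> 0" by simp
      qed
      show "AE x in lborel. norm \<bar>f x - s i x\<bar> \<le> 3 * \<bar>f x\<bar>" for i
      proof (rule AE_I2)
        fix x :: 'a
        have "norm (s i x) \<le> 2 * norm (f x)" using lim by simp
        then show "norm \<bar>f x - s i x\<bar> \<le> 3 * \<bar>f x\<bar>" by simp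
      qed
    qed (use lim in auto)
    from LIMSEQ_D[OF this e] obtain i where "norm ((LINT x|lborel. \<bar>f x - s i x\<bar>) - (LINT (x::'a)|lborel. (0::real))) < e"
      by auto
    then show "\<exists>b. integrable lborel b \<and> (\<lambda>n. L1_shift b (z n)) \<longlonglongrightarrow> 0 \<and> (LINT x|lborel. \<bar>f x - b x\<bar>) < e"
      using lim by (intro exI[of _ "s i"]) simp
  qed
qed

lemma L1_shift_small:
  fixes a :: "'a::euclidean_space \<Rightarrow> real"
  assumes "integrable lborel a" "e > 0"
  obtains r where "r > 0" "\<And>z. norm z < r \<Longrightarrow> L1_shift a z < e"
proof -
  have "((\<lambda>z. L1_shift a z) \<longlongrightarrow> 0) (at 0)"
    unfolding tendsto_at_iff_sequentially using L1_shift_tendsto[OF assms(1)] by (auto simp: o_def)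
  then have "eventually (\<lambda>z. dist (L1_shift a z) 0 < e) (at 0)"
    using assms(2) tendstoD by blast
  then obtain r where r: "r > 0" "\<And>z. z \<noteq> 0 \<Longrightarrow> norm z < r \<Longrightarrow> \<bar>L1_shift a z\<bar> < e"
    by (auto simp: eventually_at)
  moreover have "L1_shift a 0 = 0" by (simp add: L1_shift_def)
  ultimately have "L1_shift a z < e" if "norm z < r" for z
    using that assms(2) by (cases "z = 0") force+
  with r that show ?thesis by blast
qed

section \<open>Mollified pairings\<close>

lemma mollifier_smooth: "mollifier r \<rho> \<Longrightarrow> C_infinity \<rho>"
  and mollifier_nonneg: "mollifier r \<rho> \<Longrightarrow> 0 \<le> \<rho> x"
  and mollifier_even: "mollifier r \<rho> \<Longrightarrow> \<rho> (- x) = \<rho> x"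
  and mollifier_support: "mollifier r \<rho> \<Longrightarrow> r \<le> norm x \<Longrightarrow> \<rho> x = 0"
  and mollifier_integral: "mollifier r \<rho> \<Longrightarrow> (LINT x|lborel. \<rho> x) = 1"
  by (auto simp: mollifier_def)

lemma mollifier_integrable: "mollifier r \<rho> \<Longrightarrow> integrable lborel \<rho>"
  by (rule continuous_compact_support_integrable[OF C_infinity_continuous[OF mollifier_smooth], of r \<rho> "cball 0 r"])
     (auto simp: mollifier_support)

lemma mollifier_bounded:
  assumes "mollifier r \<rho>"
  obtains C where "\<And>x. \<bar>\<rho> x\<bar> \<le> C"
  by (rule continuous_compact_support_bounded[OF C_infinity_continuous[OF mollifier_smooth[OF assms]], of "cball 0 r"])
     (auto simp: mollifier_support[OF assms])

lemma mollifier_measurable: "mollifier r \<rho> \<Longrightarrow> \<rho> \<in> borel_measurable borel"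
  using borel_measurable_continuous_onI C_infinity_continuous mollifier_smooth by blast

lemma integrable_mult_bounded:
  fixes a f :: "'a::euclidean_space \<Rightarrow> real"
  assumes "integrable lborel a" "f \<in> borel_measurable borel" "\<And>x. \<bar>f x\<bar> \<le> B"
  shows "integrable lborel (\<lambda>x. a x * f x)"
proof (rule Bochner_Integration.integrable_bound)
  show "integrable lborel (\<lambda>y. B * a y)" using assms by simp
  have "\<bar>f x\<bar> \<le> \<bar>B\<bar>" for x using assms(3)[of x] by linarith
  then show "AE y in lborel. norm (a y * f y) \<le> norm (B * a y)"
    by (subst mult.commute) (auto simp: abs_mult intro!: mult_right_mono)
qed (use assms in auto)

lemma integrable_kernel:
  fixes a b \<kappa> :: "'a::euclidean_space \<Rightarrow> real"
  assumes a: "integrable lborel a" and b: "integrable lborel b"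
    and \<kappa>[measurable]: "\<kappa> \<in> borel_measurable borel" and C: "\<And>x. \<bar>\<kappa> x\<bar> \<le> C"
  shows "integrable (lborel \<Otimes>\<^sub>M lborel) (\<lambda>(x, y). a x * b y * \<kappa> (x - y))"
proof -
  note [measurable] = borel_measurable_integrable[OF a, simplified] borel_measurable_integrable[OF b, simplified]
  have "integrable (lborel \<Otimes>\<^sub>M lborel) (\<lambda>(x, y). a x * b y)"
  proof (rule lborel_pair.Fubini_integrable)
    show "integrable lborel (\<lambda>x. LINT y|lborel. norm (case (x, y) of (x, y) \<Rightarrow> a x * b y))"
      using a by (simp add: abs_mult)
    show "AE x in lborel. integrable lborel (\<lambda>y. case (x, y) of (x, y) \<Rightarrow> a x * b y)"
      using b by simp
  qed simp
  then have "integrable (lborel \<Otimes>\<^sub>M lborel) (\<lambda>p. C * (case p of (x, y) \<Rightarrow> a x * b y))"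
    by (rule integrable_mult_right)
  then show ?thesis
  proof (rule Bochner_Integration.integrable_bound)
    have "\<bar>a x * b y * \<kappa> (x - y)\<bar> \<le> \<bar>C * (a x * b y)\<bar>" for x y
    proof -
      have "\<bar>a x * b y\<bar> * \<bar>\<kappa> (x - y)\<bar> \<le> \<bar>a x * b y\<bar> * \<bar>C\<bar>"
        by (intro mult_left_mono) (use C[of "x - y"] in auto)
      then show ?thesis by (simp add: abs_mult mult_ac)
    qed
    then show "AE p in lborel \<Otimes>\<^sub>M lborel. norm (case p of (x, y) \<Rightarrow> a x * b y * \<kappa> (x - y)) \<le> norm (C * (case p of (x, y) \<Rightarrow> a x * b y))"
      by (intro AE_I2) (auto simp: split_beta)
  qed simp
qed

text \<open>
  For a mollifier \<open>\<kappa>\<close> this is \<open>\<integral>(a * \<kappa>) b\<close>, an approximation of \<open>\<integral>a b\<close>.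
\<close>

definition pairing :: "('a::euclidean_space \<Rightarrow> real) \<Rightarrow> ('a \<Rightarrow> real) \<Rightarrow> ('a \<Rightarrow> real) \<Rightarrow> real" where
  "pairing \<kappa> a b = (LINT y|lborel. b y * (LINT x|lborel. a x * \<kappa> (x - y)))"

lemma
  fixes a b \<kappa> :: "'a::euclidean_space \<Rightarrow> real"
  assumes a: "integrable lborel a" and b: "integrable lborel b"
    and \<kappa>[measurable]: "\<kappa> \<in> borel_measurable borel" and C: "\<And>x. \<bar>\<kappa> x\<bar> \<le> C"
  shows integrable_pairing: "integrable lborel (\<lambda>y. b y * (LINT x|lborel. a x * \<kappa> (x - y)))"
    and pairing_swap: "pairing \<kappa> a b = (LINT x|lborel. a x * (LINT y|lborel. b y * \<kappa> (x - y)))"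
proof -
  note k = integrable_kernel[OF assms]
  show "integrable lborel (\<lambda>y. b y * (LINT x|lborel. a x * \<kappa> (x - y)))"
    using lborel_pair.integrable_snd[OF k] by (simp add: mult_ac flip: integral_mult_right_zero)
  show "pairing \<kappa> a b = (LINT x|lborel. a x * (LINT y|lborel. b y * \<kappa> (x - y)))"
    using lborel_pair.Fubini_integral[OF k] unfolding pairing_def
    by (simp add: mult_ac flip: integral_mult_right_zero)
qed

text \<open>
  After the substitution \<open>z = x - y\<close> the error is the average, with weight \<open>\<rho> z\<close>, of
  \<open>\<integral>(a (y + z) - a y) b y\<close>.  Only an \<open>L\<^sup>1\<close> function has to be translated here, so \<open>b\<close> needs no
  regularity beyond boundedness.
\<close>

lemma pairing_close:
  fixes a b \<rho> :: "'a::euclidean_space \<Rightarrow> real"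
  assumes \<rho>: "mollifier r \<rho>" and a: "integrable lborel a"
    and b[measurable]: "b \<in> borel_measurable borel" and B: "\<And>x. \<bar>b x\<bar> \<le> B"
    and e: "\<And>z. norm z < r \<Longrightarrow> L1_shift a z \<le> e"
  shows "\<bar>pairing \<rho> a b - (LINT x|lborel. a x * b x)\<bar> \<le> B * e"
proof -
  have B0: "B \<ge> 0" using B[of 0] by linarith
  note [measurable] = borel_measurable_integrable[OF a, simplified] mollifier_measurable[OF \<rho>]
  obtain C where C: "\<And>x. \<bar>\<rho> x\<bar> \<le> C" using mollifier_bounded[OF \<rho>] by blast
  define H where "H = (\<lambda>z y. b y * (a (y + z) - a y) * \<rho> z)"
  have [measurable]: "case_prod H \<in> borel_measurable (lborel \<Otimes>\<^sub>M lborel)"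
    unfolding H_def by measurable
  have intba: "integrable lborel (\<lambda>y. b y * (a (y + z) - a y))" for z
  proof (rule Bochner_Integration.integrable_bound)
    show "integrable lborel (\<lambda>y. B * (a (y + z) - a y))"
      using a integrable_translate[OF a] by simp
    show "AE y in lborel. norm (b y * (a (y + z) - a y)) \<le> norm (B * (a (y + z) - a y))"
      using B B0 by (auto simp: abs_mult intro!: mult_right_mono)
  qed simp
  have innerB: "(LINT y|lborel. \<bar>b y * (a (y + z) - a y)\<bar>) \<le> B * L1_shift a z" for z
  proof -
    have "(LINT y|lborel. \<bar>b y * (a (y + z) - a y)\<bar>) \<le> (LINT y|lborel. B * \<bar>a (y + z) - a y\<bar>)"
      by (rule integral_mono)
         (use integrable_abs[OF intba] a integrable_translate[OF a] B in \<open>auto simp: abs_mult mult_right_mono\<close>)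
    then show ?thesis by (simp add: L1_shift_def)
  qed
  have shift_le: "L1_shift a z \<le> 2 * (LINT x|lborel. \<bar>a x\<bar>)" for z
    using L1_shift_triangle[OF a, of "\<lambda>x. 0" z] by (simp add: L1_shift_def)
  have intH: "integrable (lborel \<Otimes>\<^sub>M lborel) (case_prod H)"
  proof (rule lborel_pair.Fubini_integrable)
    show "AE z in lborel. integrable lborel (\<lambda>y. case (z, y) of (z, y) \<Rightarrow> H z y)"
      using intba by (simp add: H_def)
    show "integrable lborel (\<lambda>z. LINT y|lborel. norm (case (z, y) of (z, y) \<Rightarrow> H z y))"
    proof (rule Bochner_Integration.integrable_bound)
      show "integrable lborel (\<lambda>z. B * (2 * (LINT x|lborel. \<bar>a x\<bar>)) * \<rho> z)"
        using mollifier_integrable[OF \<rho>] by simp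
      show "AE z in lborel. norm (LINT y|lborel. norm (case (z, y) of (z, y) \<Rightarrow> H z y)) \<le> norm (B * (2 * (LINT x|lborel. \<bar>a x\<bar>)) * \<rho> z)"
      proof (rule AE_I2)
        fix z :: 'a
        have "(LINT y|lborel. norm (case (z, y) of (z, y) \<Rightarrow> H z y)) = (LINT y|lborel. \<bar>b y * (a (y + z) - a y)\<bar>) * \<bar>\<rho> z\<bar>"
          unfolding H_def by (simp add: abs_mult flip: integral_mult_left_zero)
        also have "\<dots> \<le> B * (2 * (LINT x|lborel. \<bar>a x\<bar>)) * \<bar>\<rho> z\<bar>"
          by (intro mult_right_mono order_trans[OF innerB] mult_left_mono shift_le) (use B0 in auto)
        finally show "norm (LINT y|lborel. norm (case (z, y) of (z, y) \<Rightarrow> H z y)) \<le> norm (B * (2 * (LINT x|lborel. \<bar>a x\<bar>)) * \<rho> z)"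
          using B0 by (simp add: abs_mult mollifier_nonneg[OF \<rho>])
      qed
    qed simp
  qed simp
  have intarho: "integrable lborel (\<lambda>z. a (y + z) * \<rho> z)" for y
  proof (rule Bochner_Integration.integrable_bound)
    show "integrable lborel (\<lambda>z. C * a (z + y))" using integrable_translate[OF a] by simp
    have "\<bar>\<rho> z\<bar> \<le> \<bar>C\<bar>" for z using C[of z] by linarith
    then show "AE z in lborel. norm (a (y + z) * \<rho> z) \<le> norm (C * a (z + y))"
      by (auto simp: abs_mult add.commute mult.commute intro!: mult_right_mono)
  qed simp
  have inner: "b y * (LINT x|lborel. a x * \<rho> (x - y)) = (LINT z|lborel. H z y) + a y * b y" for y
  proof -
    have "(LINT x|lborel. a x * \<rho> (x - y)) = (LINT z|lborel. a (y + z) * \<rho> z)"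
      using integral_translate[of "\<lambda>x. a x * \<rho> (x - y)" y] by (simp add: add.commute)
    moreover have "(LINT z|lborel. H z y) = b y * ((LINT z|lborel. a (y + z) * \<rho> z) - a y)"
    proof -
      have "(LINT z|lborel. H z y) = (LINT z|lborel. b y * (a (y + z) * \<rho> z - a y * \<rho> z))"
        by (simp add: H_def algebra_simps)
      then show ?thesis
        using intarho[of y] mollifier_integrable[OF \<rho>] by (simp add: mollifier_integral[OF \<rho>])
    qed
    ultimately show ?thesis by (simp add: algebra_simps)
  qed
  have "integrable lborel (\<lambda>x. a x * b x)"
    by (rule integrable_mult_bounded[OF a b B])
  then have "pairing \<rho> a b - (LINT x|lborel. a x * b x) = (LINT y|lborel. LINT z|lborel. H z y)"
    unfolding pairing_def inner using lborel_pair.integrable_snd[OF intH] by simp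
  also have "\<dots> = (LINT z|lborel. LINT y|lborel. H z y)"
    using lborel_pair.Fubini_integral[OF intH] by simp
  also have "\<bar>\<dots>\<bar> \<le> (LINT z|lborel. B * e * \<rho> z)"
  proof -
    have "\<bar>LINT z|lborel. LINT y|lborel. H z y\<bar> \<le> (LINT z|lborel. \<bar>LINT y|lborel. H z y\<bar>)"
      by (rule integral_abs_bound)
    also have "\<dots> \<le> (LINT z|lborel. B * e * \<rho> z)"
    proof (rule integral_mono)
      show "integrable lborel (\<lambda>z. \<bar>LINT y|lborel. H z y\<bar>)"
        using lborel_pair.integrable_fst'[OF intH] by simp
      show "integrable lborel (\<lambda>z. B * e * \<rho> z)" using mollifier_integrable[OF \<rho>] by simp
      fix z
      have "\<bar>LINT y|lborel. H z y\<bar> \<le> (LINT y|lborel. \<bar>b y * (a (y + z) - a y)\<bar>) * \<rho> z"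
        using integral_abs_bound[of lborel "\<lambda>y. b y * (a (y + z) - a y)"] mollifier_nonneg[OF \<rho>, of z]
        unfolding H_def by (simp add: abs_mult mult_right_mono)
      also have "\<dots> \<le> B * e * \<rho> z"
      proof (cases "norm z < r")
        case True
        have "(LINT y|lborel. \<bar>b y * (a (y + z) - a y)\<bar>) \<le> B * e"
          by (rule order_trans[OF innerB mult_left_mono[OF e[OF True] B0]])
        then show ?thesis by (intro mult_right_mono mollifier_nonneg[OF \<rho>])
      qed (simp add: mollifier_support[OF \<rho>])
      finally show "\<bar>LINT y|lborel. H z y\<bar> \<le> B * e * \<rho> z" .
    qed
    finally show ?thesis .
  qed
  finally show ?thesis using mollifier_integral[OF \<rho>] by simp
qed

lemma pairing_close_right:
  fixes a b \<rho> :: "'a::euclidean_space \<Rightarrow> real"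
  assumes \<rho>: "mollifier r \<rho>" and a: "integrable lborel a" and b: "integrable lborel b"
    and B: "\<And>x. \<bar>a x\<bar> \<le> B" and e: "\<And>z. norm z < r \<Longrightarrow> L1_shift b z \<le> e"
  shows "\<bar>pairing \<rho> a b - (LINT x|lborel. a x * b x)\<bar> \<le> B * e"
proof -
  obtain C where C: "\<And>x. \<bar>\<rho> x\<bar> \<le> C" using mollifier_bounded[OF \<rho>] by blast
  have "\<rho> (x - y) = \<rho> (y - x)" for x y
    using mollifier_even[OF \<rho>, of "x - y"] by simp
  then have "pairing \<rho> a b = pairing \<rho> b a"
    using pairing_swap[OF a b mollifier_measurable[OF \<rho>] C] by (simp add: pairing_def)
  moreover have "a \<in> borel_measurable borel"
    using borel_measurable_integrable[OF a] by simp
  from pairing_close[OF \<rho> b this B e]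
  have "\<bar>pairing \<rho> b a - (LINT x|lborel. b x * a x)\<bar> \<le> B * e" .
  ultimately show ?thesis
    by (simp add: mult.commute)
qed

section \<open>Product rule for weak derivatives\<close>

text \<open>
  One component of the weak gradient, for functions on the whole space that are integrated with respect
  to \<open>lborel\<close>.
\<close>

definition weak_partial :: "'a::euclidean_space set \<Rightarrow> 'a \<Rightarrow> ('a \<Rightarrow> real) \<Rightarrow> ('a \<Rightarrow> real) \<Rightarrow> bool" where
  "weak_partial \<Omega> v f g \<longleftrightarrow> (\<forall>\<phi>. test_function \<Omega> \<phi> \<longrightarrow>
     (LINT x|lborel. f x * frechet_derivative \<phi> (at x) v) = - (LINT x|lborel. g x * \<phi> x))"

lemma test_function_bounds:
  assumes "test_function \<Omega> \<phi>"
  shows "\<exists>B. \<forall>x. \<bar>\<phi> x\<bar> \<le> B" "\<exists>B. \<forall>x. \<bar>frechet_derivative \<phi> (at x) v\<bar> \<le> B"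
    "\<phi> \<in> borel_measurable borel" "(\<lambda>x. frechet_derivative \<phi> (at x) v) \<in> borel_measurable borel"
proof -
  have s: "C_infinity \<phi>" and K: "compact (closure {x. \<phi> x \<noteq> 0})"
    using assms by (auto simp: test_function_def)
  note c = C_infinity_continuous[OF s] C_infinity_continuous_derivative[OF s, of v]
  show "\<phi> \<in> borel_measurable borel" "(\<lambda>x. frechet_derivative \<phi> (at x) v) \<in> borel_measurable borel"
    using c borel_measurable_continuous_onI by auto
  show "\<exists>B. \<forall>x. \<bar>\<phi> x\<bar> \<le> B"
    by (rule continuous_compact_support_bounded[OF c(1) K]) (use closure_subset[of "{x. \<phi> x \<noteq> 0}"] in auto)
  show "\<exists>B. \<forall>x. \<bar>frechet_derivative \<phi> (at x) v\<bar> \<le> B"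
    by (rule continuous_compact_support_bounded[OF c(2) K]) (auto simp: derivative_eq_0_outside_support)
qed

lemma test_function_mollifier:
  assumes \<rho>: "mollifier r \<rho>" and x: "cball x r \<subseteq> \<Omega>"
  shows "test_function \<Omega> (\<lambda>y. \<rho> (x - y))"
proof (rule test_functionI[OF _ compact_cball x])
  show "C_infinity (\<lambda>y. \<rho> (x - y))"
    using C_infinity_affine[OF mollifier_smooth[OF \<rho>], of "-1" x] by simp
  show "\<rho> (x - y) = 0" if "y \<notin> cball x r" for y
    using that by (intro mollifier_support[OF \<rho>]) (simp add: dist_norm)
qed

text \<open>
  The function \<open>\<phi> x * \<rho> (x - y)\<close> is a test function both in \<open>x\<close> and, for \<open>x\<close> in the support of \<open>\<phi>\<close>
  and small \<open>\<rho>\<close>, in \<open>y\<close>.  Testing \<open>f\<^sub>1\<close> in \<open>x\<close> and integrating against \<open>f\<^sub>2 y\<close> produces the term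
  \<open>f\<^sub>1 x * \<phi> x * f\<^sub>2 y\<close> times the derivative of \<open>\<rho>\<close>, and testing \<open>f\<^sub>2\<close> in \<open>y\<close> turns that derivative
  into \<open>g\<^sub>2\<close>.  All three terms are then mollified pairings, whose limits form the product rule.  In this
  way no mollified function has to be differentiated.
\<close>

lemma weak_partial_mult:
  fixes \<Omega> :: "'a::euclidean_space set" and f\<^sub>1 f\<^sub>2 g\<^sub>1 g\<^sub>2 :: "'a \<Rightarrow> real"
  assumes \<Omega>: "open \<Omega>"
    and int: "integrable lborel f\<^sub>1" "integrable lborel f\<^sub>2" "integrable lborel g\<^sub>1" "integrable lborel g\<^sub>2"
    and B1: "\<And>x. \<bar>f\<^sub>1 x\<bar> \<le> B\<^sub>1" and B2: "\<And>x. \<bar>f\<^sub>2 x\<bar> \<le> B\<^sub>2"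
    and w: "weak_partial \<Omega> v f\<^sub>1 g\<^sub>1" "weak_partial \<Omega> v f\<^sub>2 g\<^sub>2"
  shows "weak_partial \<Omega> v (\<lambda>x. f\<^sub>1 x * f\<^sub>2 x) (\<lambda>x. f\<^sub>1 x * g\<^sub>2 x + f\<^sub>2 x * g\<^sub>1 x)"
  unfolding weak_partial_def
proof (intro allI impI)
  fix \<phi> assume \<phi>: "test_function \<Omega> \<phi>"
  define D where "D = (\<lambda>x. frechet_derivative \<phi> (at x) v)"
  define K where "K = closure {x. \<phi> x \<noteq> 0}"
  have s\<phi>: "C_infinity \<phi>" and K: "compact K" "K \<subseteq> \<Omega>"
    using \<phi> by (auto simp: test_function_def K_def)
  have offK: "\<phi> x = 0" if "x \<notin> K" for x
    using that closure_subset[of "{x. \<phi> x \<noteq> 0}"] by (auto simp: K_def)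
  note tb = test_function_bounds[OF \<phi>]
  obtain B\<^sub>3 where B3: "\<And>x. \<bar>\<phi> x\<bar> \<le> B\<^sub>3" using tb(1) by blast
  obtain B\<^sub>4 where B4: "\<And>x. \<bar>D x\<bar> \<le> B\<^sub>4" using tb(2)[of v] D_def by blast
  have [measurable]: "\<phi> \<in> borel_measurable borel" "D \<in> borel_measurable borel"
    using tb(3) tb(4)[of v] by (auto simp: D_def)
  note [measurable] = int[THEN borel_measurable_integrable, simplified]
  have i1: "integrable lborel (\<lambda>x. f\<^sub>1 x * D x)" by (rule integrable_mult_bounded[OF int(1) _ B4]) simp
  have i2: "integrable lborel (\<lambda>x. f\<^sub>1 x * \<phi> x)" by (rule integrable_mult_bounded[OF int(1) _ B3]) simp
  have i3: "integrable lborel (\<lambda>x. g\<^sub>1 x * \<phi> x)" by (rule integrable_mult_bounded[OF int(3) _ B3]) simp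
  have B12: "\<bar>f\<^sub>1 x * \<phi> x\<bar> \<le> B\<^sub>1 * B\<^sub>3" for x
    unfolding abs_mult by (rule mult_mono'[OF B1 B3]) auto
  have i4: "integrable lborel (\<lambda>x. (f\<^sub>1 x * \<phi> x) * g\<^sub>2 x)"
    using integrable_mult_bounded[OF int(4) _ B12] by (simp add: mult.commute)
  have i5: "integrable lborel (\<lambda>x. g\<^sub>1 x * \<phi> x * f\<^sub>2 x)"
    by (rule integrable_mult_bounded[OF i3 _ B2]) simp
  let ?X = "(LINT x|lborel. f\<^sub>1 x * D x * f\<^sub>2 x) + (LINT x|lborel. f\<^sub>1 x * \<phi> x * g\<^sub>2 x) + (LINT x|lborel. g\<^sub>1 x * \<phi> x * f\<^sub>2 x)"
  have bound: "\<bar>?X\<bar> \<le> (2 * B\<^sub>2 + B\<^sub>1 * B\<^sub>3) * e" if e: "e > 0" for e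
  proof -
    obtain R where R: "R > 0" "(\<Union>x\<in>K. cball x R) \<subseteq> \<Omega>"
      by (rule compact_subset_open_imp_cball_epsilon_subset[OF K(1) \<Omega> K(2)])
    obtain r1 where r1: "r1 > 0" "\<And>z. norm z < r1 \<Longrightarrow> L1_shift (\<lambda>x. f\<^sub>1 x * D x) z < e"
      using L1_shift_small[OF i1 e] by blast
    obtain r2 where r2: "r2 > 0" "\<And>z. norm z < r2 \<Longrightarrow> L1_shift g\<^sub>2 z < e"
      using L1_shift_small[OF int(4) e] by blast
    obtain r3 where r3: "r3 > 0" "\<And>z. norm z < r3 \<Longrightarrow> L1_shift (\<lambda>x. g\<^sub>1 x * \<phi> x) z < e"
      using L1_shift_small[OF i3 e] by blast
    define r where "r = min R (min r1 (min r2 r3))"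
    have "r > 0" using R r1 r2 r3 by (simp add: r_def)
    then obtain \<rho> :: "'a \<Rightarrow> real" where \<rho>: "mollifier r \<rho>" using mollifier_exists by blast
    obtain C where C: "\<And>x. \<bar>\<rho> x\<bar> \<le> C" using mollifier_bounded[OF \<rho>] by blast
    note [measurable] = mollifier_measurable[OF \<rho>]
    define D\<rho> where "D\<rho> = (\<lambda>x. frechet_derivative \<rho> (at x) v)"
    have t\<rho>: "test_function UNIV \<rho>"
      by (rule test_functionI[OF mollifier_smooth[OF \<rho>], of "cball 0 r"]) (auto simp: mollifier_support[OF \<rho>])
    obtain C' where C': "\<And>x. \<bar>D\<rho> x\<bar> \<le> C'" using test_function_bounds(2)[OF t\<rho>] D\<rho>_def by blast
    have mD[measurable]: "D\<rho> \<in> borel_measurable borel"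
      using test_function_bounds(4)[OF t\<rho>] by (simp add: D\<rho>_def)
    \<comment> \<open>the weak derivative of \<open>f\<^sub>1\<close>, tested with \<open>\<phi> x * \<rho> (x - y)\<close> for fixed \<open>y\<close>\<close>
    have first: "(LINT x|lborel. f\<^sub>1 x * D x * \<rho> (x - y)) + (LINT x|lborel. f\<^sub>1 x * \<phi> x * D\<rho> (x - y))
        = - (LINT x|lborel. g\<^sub>1 x * \<phi> x * \<rho> (x - y))" for y
    proof -
      have s: "C_infinity (\<lambda>x. \<rho> (1 *\<^sub>R x + (- y)))"
        by (rule C_infinity_affine[OF mollifier_smooth[OF \<rho>]])
      have t: "test_function \<Omega> (\<lambda>x. \<phi> x * \<rho> (x - y))"
        by (rule test_functionI[OF _ K]) (use C_infinity_mult[OF s\<phi> s] offK in auto)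
      have d: "frechet_derivative (\<lambda>x. \<phi> x * \<rho> (x - y)) (at x) v = \<phi> x * D\<rho> (x - y) + D x * \<rho> (x - y)" for x
        using frechet_derivative_mult[OF s\<phi> s, of x v] frechet_derivative_affine[OF mollifier_smooth[OF \<rho>], of 1 "-y" x v]
        by (simp add: D_def D\<rho>_def)
      have j: "integrable lborel (\<lambda>x. f\<^sub>1 x * D x * \<rho> (x - y))" "integrable lborel (\<lambda>x. f\<^sub>1 x * \<phi> x * D\<rho> (x - y))"
        by (rule integrable_mult_bounded[OF i1 _ C], simp) (rule integrable_mult_bounded[OF i2 _ C'], simp)
      have "(LINT x|lborel. f\<^sub>1 x * (\<phi> x * D\<rho> (x - y) + D x * \<rho> (x - y))) = - (LINT x|lborel. g\<^sub>1 x * (\<phi> x * \<rho> (x - y)))"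
        using w(1)[unfolded weak_partial_def, rule_format, OF t] unfolding d .
      also have "(LINT x|lborel. f\<^sub>1 x * (\<phi> x * D\<rho> (x - y) + D x * \<rho> (x - y)))
          = (LINT x|lborel. f\<^sub>1 x * D x * \<rho> (x - y) + f\<^sub>1 x * \<phi> x * D\<rho> (x - y))"
        by (simp add: algebra_simps)
      finally show ?thesis using j by (simp add: mult_ac)
    qed
    \<comment> \<open>the weak derivative of \<open>f\<^sub>2\<close>, tested with \<open>\<rho> (x - y)\<close> as a function of \<open>y\<close>\<close>
    have second: "(LINT y|lborel. f\<^sub>2 y * D\<rho> (x - y)) = (LINT y|lborel. g\<^sub>2 y * \<rho> (x - y))" if "x \<in> K" for x
    proof -
      have "cball x r \<subseteq> cball x R" by (auto simp: r_def)
      also have "\<dots> \<subseteq> \<Omega>" using R(2) that by auto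
      finally have "cball x r \<subseteq> \<Omega>" .
      note t = test_function_mollifier[OF \<rho> this]
      have "frechet_derivative (\<lambda>y. \<rho> (x - y)) (at y) v = - D\<rho> (x - y)" for y
        using frechet_derivative_affine[OF mollifier_smooth[OF \<rho>], of "-1" x y v] by (simp add: D\<rho>_def)
      then show ?thesis
        using w(2)[unfolded weak_partial_def, rule_format, OF t] by simp
    qed
    have "pairing D\<rho> (\<lambda>x. f\<^sub>1 x * \<phi> x) f\<^sub>2 = pairing \<rho> (\<lambda>x. f\<^sub>1 x * \<phi> x) g\<^sub>2"
      unfolding pairing_swap[OF i2 int(2) mD C'] pairing_swap[OF i2 int(4) mollifier_measurable[OF \<rho>] C]
      by (rule Bochner_Integration.integral_cong) (use second offK in auto)
    moreover have "pairing \<rho> (\<lambda>x. f\<^sub>1 x * D x) f\<^sub>2 + pairing D\<rho> (\<lambda>x. f\<^sub>1 x * \<phi> x) f\<^sub>2 + pairing \<rho> (\<lambda>x. g\<^sub>1 x * \<phi> x) f\<^sub>2 = 0"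
    proof -
      have "pairing \<rho> (\<lambda>x. f\<^sub>1 x * D x) f\<^sub>2 + pairing D\<rho> (\<lambda>x. f\<^sub>1 x * \<phi> x) f\<^sub>2 + pairing \<rho> (\<lambda>x. g\<^sub>1 x * \<phi> x) f\<^sub>2
        = (LINT y|lborel. f\<^sub>2 y * (LINT x|lborel. f\<^sub>1 x * D x * \<rho> (x - y)) + f\<^sub>2 y * (LINT x|lborel. f\<^sub>1 x * \<phi> x * D\<rho> (x - y))
             + f\<^sub>2 y * (LINT x|lborel. g\<^sub>1 x * \<phi> x * \<rho> (x - y)))"
        unfolding pairing_def
        using integrable_pairing[OF i1 int(2) mollifier_measurable[OF \<rho>] C] integrable_pairing[OF i2 int(2) mD C']
          integrable_pairing[OF i3 int(2) mollifier_measurable[OF \<rho>] C]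
        by simp
      also have "\<dots> = (LINT y|lborel. f\<^sub>2 y * ((LINT x|lborel. f\<^sub>1 x * D x * \<rho> (x - y)) + (LINT x|lborel. f\<^sub>1 x * \<phi> x * D\<rho> (x - y))
             + (LINT x|lborel. g\<^sub>1 x * \<phi> x * \<rho> (x - y))))"
        by (simp add: distrib_left)
      also have "\<dots> = 0" unfolding first by simp
      finally show ?thesis .
    qed
    moreover have "\<bar>pairing \<rho> (\<lambda>x. f\<^sub>1 x * D x) f\<^sub>2 - (LINT x|lborel. f\<^sub>1 x * D x * f\<^sub>2 x)\<bar> \<le> B\<^sub>2 * e"
      by (rule pairing_close[OF \<rho> i1 _ B2]) (use r1(2) in \<open>auto simp: r_def less_imp_le\<close>)
    moreover have "\<bar>pairing \<rho> (\<lambda>x. g\<^sub>1 x * \<phi> x) f\<^sub>2 - (LINT x|lborel. g\<^sub>1 x * \<phi> x * f\<^sub>2 x)\<bar> \<le> B\<^sub>2 * e"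
      by (rule pairing_close[OF \<rho> i3 _ B2]) (use r3(2) in \<open>auto simp: r_def less_imp_le\<close>)
    moreover have "\<bar>pairing \<rho> (\<lambda>x. f\<^sub>1 x * \<phi> x) g\<^sub>2 - (LINT x|lborel. f\<^sub>1 x * \<phi> x * g\<^sub>2 x)\<bar> \<le> B\<^sub>1 * B\<^sub>3 * e"
      by (rule pairing_close_right[OF \<rho> i2 int(4) B12]) (use r2(2) in \<open>auto simp: r_def less_imp_le\<close>)
    ultimately show ?thesis by (simp add: algebra_simps abs_le_iff)
  qed
  have "?X = 0"
  proof (rule ccontr)
    assume ne: "?X \<noteq> 0"
    define c where "c = 2 * B\<^sub>2 + B\<^sub>1 * B\<^sub>3"
    have c0: "c \<ge> 0"
      using B1[of 0] B2[of 0] B3[of 0] by (auto simp: c_def intro!: add_nonneg_nonneg mult_nonneg_nonneg)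
    have "\<bar>?X\<bar> \<le> c * (\<bar>?X\<bar> / (c + 1) / 2)"
      unfolding c_def by (rule bound) (use ne c0 in \<open>simp add: c_def add_nonneg_pos zero_less_divide_iff\<close>)
    also have "\<dots> = \<bar>?X\<bar> * (c / (c + 1)) / 2" by simp
    also have "\<dots> \<le> \<bar>?X\<bar> * 1 / 2" using c0 by (intro divide_right_mono mult_left_mono) auto
    also have "\<dots> < \<bar>?X\<bar>" using ne by simp
    finally show False by simp
  qed
  then have "(LINT x|lborel. f\<^sub>1 x * D x * f\<^sub>2 x) = - ((LINT x|lborel. f\<^sub>1 x * \<phi> x * g\<^sub>2 x) + (LINT x|lborel. g\<^sub>1 x * \<phi> x * f\<^sub>2 x))"
    by simp
  also have "\<dots> = - (LINT x|lborel. (f\<^sub>1 x * \<phi> x) * g\<^sub>2 x + g\<^sub>1 x * \<phi> x * f\<^sub>2 x)"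
    using i4 i5 by simp
  finally show "(LINT x|lborel. f\<^sub>1 x * f\<^sub>2 x * frechet_derivative \<phi> (at x) v)
      = - (LINT x|lborel. (f\<^sub>1 x * g\<^sub>2 x + f\<^sub>2 x * g\<^sub>1 x) * \<phi> x)"
    by (simp add: D_def algebra_simps)
qed

section \<open>Chain rule for polynomials\<close>

lemma C_infinity_directional_derivative:
  fixes \<phi> :: "'a::euclidean_space \<Rightarrow> real"
  assumes "C_infinity \<phi>"
  shows "((\<lambda>t. \<phi> (x + t *\<^sub>R v)) has_real_derivative frechet_derivative \<phi> (at (x + t *\<^sub>R v)) v) (at t)"
proof -
  note d = C_infinity_has_derivative[OF assms, of "x + t *\<^sub>R v"]
  have "((\<lambda>t. \<phi> (x + t *\<^sub>R v)) has_derivative (\<lambda>s. frechet_derivative \<phi> (at (x + t *\<^sub>R v)) (s *\<^sub>R v))) (at t)"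
    by (rule has_derivative_compose[where f = "\<lambda>t. x + t *\<^sub>R v" and f' = "\<lambda>s. s *\<^sub>R v" and g = \<phi>, OF _ d])
       (auto intro!: derivative_eq_intros)
  moreover have "frechet_derivative \<phi> (at (x + t *\<^sub>R v)) (s *\<^sub>R v) = frechet_derivative \<phi> (at (x + t *\<^sub>R v)) v * s" for s
    using linear_cmul[OF has_derivative_linear[OF d], of s v] by simp
  ultimately show ?thesis
    by (simp add: has_field_derivative_def)
qed

text \<open>
  The integrals of \<open>\<phi>\<close> and of its translates agree, so all difference quotients have integral \<open>0\<close>; they
  converge dominatedly to the derivative.  In other words, constants have weak gradient \<open>0\<close>.
\<close>

lemma integral_derivative_test_function:
  fixes \<phi> :: "'a::euclidean_space \<Rightarrow> real"
  assumes "test_function \<Omega> \<phi>"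
  shows "(LINT x|lborel. frechet_derivative \<phi> (at x) v) = 0"
proof -
  have s: "C_infinity \<phi>" and K: "compact (closure {x. \<phi> x \<noteq> 0})"
    using assms by (auto simp: test_function_def)
  obtain R where R: "\<And>x. x \<in> closure {x. \<phi> x \<noteq> 0} \<Longrightarrow> norm x \<le> R"
    using compact_imp_bounded[OF K] by (auto simp: bounded_iff)
  have out: "\<phi> x = 0" "frechet_derivative \<phi> (at x) v = 0" if "norm x > R" for x
    using R[of x] that closure_subset[of "{x. \<phi> x \<noteq> 0}"] derivative_eq_0_outside_support[of x \<phi> v] by auto
  note tb = test_function_bounds[OF assms]
  obtain B where B: "\<And>x. \<bar>frechet_derivative \<phi> (at x) v\<bar> \<le> B" using tb(2)[of v] by blast
  have [measurable]: "\<phi> \<in> borel_measurable borel" "(\<lambda>x. frechet_derivative \<phi> (at x) v) \<in> borel_measurable borel"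
    using tb(3) tb(4)[of v] by auto
  have int: "integrable lborel \<phi>"
    by (rule continuous_compact_support_integrable[OF C_infinity_continuous[OF s], of "cball 0 R"]) (use out in auto)
  define q where "q n x = (\<phi> (x + (1 / real (Suc n)) *\<^sub>R v) - \<phi> x) / (1 / real (Suc n))" for n x
  have [measurable]: "q n \<in> borel_measurable borel" for n
    unfolding q_def by measurable
  have "(\<lambda>n. LINT x|lborel. q n x) \<longlonglongrightarrow> (LINT x|lborel. frechet_derivative \<phi> (at x) v)"
  proof (rule integral_dominated_convergence[where w = "\<lambda>x. B * indicator (cball 0 (R + norm v)) x"])
    show "integrable lborel (\<lambda>x::'a. B * indicator (cball 0 (R + norm v)) x)"
      using emeasure_lborel_cball_finite[of "0::'a" "R + norm v"] by (simp add: less_top)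
    show "AE x in lborel. (\<lambda>n. q n x) \<longlonglongrightarrow> frechet_derivative \<phi> (at x) v"
    proof (rule AE_I2)
      fix x
      have "((\<lambda>h. (\<phi> (x + h *\<^sub>R v) - \<phi> x) / h) \<longlongrightarrow> frechet_derivative \<phi> (at x) v) (at 0)"
        using C_infinity_directional_derivative[OF s, of x v 0] by (simp add: DERIV_def)
      moreover have "filterlim (\<lambda>n. 1 / real (Suc n)) (at 0) sequentially"
        by (rule filterlim_atI[OF LIMSEQ_inverse_real_of_nat[unfolded inverse_eq_divide]]) auto
      ultimately show "(\<lambda>n. q n x) \<longlonglongrightarrow> frechet_derivative \<phi> (at x) v"
        unfolding q_def by (rule filterlim_compose)
    qed
    fix n
    show "AE x in lborel. norm (q n x) \<le> B * indicator (cball 0 (R + norm v)) x"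
    proof (rule AE_I2)
      fix x
      let ?h = "1 / real (Suc n)"
      have h: "0 < ?h" "?h \<le> 1" by auto
      obtain z where z: "0 < z" "z < ?h" "\<phi> (x + ?h *\<^sub>R v) - \<phi> (x + 0 *\<^sub>R v) = (?h - 0) * frechet_derivative \<phi> (at (x + z *\<^sub>R v)) v"
        using MVT2[OF h(1) C_infinity_directional_derivative[OF s, of x v]] by metis
      then have q: "q n x = frechet_derivative \<phi> (at (x + z *\<^sub>R v)) v"
        unfolding q_def using h(1) by simp
      show "norm (q n x) \<le> B * indicator (cball 0 (R + norm v)) x"
      proof (cases "norm x \<le> R + norm v")
        case True
        then show ?thesis using B q by simp
      next
        case False
        have z1: "z \<le> 1" using z(2) h(2) by linarith
        have "norm x \<le> norm (x + z *\<^sub>R v) + norm (z *\<^sub>R v)"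
          using norm_triangle_ineq4[of "x + z *\<^sub>R v" "z *\<^sub>R v"] by simp
        also have "norm (z *\<^sub>R v) \<le> 1 * norm v"
          unfolding norm_scaleR by (rule mult_right_mono) (use z(1) z1 in auto)
        finally have "norm (x + z *\<^sub>R v) > R" using False by simp
        then show ?thesis using q out(2) False by simp
      qed
    qed
  qed auto
  moreover have "(LINT x|lborel. q n x) = 0" for n
    unfolding q_def using int integrable_translate[OF int] integral_translate[of \<phi>] by simp
  ultimately show ?thesis
    using LIMSEQ_unique[OF _ tendsto_const] by fastforce
qed

lemma poly_comp_bounded:
  assumes "\<And>x. \<bar>f x\<bar> \<le> (B::real)"
  shows "\<exists>C. \<forall>x. \<bar>poly p (f x)\<bar> \<le> C"
proof -
  have "compact (poly p ` {-B..B})"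
    by (intro compact_continuous_image continuous_intros) auto
  then have "bounded (poly p ` {-B..B})" by (rule compact_imp_bounded)
  then obtain C where C: "\<forall>z\<in>poly p ` {-B..B}. norm z \<le> C"
    unfolding bounded_iff by blast
  have "\<bar>poly p (f x)\<bar> \<le> C" for x
    using C assms[of x] by (simp add: abs_le_iff)
  then show ?thesis by blast
qed

text \<open>
  Horner's scheme \<open>pCons c q (f) = c + f * q(f)\<close> reduces the chain rule to the product rule.  The
  indicator makes the constant terms integrable.
\<close>

lemma weak_partial_poly:
  fixes \<Omega> :: "'a::euclidean_space set" and f g :: "'a \<Rightarrow> real"
  assumes \<Omega>: "open \<Omega>" "bounded \<Omega>"
    and f: "integrable lborel f" "\<And>x. \<bar>f x\<bar> \<le> B"
    and g: "integrable lborel g" "\<And>x. x \<notin> \<Omega> \<Longrightarrow> g x = 0"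
    and w: "weak_partial \<Omega> v f g"
  shows "weak_partial \<Omega> v (\<lambda>x. indicator \<Omega> x * poly p (f x)) (\<lambda>x. poly (pderiv p) (f x) * g x)"
proof (induction p)
  case 0
  show ?case by (simp add: weak_partial_def)
next
  case (pCons c q)
  note [measurable] = borel_measurable_integrable[OF f(1), simplified] borel_measurable_integrable[OF g(1), simplified]
  have [measurable]: "\<Omega> \<in> sets borel" using \<Omega> by simp
  have [measurable]: "(\<lambda>x. poly r (f x)) \<in> borel_measurable borel" for r
    by (rule measurable_compose[of f borel borel "poly r"])
       (auto intro!: borel_measurable_continuous_onI continuous_intros)
  have ind: "integrable lborel (indicator \<Omega> :: 'a \<Rightarrow> real)"
    using emeasure_bounded_finite[OF \<Omega>(2)] by simp
  let ?i = "indicator \<Omega> :: 'a \<Rightarrow> real"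
  obtain C where C: "\<And>x. \<bar>poly q (f x)\<bar> \<le> C" using poly_comp_bounded[of f B q, OF f(2)] by blast
  obtain C' where C': "\<And>x. \<bar>poly (pderiv q) (f x)\<bar> \<le> C'"
    using poly_comp_bounded[of f B "pderiv q", OF f(2)] by blast
  have Ci: "\<bar>?i x * poly q (f x)\<bar> \<le> C" for x
    using C[of x] by (auto simp: indicator_def)
  have i1: "integrable lborel (\<lambda>x. ?i x * poly q (f x))"
    by (rule integrable_mult_bounded[OF ind _ C]) simp
  have i2: "integrable lborel (\<lambda>x. poly (pderiv q) (f x) * g x)"
    using integrable_mult_bounded[OF g(1) _ C'] by (simp add: mult.commute)
  have prod: "weak_partial \<Omega> v (\<lambda>x. f x * (?i x * poly q (f x)))
      (\<lambda>x. f x * (poly (pderiv q) (f x) * g x) + ?i x * poly q (f x) * g x)"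
    by (rule weak_partial_mult[OF \<Omega>(1) f(1) i1 g(1) i2 f(2) Ci w pCons.IH])
  show ?case
    unfolding weak_partial_def
  proof (intro allI impI)
    fix \<phi> assume t: "test_function \<Omega> \<phi>"
    let ?D = "\<lambda>x. frechet_derivative \<phi> (at x) v"
    have D0: "?D x = 0" if "x \<notin> \<Omega>" for x
      using t that by (intro derivative_eq_0_outside_support) (auto simp: test_function_def)
    note tb = test_function_bounds[OF t]
    obtain E where E: "\<And>x. \<bar>?D x\<bar> \<le> E" using tb(2)[of v] by blast
    have iD: "integrable lborel ?D"
    proof -
      have "integrable lborel (\<lambda>x. ?i x * ?D x)" by (rule integrable_mult_bounded[OF ind tb(4) E])
      also have "(\<lambda>x. ?i x * ?D x) = ?D" by (rule ext) (use D0 in \<open>auto simp: indicator_def\<close>)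
      finally show ?thesis .
    qed
    have i3: "integrable lborel (\<lambda>x. f x * (?i x * poly q (f x)) * ?D x)"
      by (rule integrable_mult_bounded[OF integrable_mult_bounded[OF f(1) _ Ci] tb(4) E]) simp
    have "(LINT x|lborel. ?i x * poly (pCons c q) (f x) * ?D x)
        = (LINT x|lborel. c * ?D x + f x * (?i x * poly q (f x)) * ?D x)"
      using D0 by (intro Bochner_Integration.integral_cong) (auto simp: indicator_def algebra_simps)
    also have "\<dots> = (LINT x|lborel. f x * (?i x * poly q (f x)) * ?D x)"
      using iD i3 integral_derivative_test_function[OF t, of v] by simp
    also have "\<dots> = - (LINT x|lborel. (f x * (poly (pderiv q) (f x) * g x) + ?i x * poly q (f x) * g x) * \<phi> x)"
      using prod t by (simp add: weak_partial_def)
    also have "\<dots> = - (LINT x|lborel. poly (pderiv (pCons c q)) (f x) * g x * \<phi> x)"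
      using g(2) by (intro arg_cong[where f = uminus] Bochner_Integration.integral_cong)
        (auto simp: indicator_def algebra_simps pderiv_pCons)
    finally show "(LINT x|lborel. ?i x * poly (pCons c q) (f x) * ?D x)
       = - (LINT x|lborel. poly (pderiv (pCons c q)) (f x) * g x * \<phi> x)" .
  qed
qed

text \<open>
  Passing from \<open>lebesgue_on S\<close> to \<open>lborel\<close>: a function on \<open>S\<close> is replaced by a Borel representative that
  vanishes outside of \<open>S\<close>.
\<close>

lemma
  fixes F F' :: "'a::euclidean_space \<Rightarrow> real"
  assumes S: "S \<in> sets borel" and F: "F \<in> borel_measurable (lebesgue_on S)" and F': "F' \<in> borel_measurable borel"
    and off: "\<And>x. x \<notin> S \<Longrightarrow> F' x = 0" and eq: "AE x in lebesgue_on S. F x = F' x"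
  shows integral_lebesgue_on_eq_lborel: "(LINT x|lebesgue_on S. F x) = (LINT x|lborel. F' x)"
    and integrable_lebesgue_on_iff_lborel: "integrable (lebesgue_on S) F \<longleftrightarrow> integrable lborel F'"
proof -
  have F'l: "F' \<in> borel_measurable lebesgue" using F' by (simp add: measurable_completion)
  have F'S: "F' \<in> borel_measurable (lebesgue_on S)" using F'l by (rule measurable_restrict_space1)
  have S': "S \<inter> space lebesgue \<in> sets lebesgue" using S by simp
  have e: "(\<lambda>x. indicator S x *\<^sub>R F' x) = F'" by (rule ext) (use off in \<open>auto simp: indicator_def\<close>)
  have "(LINT x|lebesgue_on S. F x) = (LINT x|lebesgue_on S. F' x)"
    by (rule integral_cong_AE[OF F F'S eq])
  also have "\<dots> = (LINT x|lborel. F' x)"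
    unfolding integral_restrict_space[OF S'] e using F' by (intro integral_completion) simp
  finally show "(LINT x|lebesgue_on S. F x) = (LINT x|lborel. F' x)" .
  have "integrable (lebesgue_on S) F \<longleftrightarrow> integrable (lebesgue_on S) F'"
    by (rule integrable_cong_AE[OF F F'S eq])
  also have "\<dots> \<longleftrightarrow> integrable lborel F'"
    unfolding integrable_restrict_space[OF S'] e using F' by (intro integrable_completion) simp
  finally show "integrable (lebesgue_on S) F \<longleftrightarrow> integrable lborel F'" .
qed

lemma borel_representative:
  fixes F :: "'a::euclidean_space \<Rightarrow> real"
  assumes S: "S \<in> sets borel" and F: "F \<in> borel_measurable (lebesgue_on S)"
  obtains F' where "F' \<in> borel_measurable borel" "\<And>x. x \<notin> S \<Longrightarrow> F' x = 0" "AE x in lebesgue_on S. F x = F' x"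
proof -
  have "(\<lambda>x. indicator S x *\<^sub>R F x) \<in> borel_measurable lebesgue"
    using F S borel_measurable_restrict_space_iff[of S lebesgue F] by simp
  then obtain G where G: "G \<in> borel_measurable lborel" "AE x in lborel. indicator S x *\<^sub>R F x = G x"
    using completion_ex_borel_measurable_real by blast
  have [measurable]: "G \<in> borel_measurable borel" "S \<in> sets borel" using G S by auto
  have "AE x in lebesgue. indicator S x *\<^sub>R F x = G x" using G(2) by (rule AE_completion)
  then have "AE x in lebesgue. x \<in> S \<longrightarrow> F x = indicator S x * G x"
    by eventually_elim auto
  then have "AE x in lebesgue_on S. F x = indicator S x * G x"
    using S by (subst AE_restrict_space_iff) auto
  then show ?thesis
    by (intro that[of "\<lambda>x. indicator S x * G x"]) auto
qed

section \<open>Uniqueness and chain rule for weak gradients\<close>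

text \<open>
  Pairing the vanishing mollifications with \<open>sgn a\<close> on \<open>K\<close> gives \<open>\<integral>\<bar>a\<bar> = 0\<close> over \<open>K\<close> in the limit.
\<close>

lemma AE_0_if_mollification_vanishes:
  fixes a :: "'a::euclidean_space \<Rightarrow> real"
  assumes a: "integrable lborel a" and K: "K \<in> sets borel" and "R > 0"
    and zero: "\<And>r \<rho> y. 0 < r \<Longrightarrow> r < R \<Longrightarrow> mollifier r \<rho> \<Longrightarrow> y \<in> K \<Longrightarrow> (LINT x|lborel. a x * \<rho> (x - y)) = 0"
  shows "AE x in lborel. x \<in> K \<longrightarrow> a x = 0"
proof -
  note [measurable] = borel_measurable_integrable[OF a, simplified] K
  define b where "b x = indicator K x * sgn (a x)" for x
  have bm[measurable]: "b \<in> borel_measurable borel" unfolding b_def by measurable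
  have b1: "\<bar>b x\<bar> \<le> 1" for x by (simp add: b_def indicator_def sgn_if)
  have ab: "a x * b x = indicator K x * \<bar>a x\<bar>" for x
    by (simp add: b_def sgn_if)
  have le: "(LINT x|lborel. a x * b x) \<le> 0 + e" if e: "e > 0" for e
  proof -
    obtain r1 where r1: "r1 > 0" "\<And>z. norm z < r1 \<Longrightarrow> L1_shift a z < e"
      using L1_shift_small[OF a e] by blast
    define r where "r = min (R / 2) r1"
    have r: "0 < r" "r < R" using r1 \<open>R > 0\<close> by (auto simp: r_def)
    obtain \<rho> :: "'a \<Rightarrow> real" where \<rho>: "mollifier r \<rho>" using mollifier_exists[OF r(1)] by blast
    have "b y * (LINT x|lborel. a x * \<rho> (x - y)) = 0" for y
      using zero[OF r \<rho>, of y] by (cases "y \<in> K") (auto simp: b_def)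
    then have "pairing \<rho> a b = 0"
      unfolding pairing_def by (simp only: Bochner_Integration.integral_zero)
    moreover have "\<bar>pairing \<rho> a b - (LINT x|lborel. a x * b x)\<bar> \<le> 1 * e"
      by (rule pairing_close[OF \<rho> a _ b1]) (use r1 in \<open>auto simp: r_def less_imp_le\<close>)
    ultimately show ?thesis by simp
  qed
  have "(LINT x|lborel. a x * b x) \<le> 0" by (rule field_le_epsilon) (rule le)
  moreover have "(LINT x|lborel. a x * b x) \<ge> 0" unfolding ab by simp
  ultimately have "(LINT x|lborel. indicator K x * \<bar>a x\<bar>) = 0" unfolding ab by simp
  moreover have "integrable lborel (\<lambda>x. indicator K x * \<bar>a x\<bar>)"
    using integrable_mult_bounded[OF a bm b1] unfolding ab .
  ultimately have "AE x in lborel. indicator K x * \<bar>a x\<bar> = 0"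
    by (subst (asm) integral_nonneg_eq_0_iff_AE) auto
  then show ?thesis by eventually_elim (auto simp: indicator_def split: if_splits)
qed

lemma integral_lebesgue_on_subset:
  fixes F :: "'a::euclidean_space \<Rightarrow> real"
  assumes "S \<in> sets borel" "T \<in> sets borel" "T \<subseteq> S" "\<And>x. x \<notin> T \<Longrightarrow> F x = 0"
  shows "(LINT x|lebesgue_on S. F x) = (LINT x|lebesgue_on T. F x)"
proof -
  have "(\<lambda>x. indicator S x *\<^sub>R F x) = (\<lambda>x. indicator T x *\<^sub>R F x)"
    by (rule ext) (use assms(3,4) in \<open>auto simp: indicator_def\<close>)
  then show ?thesis using assms by (simp add: integral_restrict_space)
qed

lemma has_weak_gradientD:
  assumes "has_weak_gradient \<Omega> f g" "test_function \<Omega> \<phi>" "b \<in> Basis"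
  shows "(LINT x|lebesgue_on \<Omega>. f x * frechet_derivative \<phi> (at x) b)
          = - (LINT x|lebesgue_on \<Omega>. (g x \<bullet> b) * \<phi> x)"
  using assms unfolding has_weak_gradient_def by blast

text \<open>
  Weak gradients are only locally integrable, so the difference of two of them is cut off to a compact
  neighbourhood \<open>K'\<close> of a given compact set \<open>K\<close>; mollifiers centred in \<open>K\<close> with a small radius are
  test functions that do not see the cut-off.  Finally \<open>\<Omega>\<close> is exhausted by countably many compact sets.
\<close>

lemma has_weak_gradient_unique:
  fixes \<Omega> :: "'a::euclidean_space set"
  assumes \<Omega>: "open \<Omega>" and g: "has_weak_gradient \<Omega> f g" "has_weak_gradient \<Omega> f g'"
  shows "AE x in lebesgue_on \<Omega>. g x = g' x"
proof -
  have \<Omega>b: "\<Omega> \<in> sets borel" using \<Omega> by simp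
  have comp: "AE x in lebesgue. x \<in> K \<longrightarrow> g x \<bullet> b = g' x \<bullet> b"
    if K: "compact K" "K \<subseteq> \<Omega>" and b: "b \<in> Basis" for K and b :: 'a
  proof -
    obtain R where R: "R > 0" "(\<Union>x\<in>K. cball x R) \<subseteq> \<Omega>"
      by (rule compact_subset_open_imp_cball_epsilon_subset[OF K(1) \<Omega> K(2)])
    define K' where "K' = (\<Union>x\<in>K. cball x R)"
    have "K' = (\<Union>x\<in>K. \<Union>y\<in>cball 0 R. {x + y})"
      by (force simp: K'_def dist_norm norm_minus_commute intro: bexI[of _ "_ - _"])
    then have K': "compact K'"
      using compact_sums'[OF K(1) compact_cball[of 0 R]] by simp
    have K'b: "K' \<in> sets borel" "K \<in> sets borel" using K' K by (auto intro: borel_compact)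
    have K'\<Omega>: "K' \<subseteq> \<Omega>" using R by (simp add: K'_def)
    have KK': "K \<subseteq> K'" using R(1) by (force simp: K'_def)
    have ig: "integrable (lebesgue_on K') g" "integrable (lebesgue_on K') g'"
      using g K' K'\<Omega> by (auto simp: has_weak_gradient_def locally_integrable_def)
    then have igb: "integrable (lebesgue_on K') (\<lambda>x. g x \<bullet> b)" "integrable (lebesgue_on K') (\<lambda>x. g' x \<bullet> b)"
      by auto
    define h where "h x = g x \<bullet> b - g' x \<bullet> b" for x
    have ih: "integrable (lebesgue_on K') h" unfolding h_def using igb by (rule Bochner_Integration.integrable_diff)
    obtain a where a: "a \<in> borel_measurable borel" "\<And>x. x \<notin> K' \<Longrightarrow> a x = 0" "AE x in lebesgue_on K'. h x = a x"
      using borel_representative[OF K'b(1) borel_measurable_integrable[OF ih]] by blast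
    have ia: "integrable lborel a"
      using integrable_lebesgue_on_iff_lborel[OF K'b(1) borel_measurable_integrable[OF ih] a] ih by simp
    have "AE x in lborel. x \<in> K \<longrightarrow> a x = 0"
    proof (rule AE_0_if_mollification_vanishes[OF ia K'b(2) R(1)])
      fix r :: real and \<rho> :: "'a \<Rightarrow> real" and y
      assume r: "0 < r" "r < R" and \<rho>: "mollifier r \<rho>" and y: "y \<in> K"
      have cy: "cball y r \<subseteq> K'" using y r by (force simp: K'_def)
      define \<phi> where "\<phi> x = \<rho> (y - x)" for x
      have \<phi>: "test_function \<Omega> \<phi>"
        unfolding \<phi>_def by (rule test_function_mollifier[OF \<rho>]) (use cy K'\<Omega> in auto)
      have \<phi>eq: "\<phi> x = \<rho> (x - y)" for x
        using mollifier_even[OF \<rho>, of "x - y"] by (simp add: \<phi>_def)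
      have \<phi>0: "\<phi> x = 0" if "x \<notin> K'" for x
      proof -
        have "x \<notin> cball y r" using that cy by blast
        then show ?thesis
          unfolding \<phi>_def by (intro mollifier_support[OF \<rho>]) (simp add: dist_norm)
      qed
      have [measurable]: "\<phi> \<in> borel_measurable borel" using test_function_bounds(3)[OF \<phi>] .
      have \<phi>l: "\<phi> \<in> borel_measurable (lebesgue_on K')"
        by (intro measurable_restrict_space1 measurable_completion) simp
      obtain C where C: "\<And>x. \<bar>\<phi> x\<bar> \<le> C" using test_function_bounds(1)[OF \<phi>] by blast
      have bi: "integrable (lebesgue_on K') (\<lambda>x. k x * \<phi> x)" if "integrable (lebesgue_on K') k" for k
      proof (rule Bochner_Integration.integrable_bound)
        show "integrable (lebesgue_on K') (\<lambda>x. C * k x)" using that by simp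
        have "\<bar>\<phi> x\<bar> \<le> \<bar>C\<bar>" for x using C[of x] by linarith
        then show "AE x in lebesgue_on K'. norm (k x * \<phi> x) \<le> norm (C * k x)"
          by (subst mult.commute) (auto simp: abs_mult intro!: mult_right_mono)
        show "(\<lambda>x. k x * \<phi> x) \<in> borel_measurable (lebesgue_on K')"
          using that \<phi>l by (auto intro: borel_measurable_times)
      qed
      have "(LINT x|lebesgue_on \<Omega>. (g x \<bullet> b) * \<phi> x) = (LINT x|lebesgue_on \<Omega>. (g' x \<bullet> b) * \<phi> x)"
        using has_weak_gradientD[OF g(1) \<phi> b] has_weak_gradientD[OF g(2) \<phi> b] by linarith
      moreover have "(LINT x|lebesgue_on \<Omega>. k x * \<phi> x) = (LINT x|lebesgue_on K'. k x * \<phi> x)" for k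
        by (rule integral_lebesgue_on_subset[OF \<Omega>b K'b(1) K'\<Omega>]) (simp add: \<phi>0)
      ultimately have "(LINT x|lebesgue_on K'. (g x \<bullet> b) * \<phi> x) = (LINT x|lebesgue_on K'. (g' x \<bullet> b) * \<phi> x)"
        by (simp only:)
      then have "(LINT x|lebesgue_on K'. h x * \<phi> x) = 0"
        using bi[OF igb(1)] bi[OF igb(2)] by (simp add: h_def left_diff_distrib)
      moreover have "(LINT x|lebesgue_on K'. h x * \<phi> x) = (LINT x|lborel. a x * \<phi> x)"
      proof (rule integral_lebesgue_on_eq_lborel[OF K'b(1)])
        show "(\<lambda>x. h x * \<phi> x) \<in> borel_measurable (lebesgue_on K')"
          using bi[OF ih] by (rule borel_measurable_integrable)
        show "AE x in lebesgue_on K'. h x * \<phi> x = a x * \<phi> x"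
          using a(3) by eventually_elim simp
      qed (use a in auto)
      ultimately show "(LINT x|lborel. a x * \<rho> (x - y)) = 0"
        by (simp add: \<phi>eq)
    qed
    then have 1: "AE x in lebesgue. x \<in> K \<longrightarrow> a x = 0" by (rule AE_completion)
    have 2: "AE x in lebesgue. x \<in> K' \<longrightarrow> h x = a x"
      using a(3) K'b by (subst (asm) AE_restrict_space_iff) auto
    show ?thesis using 1 2 by eventually_elim (use KK' in \<open>auto simp: h_def\<close>)
  qed
  obtain C where C: "\<And>n::nat. compact (C n)" "\<And>n. C n \<subseteq> \<Omega>" "\<Union> (range C) = \<Omega>"
    using open_Union_compact_subsets[OF \<Omega>] by metis
  have "AE x in lebesgue. \<forall>n. \<forall>b\<in>Basis. x \<in> C n \<longrightarrow> g x \<bullet> b = g' x \<bullet> b"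
  proof (subst AE_all_countable, intro allI)
    fix n
    have "AE x in lebesgue. x \<in> C n \<longrightarrow> g x \<bullet> b = g' x \<bullet> b" if "b \<in> Basis" for b
      by (rule comp[OF C(1) C(2) that])
    then show "AE x in lebesgue. \<forall>b\<in>Basis. x \<in> C n \<longrightarrow> g x \<bullet> b = g' x \<bullet> b"
      by (intro AE_finite_allI finite_Basis)
  qed
  then have "AE x in lebesgue. x \<in> \<Omega> \<longrightarrow> g x = g' x"
  proof eventually_elim
    case (elim x)
    show ?case
    proof
      assume "x \<in> \<Omega>"
      then obtain n where n: "x \<in> C n" using C(3) by blast
      show "g x = g' x"
        by (rule euclidean_eqI) (rule elim[rule_format, OF _ n])
    qed
  qed
  then show ?thesis
    using \<Omega>b by (subst AE_restrict_space_iff) auto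
qed

lemma L2_imp_integrable:
  fixes g :: "'a::euclidean_space \<Rightarrow> 'b::euclidean_space"
  assumes "bounded \<Omega>" "open \<Omega>" "g \<in> L2 \<Omega>"
  shows "integrable (lebesgue_on \<Omega>) g"
proof -
  have "finite_measure (lebesgue_on \<Omega>)"
    using assms by (intro finite_measure_lebesgue_on lmeasurable_open)
  then have "integrable (lebesgue_on \<Omega>) (\<lambda>x. 1 + (norm (g x))\<^sup>2)"
    using assms by (intro Bochner_Integration.integrable_add finite_measure.integrable_const) (auto simp: L2_def)
  then show ?thesis
  proof (rule Bochner_Integration.integrable_bound)
    have "norm (g x) \<le> 1 + (norm (g x))\<^sup>2" for x
    proof -
      have "0 \<le> (norm (g x) - 1 / 2)\<^sup>2" by simp
      then show ?thesis by (simp add: power2_eq_square algebra_simps)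
    qed
    then show "AE x in lebesgue_on \<Omega>. norm (g x) \<le> norm (1 + (norm (g x))\<^sup>2)"
      by simp
  qed (use assms in \<open>auto simp: L2_def\<close>)
qed

lemma integrable_imp_locally_integrable:
  fixes g :: "'a::euclidean_space \<Rightarrow> 'b::euclidean_space"
  assumes \<Omega>: "open \<Omega>" and g: "integrable (lebesgue_on \<Omega>) g"
  shows "locally_integrable \<Omega> g"
  unfolding locally_integrable_def
proof (intro allI impI)
  fix K assume K: "compact K \<and> K \<subseteq> \<Omega>"
  then have "K \<in> sets borel" by (auto intro: borel_compact)
  then have Kb: "K \<in> sets lebesgue" by simp
  have "set_integrable lebesgue \<Omega> g"
    using g \<Omega> by (simp add: set_integrable_def integrable_restrict_space)
  then have "set_integrable lebesgue K g"
    by (rule set_integrable_subset[OF _ Kb]) (use K in auto)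
  then show "integrable (lebesgue_on K) g"
    using Kb by (simp add: set_integrable_def integrable_restrict_space)
qed

text \<open>
  The values of \<open>u\<close> on a null set are unconstrained; truncating a Borel representative at \<open>B\<close> makes it
  bounded everywhere, as \<open>weak_partial_poly\<close> requires.
\<close>

lemma has_weak_gradient_poly:
  fixes \<Omega> :: "'a::euclidean_space set" and u :: "'a \<Rightarrow> real" and p :: "real poly"
  assumes \<Omega>: "open \<Omega>" "bounded \<Omega>" and u: "u \<in> borel_measurable (lebesgue_on \<Omega>)"
    and B: "AE x in lebesgue_on \<Omega>. \<bar>u x\<bar> \<le> B" "B \<ge> 0"
    and g: "g \<in> L2 \<Omega>" and w: "has_weak_gradient \<Omega> u g"
  shows "has_weak_gradient \<Omega> (\<lambda>x. poly p (u x)) (\<lambda>x. poly (pderiv p) (u x) *\<^sub>R g x)"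
proof -
  have \<Omega>b[measurable]: "\<Omega> \<in> sets borel" using \<Omega> by simp
  have fin: "finite_measure (lebesgue_on \<Omega>)"
    using \<Omega> by (intro finite_measure_lebesgue_on lmeasurable_open)
  have [measurable]: "u \<in> borel_measurable (lebesgue_on \<Omega>)" by (rule u)
  have pm: "poly q \<in> borel_measurable borel" for q :: "real poly"
    by (auto intro!: borel_measurable_continuous_onI continuous_intros)
  obtain u1 where u1: "u1 \<in> borel_measurable borel" "\<And>x. x \<notin> \<Omega> \<Longrightarrow> u1 x = 0" "AE x in lebesgue_on \<Omega>. u x = u1 x"
    using borel_representative[OF \<Omega>b u] by blast
  define f where "f x = max (- B) (min B (u1 x))" for x
  have f[measurable]: "f \<in> borel_measurable borel" unfolding f_def using u1(1) by measurable
  have f0: "f x = 0" if "x \<notin> \<Omega>" for x using u1(2)[OF that] B(2) by (simp add: f_def)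
  have fB: "\<bar>f x\<bar> \<le> B" for x using B(2) by (auto simp: f_def)
  have fu: "AE x in lebesgue_on \<Omega>. u x = f x"
    using u1(3) B(1) by eventually_elim (auto simp: f_def)
  have "integrable lborel (\<lambda>x. indicator \<Omega> x * f x)"
    by (rule integrable_mult_bounded[OF _ f fB]) (use emeasure_bounded_finite[OF \<Omega>(2)] in simp)
  also have "(\<lambda>x. indicator \<Omega> x * f x) = f" by (rule ext) (use f0 in \<open>auto simp: indicator_def\<close>)
  finally have fi: "integrable lborel f" .
  have ig: "integrable (lebesgue_on \<Omega>) g" using L2_imp_integrable[OF \<Omega>(2,1) g] .
  obtain C where C: "\<And>x. \<bar>poly (pderiv p) (f x)\<bar> \<le> C" using poly_comp_bounded[of f B, OF fB] by blast
  have pu: "(\<lambda>x. poly q (u x)) \<in> borel_measurable (lebesgue_on \<Omega>)" for q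
    by (rule measurable_compose[OF u pm])
  have ipg: "integrable (lebesgue_on \<Omega>) (\<lambda>x. poly (pderiv p) (u x) *\<^sub>R g x)"
  proof (rule Bochner_Integration.integrable_bound)
    show "integrable (lebesgue_on \<Omega>) (\<lambda>x. C *\<^sub>R g x)" using ig by simp
    show "AE x in lebesgue_on \<Omega>. norm (poly (pderiv p) (u x) *\<^sub>R g x) \<le> norm (C *\<^sub>R g x)"
      using fu
    proof eventually_elim
      fix x assume "u x = f x"
      then show "norm (poly (pderiv p) (u x) *\<^sub>R g x) \<le> norm (C *\<^sub>R g x)"
        using C[of x] by (simp add: mult_right_mono)
    qed
    show "(\<lambda>x. poly (pderiv p) (u x) *\<^sub>R g x) \<in> borel_measurable (lebesgue_on \<Omega>)"
      using pu borel_measurable_integrable[OF ig] by (intro borel_measurable_scaleR)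
  qed
  have ip: "integrable (lebesgue_on \<Omega>) (\<lambda>x. poly p (u x))"
  proof -
    obtain C where C: "\<And>x. \<bar>poly p (f x)\<bar> \<le> C" using poly_comp_bounded[of f B, OF fB] by blast
    show ?thesis
      by (rule finite_measure.integrable_const_bound[OF fin _ pu, of _ C])
         (use fu in eventually_elim, use C in auto)
  qed
  have "(LINT x|lebesgue_on \<Omega>. poly p (u x) * frechet_derivative \<phi> (at x) b)
     = - (LINT x|lebesgue_on \<Omega>. (poly (pderiv p) (u x) *\<^sub>R g x \<bullet> b) * \<phi> x)"
    if \<phi>: "test_function \<Omega> \<phi>" and b: "b \<in> Basis" for \<phi> b
  proof -
    have igb: "integrable (lebesgue_on \<Omega>) (\<lambda>x. g x \<bullet> b)" using ig by simp
    obtain k where k: "k \<in> borel_measurable borel" "\<And>x. x \<notin> \<Omega> \<Longrightarrow> k x = 0" "AE x in lebesgue_on \<Omega>. g x \<bullet> b = k x"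
      using borel_representative[OF \<Omega>b borel_measurable_integrable[OF igb]] by blast
    note [measurable] = k(1)
    have ik: "integrable lborel k"
      using integrable_lebesgue_on_iff_lborel[OF \<Omega>b borel_measurable_integrable[OF igb] k] igb by simp
    have bl: "\<psi> \<in> borel_measurable (lebesgue_on \<Omega>)" if "\<psi> \<in> borel_measurable borel" for \<psi> :: "'a \<Rightarrow> real"
      using that by (intro measurable_restrict_space1 measurable_completion) simp
    have "weak_partial \<Omega> b f k"
      unfolding weak_partial_def
    proof (intro allI impI)
      fix \<psi> assume \<psi>: "test_function \<Omega> \<psi>"
      note tb = test_function_bounds(3)[OF \<psi>] test_function_bounds(4)[OF \<psi>, of b]
      have "(LINT x|lebesgue_on \<Omega>. u x * frechet_derivative \<psi> (at x) b) = (LINT x|lborel. f x * frechet_derivative \<psi> (at x) b)"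
        by (rule integral_lebesgue_on_eq_lborel[OF \<Omega>b borel_measurable_times[OF u bl[OF tb(2)]] borel_measurable_times[OF f tb(2)]])
           (use fu in \<open>auto simp: f0\<close>)
      moreover have "(LINT x|lebesgue_on \<Omega>. (g x \<bullet> b) * \<psi> x) = (LINT x|lborel. k x * \<psi> x)"
        by (rule integral_lebesgue_on_eq_lborel[OF \<Omega>b borel_measurable_times[OF borel_measurable_integrable[OF igb] bl[OF tb(1)]]
              borel_measurable_times[OF k(1) tb(1)]])
           (use k(3) in \<open>auto simp: k(2)\<close>)
      ultimately show "(LINT x|lborel. f x * frechet_derivative \<psi> (at x) b) = - (LINT x|lborel. k x * \<psi> x)"
        using has_weak_gradientD[OF w \<psi> b] by (simp only:)
    qed
    from weak_partial_poly[OF \<Omega> fi fB ik k(2) this, of p]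
    have "(LINT x|lborel. indicator \<Omega> x * poly p (f x) * frechet_derivative \<phi> (at x) b)
       = - (LINT x|lborel. poly (pderiv p) (f x) * k x * \<phi> x)"
      using \<phi> by (simp add: weak_partial_def)
    moreover
    note tb = test_function_bounds(3)[OF \<phi>] test_function_bounds(4)[OF \<phi>, of b]
    have fu': "AE x in lebesgue_on \<Omega>. x \<in> \<Omega> \<and> u x = f x"
      using fu AE_space[of "lebesgue_on \<Omega>"] by eventually_elim simp
    have "(LINT x|lebesgue_on \<Omega>. poly p (u x) * frechet_derivative \<phi> (at x) b)
       = (LINT x|lborel. indicator \<Omega> x * poly p (f x) * frechet_derivative \<phi> (at x) b)"
    proof (rule integral_lebesgue_on_eq_lborel[OF \<Omega>b borel_measurable_times[OF pu bl[OF tb(2)]]])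
      show "AE x in lebesgue_on \<Omega>. poly p (u x) * frechet_derivative \<phi> (at x) b = indicator \<Omega> x * poly p (f x) * frechet_derivative \<phi> (at x) b"
        using fu' by eventually_elim simp
    qed (auto intro!: borel_measurable_times tb measurable_compose[OF f pm])
    moreover have "(LINT x|lebesgue_on \<Omega>. (poly (pderiv p) (u x) *\<^sub>R g x \<bullet> b) * \<phi> x)
       = (LINT x|lborel. poly (pderiv p) (f x) * k x * \<phi> x)"
    proof (rule integral_lebesgue_on_eq_lborel[OF \<Omega>b])
      show "AE x in lebesgue_on \<Omega>. (poly (pderiv p) (u x) *\<^sub>R g x \<bullet> b) * \<phi> x = poly (pderiv p) (f x) * k x * \<phi> x"
        using fu k(3) by eventually_elim simp
      show "(\<lambda>x. (poly (pderiv p) (u x) *\<^sub>R g x \<bullet> b) * \<phi> x) \<in> borel_measurable (lebesgue_on \<Omega>)"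
        by (rule borel_measurable_times[OF borel_measurable_inner[OF borel_measurable_integrable[OF ipg] borel_measurable_const] bl[OF tb(1)]])
    qed (auto simp: k(2) intro!: borel_measurable_times k(1) tb measurable_compose[OF f pm])
    ultimately show ?thesis by simp
  qed
  then show ?thesis
    using integrable_imp_locally_integrable[OF \<Omega>(1) ip] integrable_imp_locally_integrable[OF \<Omega>(1) ipg]
    unfolding has_weak_gradient_def by blast
qed

section \<open>Pointwise estimates for the entropy of mixing\<close>

lemma relative_entropy_nonneg:
  fixes x w :: real
  assumes "0 \<le> x" "0 < w"
  shows "0 \<le> x * ln x - x * ln w - x + w"
    and "x * ln x - x * ln w - x + w = 0 \<Longrightarrow> x = w"
proof -
  have *: "x * ln x - x * ln w - x + w = x * ((w / x - 1) - ln (w / x))" if "x > 0"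
    using that assms by (simp add: ln_div field_simps)
  show "0 \<le> x * ln x - x * ln w - x + w"
  proof (cases "x = 0")
    case False
    then have "x > 0" using assms by simp
    moreover have "ln (w / x) \<le> w / x - 1" using \<open>x > 0\<close> assms by (intro ln_le_minus_one) simp
    ultimately show ?thesis using * by simp
  qed (use assms in simp)
  assume eq: "x * ln x - x * ln w - x + w = 0"
  then have "x > 0" using assms by (cases "x = 0") auto
  then have "ln (w / x) = w / x - 1" using eq * by simp
  then have "w / x = 1" using ln_eq_minus_one[of "w / x"] \<open>x > 0\<close> assms by simp
  then show "x = w" using \<open>x > 0\<close> by simp
qed

text \<open>
  This is why mass may be taken away in proportion to \<open>y\<close> at bounded cost: \<open>- y * ln w\<close> stays bounded
  when \<open>w\<close> is comparable to \<open>y\<close>.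
\<close>

lemma neg_mult_ln_le:
  fixes y w :: real
  assumes "0 \<le> y" "y \<le> 1" "y / 2 \<le> w" "0 < w" "w \<le> 1"
  shows "- (y * ln w) \<le> 2"
proof -
  have "- (y * ln w) \<le> - (y * (ln y - ln 2))"
  proof (cases "y = 0")
    case False
    then have "y > 0" using assms by simp
    have "ln (y / 2) \<le> ln w" using \<open>y > 0\<close> assms by simp
    then have "ln y - ln 2 \<le> ln w" using \<open>y > 0\<close> by (simp add: ln_div)
    then show ?thesis using \<open>y > 0\<close> by (simp add: mult_left_mono)
  qed simp
  also have "\<dots> = - (y * ln y) + y * ln 2" by (simp add: algebra_simps)
  also have "- (y * ln y) \<le> 1"
    using relative_entropy_nonneg(1)[of y 1] assms by simp
  also have "y * ln 2 \<le> 1 * 1"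
    using assms ln_2_less_1 by (intro mult_mono) auto
  finally show ?thesis by simp
qed

lemma abs_mult_ln_le:
  fixes x :: real
  assumes "0 \<le> x" "x \<le> 1"
  shows "\<bar>x * ln x\<bar> \<le> 1"
proof -
  have "x * ln x \<le> 0" using assms by (cases "x = 0") (auto intro: mult_nonneg_nonpos)
  then show ?thesis using relative_entropy_nonneg(1)[of x 1] assms by simp
qed

definition mixing_density :: "real \<Rightarrow> real \<Rightarrow> real" where
  "mixing_density \<beta> x = x * ln x + (1 - x) * ln (1 - x) + \<beta> * x * (1 - x)"

lemma mixing_density_reflect: "mixing_density \<beta> (1 - x) = mixing_density \<beta> x"
  by (simp add: mixing_density_def)

lemma mixing_density_bounded:
  assumes "0 \<le> x" "x \<le> 1" "0 \<le> \<beta>"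
  shows "\<bar>mixing_density \<beta> x\<bar> \<le> 2 + \<beta>"
proof -
  have "\<beta> * x * (1 - x) \<le> \<beta>"
    using assms mult_le_one[of x "1 - x"] mult_left_mono[of "x * (1 - x)" 1 \<beta>] by (simp add: mult.assoc)
  moreover have "0 \<le> \<beta> * x * (1 - x)" using assms by simp
  ultimately show ?thesis
    using abs_mult_ln_le[of x] abs_mult_ln_le[of "1 - x"] assms unfolding mixing_density_def by linarith
qed

lemma mixing_density_measurable [measurable]: "mixing_density \<beta> \<in> borel_measurable borel"
  unfolding mixing_density_def[abs_def] by measurable

text \<open>
  The entropy lies above its tangent at the new value \<open>v\<close>.  Using \<open>v\<close> and not \<open>x\<close> as the base point keeps the
  logarithms finite, as \<open>x\<close> may be \<open>0\<close> or \<open>1\<close>; the concave term is expanded at \<open>x\<close>.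
\<close>

lemma mixing_density_tangent:
  assumes x: "0 \<le> x" "x \<le> 1" and v: "0 < v" "v < 1" and \<beta>: "0 \<le> \<beta>"
  shows "mixing_density \<beta> v - mixing_density \<beta> x \<le> (v - x) * (ln v - ln (1 - v) + \<beta> * (1 - 2 * x))"
proof -
  have "0 \<le> x * ln x - x * ln v - x + v" "0 \<le> (1 - x) * ln (1 - x) - (1 - x) * ln (1 - v) - (1 - x) + (1 - v)"
    using relative_entropy_nonneg(1)[of x v] relative_entropy_nonneg(1)[of "1 - x" "1 - v"] assms by auto
  moreover have "0 \<le> \<beta> * (v - x)\<^sup>2" using \<beta> by simp
  ultimately show ?thesis
    unfolding mixing_density_def by (simp add: algebra_simps power2_eq_square)
qed

lemma competitor_bounds:
  fixes x t B :: real and N :: nat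
  assumes x: "0 \<le> x" "x \<le> 1" and t: "0 < t" "t * (real N + B) \<le> 1 / 2" and B: "0 < B" and N: "1 \<le> N"
  defines "v \<equiv> x + t * ((1 - x) ^ N - B * x)"
  shows "x / 2 \<le> v" "(1 - x) / 2 \<le> 1 - v" "0 < v" "v < 1"
proof -
  have tN: "t * real N + t * B \<le> 1 / 2" using t(2) by (simp add: distrib_left)
  have tN0: "t \<le> t * real N" using t N by simp
  have tB0: "0 < t * B" using t B by simp
  have pw: "0 \<le> (1 - x) ^ N" "(1 - x) ^ N \<le> 1 - x"
    using x N power_decreasing[of 1 N "1 - x"] by auto
  have t2: "t \<le> 1 / 2" "t * B \<le> 1 / 2" using tN tN0 tB0 t by linarith+
  have a: "t * B * x \<le> x / 2" using mult_right_mono[OF t2(2) x(1)] by simp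
  have b: "t * (1 - x) ^ N \<le> (1 - x) / 2"
    using mult_mono[OF t2(1) pw(2)] pw(1) t by simp
  have v: "v = x + t * (1 - x) ^ N - t * B * x" by (simp add: v_def algebra_simps)
  have n: "0 \<le> t * (1 - x) ^ N" "0 \<le> t * B * x" using pw t x tB0 by auto
  show h: "x / 2 \<le> v" "(1 - x) / 2 \<le> 1 - v" using a b n v by (auto simp: field_simps)
  show "0 < v"
  proof (cases "x = 0")
    case True then show ?thesis using v t by simp
  next
    case False
    then have "0 < x" using x by simp
    then show ?thesis using h by linarith
  qed
  show "v < 1"
  proof (cases "x = 1")
    case True then show ?thesis using v tB0 N by (simp add: power_0_left)
  next
    case False
    then have "0 < (1 - x) / 2" using x by simp
    with h(2) have "0 < 1 - v" by (rule less_le_trans[rotated])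
    then show ?thesis by simp
  qed
qed

text \<open>
  The effect on the bulk energy of adding \<open>t * (1 - x) ^ N\<close> and removing \<open>t * B * x\<close>.  Where \<open>x < 2 * s\<close>
  the addition is rewarded with \<open>ln (3 * s)\<close>, since the new value is at most \<open>3 * s\<close>; elsewhere one power of
  \<open>1 - x\<close> is spent on the singularity of \<open>ln (1 - x)\<close>.  The removal costs a bounded amount per unit of \<open>B\<close>.
\<close>

lemma competitor_gain:
  fixes x t B s \<beta> :: real and N :: nat
  assumes x: "0 \<le> x" "x \<le> 1" and t: "0 < t" "t \<le> s" "t * (real N + B) \<le> 1 / 2" and B: "0 < B" and N: "1 \<le> N"
    and s: "3 * s \<le> 1 / 2" and \<beta>: "0 \<le> \<beta>"
  shows "mixing_density \<beta> (x + t * ((1 - x) ^ N - B * x)) - mixing_density \<beta> x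
      \<le> t * ((if x < 2 * s then (1 - x) ^ N * (ln (3 * s) + 1 + \<beta>) else (2 + \<beta>) * (1 - x) ^ (N - 1)) + B * (2 + \<beta>))"
proof -
  define v where "v = x + t * ((1 - x) ^ N - B * x)"
  define p where "p = (1 - x) ^ N"
  have v: "x / 2 \<le> v" "(1 - x) / 2 \<le> 1 - v" "0 < v" "v < 1"
    unfolding v_def using competitor_bounds[OF x t(1,3) B N] by auto
  have p: "0 \<le> p" "p \<le> 1" unfolding p_def using x by (auto intro: power_le_one)
  have pN: "p = (1 - x) ^ (N - 1) * (1 - x)"
    unfolding p_def using N by (metis Suc_pred' less_eq_Suc_le power_Suc2 One_nat_def)
  have p': "0 \<le> (1 - x) ^ (N - 1)" "p \<le> (1 - x) ^ (N - 1)"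
    using x unfolding pN by (auto simp: mult_left_le)
  have lnv: "ln v \<le> 0" "ln (1 - v) \<le> 0" using v by auto
  have part1: "p * (ln v - ln (1 - v)) + \<beta> * p \<le> (if x < 2 * s then p * (ln (3 * s) + 1 + \<beta>) else (2 + \<beta>) * (1 - x) ^ (N - 1))"
  proof (cases "x < 2 * s")
    case True
    have "t * p \<le> s * 1" using t p by (intro mult_mono) auto
    moreover have "0 \<le> t * (B * x)" using t B x by simp
    ultimately have v3: "v \<le> 3 * s" unfolding v_def p_def[symmetric] using True by (simp add: right_diff_distrib)
    have "ln v \<le> ln (3 * s)" using v3 v by simp
    moreover have "ln (1 / 2) \<le> ln (1 - v)" using v3 v s by (intro ln_mono) auto
    then have "- ln (1 - v) \<le> 1" using ln_2_less_1 by (simp add: ln_div)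
    ultimately have "ln v - ln (1 - v) + \<beta> \<le> ln (3 * s) + 1 + \<beta>" by linarith
    then show ?thesis using True p mult_left_mono[of _ _ p] by (simp add: distrib_left[symmetric] mult.commute[of \<beta> p])
  next
    case False
    have "- ((1 - x) * ln (1 - v)) \<le> 2"
      by (rule neg_mult_ln_le) (use x v in auto)
    from mult_left_mono[OF this p'(1)] have "- (p * ln (1 - v)) \<le> 2 * (1 - x) ^ (N - 1)"
      unfolding pN by (simp add: mult_ac)
    moreover have "p * ln v \<le> 0" using p lnv by (simp add: mult_nonneg_nonpos)
    moreover have "\<beta> * p \<le> \<beta> * (1 - x) ^ (N - 1)" using p' \<beta> by (simp add: mult_left_mono)
    ultimately show ?thesis using False by (simp add: algebra_simps)
  qed
  have part2: "- (x * ln v) + x * ln (1 - v) + \<beta> * x \<le> 2 + \<beta>"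
  proof -
    have "- (x * ln v) \<le> 2" by (rule neg_mult_ln_le) (use x v in auto)
    moreover have "x * ln (1 - v) \<le> 0" using x lnv by (simp add: mult_nonneg_nonpos)
    moreover have "\<beta> * x \<le> \<beta>" using x \<beta> by (simp add: mult_left_le)
    ultimately show ?thesis by linarith
  qed
  have "\<beta> * (p - B * x) * (1 - 2 * x) \<le> \<beta> * (p + B * x)"
  proof -
    have "(p - B * x) * (1 - 2 * x) \<le> p + B * x"
    proof -
      have "0 \<le> p * (2 * x)" "0 \<le> B * x * (2 - 2 * x)" using p B x by auto
      then show ?thesis by (simp add: algebra_simps)
    qed
    then show ?thesis using mult_left_mono[OF _ \<beta>] by (simp add: mult.assoc)
  qed
  then have "(p - B * x) * (ln v - ln (1 - v) + \<beta> * (1 - 2 * x))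
     \<le> (p * (ln v - ln (1 - v)) + \<beta> * p) + B * (- (x * ln v) + x * ln (1 - v) + \<beta> * x)"
    by (simp add: algebra_simps)
  also have "\<dots> \<le> (if x < 2 * s then p * (ln (3 * s) + 1 + \<beta>) else (2 + \<beta>) * (1 - x) ^ (N - 1)) + B * (2 + \<beta>)"
    by (intro add_mono part1 mult_left_mono part2) (use B in auto)
  finally have le: "(p - B * x) * (ln v - ln (1 - v) + \<beta> * (1 - 2 * x)) \<le> \<dots>" .
  have "mixing_density \<beta> v - mixing_density \<beta> x \<le> (v - x) * (ln v - ln (1 - v) + \<beta> * (1 - 2 * x))"
    by (rule mixing_density_tangent) (use x v \<beta> in auto)
  also have "\<dots> = t * ((p - B * x) * (ln v - ln (1 - v) + \<beta> * (1 - 2 * x)))"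
    by (simp add: v_def p_def)
  also have "\<dots> \<le> t * ((if x < 2 * s then p * (ln (3 * s) + 1 + \<beta>) else (2 + \<beta>) * (1 - x) ^ (N - 1)) + B * (2 + \<beta>))"
    by (rule mult_left_mono[OF le]) (use t in simp)
  finally show ?thesis unfolding v_def p_def .
qed

section \<open>Lower bound from stability under polynomial competitors\<close>

definition contraction_poly :: "real \<Rightarrow> real poly \<Rightarrow> bool" where
  "contraction_poly \<eta> p \<longleftrightarrow> (\<forall>x\<in>{0..1}. poly p x \<in> {0..1} \<and> \<bar>poly (pderiv p) x\<bar> \<le> 1 \<and> \<bar>poly p x - x\<bar> \<le> \<eta>)"

definition poly_stable :: "'a measure \<Rightarrow> real \<Rightarrow> real \<Rightarrow> ('a \<Rightarrow> real) \<Rightarrow> bool" where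
  "poly_stable M \<beta> \<eta> u \<longleftrightarrow> (\<forall>p. contraction_poly \<eta> p \<longrightarrow> (LINT x|M. poly p (u x)) = (LINT x|M. u x) \<longrightarrow>
     (LINT x|M. mixing_density \<beta> (u x)) \<le> (LINT x|M. mixing_density \<beta> (poly p (u x))))"

lemma poly_measurable: "poly (q :: real poly) \<in> borel_measurable borel"
  by (auto intro!: borel_measurable_continuous_onI continuous_intros)

text \<open>
  Chosen so that \<open>ln (3 * s)\<close> outweighs all bounded costs by one: \<open>ln (3 * s) + 1 + \<beta> + K = - 1\<close> for
  \<open>K = (2 + \<beta>) * V / m\<close>, the cost of restoring the mass.
\<close>

definition lower_threshold :: "real \<Rightarrow> real \<Rightarrow> real \<Rightarrow> real" where
  "lower_threshold \<beta> V m = exp (- (2 + \<beta> + (2 + \<beta>) * V / m)) / 3"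

text \<open>
  Stability under the competitor of degree \<open>N\<close>: the reward collected on \<open>{u < s}\<close> is at most the loss on
  \<open>{u \<ge> 2 * s}\<close>.  The decisive point is the gap between \<open>1 - s\<close> and \<open>1 - 2 * s\<close>, which powers amplify.
\<close>

lemma poly_stable_power_estimate:
  fixes u :: "'a \<Rightarrow> real"
  assumes M: "finite_measure M" and u[measurable]: "u \<in> borel_measurable M"
    and u01: "AE x in M. 0 \<le> u x \<and> u x \<le> 1"
    and m: "0 < (LINT x|M. u x)" "(LINT x|M. u x) < measure M (space M)"
    and \<beta>: "0 \<le> \<beta>" and \<eta>: "0 < \<eta>" and stable: "poly_stable M \<beta> \<eta> u" and N: "1 \<le> N"
  defines "V \<equiv> measure M (space M)"
  defines "s \<equiv> lower_threshold \<beta> V (LINT x|M. u x)"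
  shows "(1 - s) ^ N * measure M {x \<in> space M. u x < s} \<le> (2 + \<beta> + (2 + \<beta>) * V / (LINT x|M. u x)) * V * (1 - 2 * s) ^ (N - 1)"
proof -
  interpret finite_measure M by (rule M)
  define m where "m = (LINT x|M. u x)"
  define K where "K = (2 + \<beta>) * V / m"
  define A where "A = (LINT x|M. (1 - u x) ^ N)"
  define B where "B = A / m"
  have m0: "0 < m" and V0: "0 \<le> V" using m by (auto simp: m_def V_def)
  have K0: "0 \<le> K" using m0 V0 \<beta> by (simp add: K_def)
  have s_def': "s = exp (- (2 + \<beta> + K)) / 3" by (simp add: s_def lower_threshold_def K_def m_def)
  have s0: "0 < s" by (simp add: s_def')
  have "exp (- (2 + \<beta> + K)) \<le> exp (- 1)" using \<beta> K0 by simp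
  also have "exp (- 1) \<le> (1 / 2 :: real)" using exp_ge_add_one_self[of 1] by (simp add: exp_minus field_simps)
  finally have s3: "3 * s \<le> 1 / 2" by (simp add: s_def')
  have lns: "ln (3 * s) = - (2 + \<beta> + K)" by (simp add: s_def')
  have pow: "0 \<le> (1 - y) ^ k" "(1 - y) ^ k \<le> 1" if "0 \<le> y" "y \<le> 1" for y :: real and k
    using that by (auto intro: power_le_one)
  have intp: "integrable M (\<lambda>x. (1 - u x) ^ k)" for k
    by (rule integrable_const_bound[of _ 1]) (use u01 in \<open>eventually_elim, auto simp: power_abs[symmetric] abs_if pow\<close>, measurable)
  have intu: "integrable M u"
    by (rule integrable_const_bound[of _ 1]) (use u01 in \<open>eventually_elim, auto\<close>)
  have pos: "AE x in M. 0 \<le> (1 - u x) ^ N"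
    using u01 by eventually_elim auto
  have "A \<noteq> 0"
  proof
    assume "A = 0"
    then have "AE x in M. (1 - u x) ^ N = 0"
      unfolding A_def by (simp add: integral_nonneg_eq_0_iff_AE[OF intp pos])
    then have "AE x in M. u x = 1" by eventually_elim auto
    then have "(LINT x|M. u x) = (LINT x|M. 1)" by (intro integral_cong_AE) auto
    then show False using m by simp
  qed
  moreover have "0 \<le> A" unfolding A_def
    by (rule integral_nonneg_AE[OF pos])
  ultimately have A0: "0 < A" by simp
  have B0: "0 < B" using A0 m0 by (simp add: B_def)
  \<comment> \<open>in turn: the new values stay below \<open>3 * s\<close> on \<open>{u < 2 * s}\<close>; contraction and invariance of the unit interval; closeness to the identity\<close>
  define t where "t = min s (min (1 / (2 * (real N + B))) (\<eta> / (1 + B)))"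
  have t0: "0 < t" using s0 B0 \<eta> N by (simp add: t_def)
  have ts: "t \<le> s" by (simp add: t_def)
  have "t \<le> 1 / (2 * (real N + B))" by (simp add: t_def)
  then have tN: "t * (real N + B) \<le> 1 / 2" using B0 N by (simp add: field_simps)
  have "t \<le> \<eta> / (1 + B)" by (simp add: t_def)
  then have t\<eta>: "t * (1 + B) \<le> \<eta>" using B0 by (simp add: field_simps)
  define p where "p = [:0, 1:] + smult t ([:1, -1:] ^ N - smult B [:0, 1:])"
  have px: "poly p x = x + t * ((1 - x) ^ N - B * x)" for x
    by (simp add: p_def poly_power)
  have dpx: "poly (pderiv p) x = 1 - t * (real N * (1 - x) ^ (N - 1) + B)" for x
    by (simp add: p_def pderiv_add pderiv_smult pderiv_diff pderiv_power pderiv_pCons poly_power algebra_simps)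
  have "contraction_poly \<eta> p"
    unfolding contraction_poly_def
  proof (intro ballI conjI)
    fix x :: real assume "x \<in> {0..1}"
    then have x: "0 \<le> x" "x \<le> 1" by auto
    show "poly p x \<in> {0..1}"
      using competitor_bounds[OF x t0 tN B0 N] unfolding px by auto
    have "0 \<le> t * (real N * (1 - x) ^ (N - 1) + B)" using t0 B0 pow[OF x] by simp
    moreover have "t * (real N * (1 - x) ^ (N - 1) + B) \<le> t * (real N + B)"
      using t0 pow[OF x, of "N - 1"] by (intro mult_left_mono add_right_mono) (auto simp: mult_left_le)
    ultimately show "\<bar>poly (pderiv p) x\<bar> \<le> 1"
      unfolding dpx using tN by (intro abs_leI) linarith+
    have "\<bar>(1 - x) ^ N - B * x\<bar> \<le> 1 + B"
    proof -
      have "0 \<le> B * x" "B * x \<le> B" using B0 x by (auto simp: mult_left_le)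
      then show ?thesis using pow[OF x, of N] by linarith
    qed
    then have "t * \<bar>(1 - x) ^ N - B * x\<bar> \<le> t * (1 + B)" using t0 by (intro mult_left_mono) auto
    from order_trans[OF this t\<eta>] show "\<bar>poly p x - x\<bar> \<le> \<eta>"
      unfolding px using t0 by (simp add: abs_mult)
  qed
  moreover have "(LINT x|M. poly p (u x)) = (LINT x|M. u x)"
    unfolding px using intp[of N] intu m0 by (simp add: B_def A_def m_def)
  ultimately have stab: "(LINT x|M. mixing_density \<beta> (u x)) \<le> (LINT x|M. mixing_density \<beta> (poly p (u x)))"
    using stable unfolding poly_stable_def by blast
  \<comment> \<open>the pointwise gain, except for the cost of restoring the mass\<close>
  define G where "G x = (if u x < 2 * s then (1 - u x) ^ N * (ln (3 * s) + 1 + \<beta>) else (2 + \<beta>) * (1 - u x) ^ (N - 1))" for x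
  have [measurable]: "G \<in> borel_measurable M" unfolding G_def by measurable
  have intG: "integrable M G"
  proof (rule integrable_const_bound[of _ "\<bar>ln (3 * s) + 1 + \<beta>\<bar> + (2 + \<beta>)"])
    show "AE x in M. norm (G x) \<le> \<bar>ln (3 * s) + 1 + \<beta>\<bar> + (2 + \<beta>)"
      using u01
    proof eventually_elim
      case (elim x)
      define L where "L = ln (3 * s) + 1 + \<beta>"
      have a: "\<bar>(1 - u x) ^ k\<bar> \<le> 1" for k using elim pow[of "u x" k] by auto
      have "\<bar>(1 - u x) ^ N * L\<bar> \<le> 1 * \<bar>L\<bar>"
        unfolding abs_mult by (intro mult_right_mono a) simp
      moreover have "\<bar>(2 + \<beta>) * (1 - u x) ^ (N - 1)\<bar> \<le> \<bar>2 + \<beta>\<bar> * 1"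
        unfolding abs_mult by (intro mult_left_mono a) simp
      ultimately show ?case
        using \<beta> unfolding G_def L_def[symmetric] by (cases "u x < 2 * s") simp_all
    qed
  qed simp
  have intF: "integrable M (\<lambda>x. mixing_density \<beta> (u x))"
    by (rule integrable_const_bound[of _ "2 + \<beta>"])
       (use u01 in \<open>eventually_elim, auto intro: mixing_density_bounded[OF _ _ \<beta>]\<close>, measurable)
  have intFp: "integrable M (\<lambda>x. mixing_density \<beta> (poly p (u x)))"
  proof (rule integrable_const_bound[of _ "2 + \<beta>"])
    show "AE x in M. norm (mixing_density \<beta> (poly p (u x))) \<le> 2 + \<beta>"
      using u01
    proof eventually_elim
      case (elim x)
      then have "poly p (u x) \<in> {0..1}"
        using \<open>contraction_poly \<eta> p\<close> by (simp add: contraction_poly_def)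
      then show ?case using mixing_density_bounded[OF _ _ \<beta>] by simp
    qed
    show "(\<lambda>x. mixing_density \<beta> (poly p (u x))) \<in> borel_measurable M"
      by (rule measurable_compose[OF measurable_compose[OF u poly_measurable] mixing_density_measurable])
  qed
  have ind: "integrable M (\<lambda>x. indicator {x \<in> space M. u x < s} x :: real)"
    by (rule integrable_const_bound[of _ 1]) (auto simp: indicator_def)
  have "0 \<le> (LINT x|M. mixing_density \<beta> (poly p (u x)) - mixing_density \<beta> (u x))"
    using stab intF intFp by simp
  also have "\<dots> \<le> (LINT x|M. t * (G x + B * (2 + \<beta>)))"
  proof (rule integral_mono_AE)
    show "AE x in M. mixing_density \<beta> (poly p (u x)) - mixing_density \<beta> (u x) \<le> t * (G x + B * (2 + \<beta>))"
      using u01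
    proof eventually_elim
      case (elim x)
      then show ?case
        unfolding px G_def using competitor_gain[OF _ _ t0 ts tN B0 N s3 \<beta>, of "u x"] by simp
    qed
  qed (use intF intFp intG in auto)
  also have "\<dots> = t * ((LINT x|M. G x) + B * (2 + \<beta>) * V)"
    using intG by (simp add: V_def mult_ac)
  finally have "0 \<le> (LINT x|M. G x) + B * (2 + \<beta>) * V"
    using t0 by (simp add: zero_le_mult_iff)
  also have "B * (2 + \<beta>) * V = K * A" by (simp add: B_def K_def)
  also have "(LINT x|M. G x) + K * A = (LINT x|M. G x + K * (1 - u x) ^ N)"
    unfolding A_def using intG intp[of N] by simp
  also have "\<dots> \<le> (LINT x|M. (2 + \<beta> + K) * (1 - 2 * s) ^ (N - 1) - (1 - s) ^ N * indicator {x \<in> space M. u x < s} x)"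
  proof (rule integral_mono_AE)
    show "AE x in M. G x + K * (1 - u x) ^ N \<le> (2 + \<beta> + K) * (1 - 2 * s) ^ (N - 1) - (1 - s) ^ N * indicator {x \<in> space M. u x < s} x"
      using u01 AE_space
    proof eventually_elim
      case (elim x)
      then have ux: "0 \<le> u x" "u x \<le> 1" by auto
      have nn: "0 \<le> (2 + \<beta> + K) * (1 - 2 * s) ^ (N - 1)" using \<beta> K0 s3 s0 by simp
      show ?case
      proof (cases "u x < 2 * s")
        case True
        then have eq: "G x + K * (1 - u x) ^ N = - ((1 - u x) ^ N)"
          unfolding G_def lns by (simp add: algebra_simps)
        show ?thesis
        proof (cases "u x < s")
          case True
          have "(1 - s) ^ N \<le> (1 - u x) ^ N" using True s3 s0 by (intro power_mono) auto
          then show ?thesis unfolding eq using nn True elim by simp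
        next
          case False
          then show ?thesis unfolding eq using nn pow[OF ux, of N] by simp
        qed
      next
        case False
        have "(1 - u x) ^ N \<le> (1 - u x) ^ (N - 1)"
          using ux N by (intro power_decreasing) auto
        then have "G x + K * (1 - u x) ^ N \<le> (2 + \<beta> + K) * (1 - u x) ^ (N - 1)"
          using False K0 mult_left_mono[of _ _ K] by (simp add: G_def distrib_right)
        also have "\<dots> \<le> (2 + \<beta> + K) * (1 - 2 * s) ^ (N - 1)"
          using False ux \<beta> K0 by (intro mult_left_mono power_mono) auto
        finally show ?thesis using False s0 by simp
      qed
    qed
  next
    show "integrable M (\<lambda>x. (2 + \<beta> + K) * (1 - 2 * s) ^ (N - 1) - (1 - s) ^ N * indicator {x \<in> space M. u x < s} x)"
      by (intro Bochner_Integration.integrable_diff integrable_mult_right ind integrable_const)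
  qed (use intG intp[of N] in auto)
  also have "\<dots> = (2 + \<beta> + K) * (1 - 2 * s) ^ (N - 1) * V - (1 - s) ^ N * measure M {x \<in> space M. u x < s}"
    by (subst Bochner_Integration.integral_diff[OF integrable_const integrable_mult_right[OF ind]]) (simp add: V_def Int_def conj_ac)
  finally show ?thesis by (simp add: K_def m_def mult_ac)
qed

text \<open>
  Dividing the power estimate by \<open>(1 - s) ^ N\<close> leaves a geometric sequence with ratio
  \<open>(1 - 2 * s) / (1 - s) < 1\<close> on the right.
\<close>

lemma poly_stable_lower_bound:
  fixes u :: "'a \<Rightarrow> real"
  assumes M: "finite_measure M" and u[measurable]: "u \<in> borel_measurable M"
    and u01: "AE x in M. 0 \<le> u x \<and> u x \<le> 1"
    and m: "0 < (LINT x|M. u x)" "(LINT x|M. u x) < measure M (space M)"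
    and \<beta>: "0 \<le> \<beta>" and \<eta>: "0 < \<eta>" and stable: "poly_stable M \<beta> \<eta> u"
  shows "AE x in M. lower_threshold \<beta> (measure M (space M)) (LINT x|M. u x) \<le> u x"
proof -
  interpret finite_measure M by (rule M)
  define V where "V = measure M (space M)"
  define m where "m = (LINT x|M. u x)"
  define s where "s = lower_threshold \<beta> V m"
  define Q where "Q = (2 + \<beta> + (2 + \<beta>) * V / m) * V"
  define \<mu> where "\<mu> = measure M {x \<in> space M. u x < s}"
  have m0: "0 < m" and V0: "0 \<le> V" using assms by (auto simp: m_def V_def)
  have "0 \<le> (2 + \<beta>) * V / m" using m0 V0 \<beta> by simp
  then have "exp (- (2 + \<beta> + (2 + \<beta>) * V / m)) < 1" using \<beta> by simp
  then have s: "0 < s" "3 * s < 1" by (auto simp: s_def lower_threshold_def)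
  have "(1 - s) * \<mu> \<le> Q * ((1 - 2 * s) / (1 - s)) ^ k" for k
  proof -
    have "(1 - s) ^ Suc k * \<mu> \<le> Q * (1 - 2 * s) ^ k"
      using poly_stable_power_estimate[OF M u u01 m \<beta> \<eta> stable, of "Suc k"]
      by (simp add: V_def m_def s_def Q_def \<mu>_def)
    then show ?thesis using s by (simp add: power_divide field_simps)
  qed
  moreover have "(\<lambda>k. Q * ((1 - 2 * s) / (1 - s)) ^ k) \<longlonglongrightarrow> Q * 0"
    by (intro tendsto_mult tendsto_const LIMSEQ_power_zero) (use s in simp)
  ultimately have "(1 - s) * \<mu> \<le> Q * 0"
    by (intro LIMSEQ_le_const) auto
  moreover have "0 \<le> \<mu>" by (simp add: \<mu>_def)
  ultimately have "\<mu> = 0" using s by (simp add: mult_le_0_iff)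
  then have "emeasure M {x \<in> space M. u x < s} = 0"
    by (simp add: \<mu>_def emeasure_eq_measure)
  then have "AE x in M. \<not> u x < s"
    by (subst AE_iff_measurable[of "{x \<in> space M. u x < s}"]) auto
  then show ?thesis by eventually_elim (simp add: s_def V_def m_def)
qed

text \<open>
  The polynomial \<open>1 - p (1 - x)\<close> is a competitor for \<open>u\<close> whenever \<open>p\<close> is one for \<open>1 - u\<close>, and the bulk
  energy is symmetric.
\<close>

lemma poly_stable_reflect:
  fixes u :: "'a \<Rightarrow> real"
  assumes M: "finite_measure M" and u[measurable]: "u \<in> borel_measurable M"
    and u01: "AE x in M. 0 \<le> u x \<and> u x \<le> 1" and stable: "poly_stable M \<beta> \<eta> u"
  shows "poly_stable M \<beta> \<eta> (\<lambda>x. 1 - u x)"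
  unfolding poly_stable_def
proof (intro allI impI)
  interpret finite_measure M by (rule M)
  fix p assume p: "contraction_poly \<eta> p" and I: "(LINT x|M. poly p (1 - u x)) = (LINT x|M. 1 - u x)"
  define q where "q = 1 - pcompose p [:1, -1:]"
  have q: "poly q x = 1 - poly p (1 - x)" "poly (pderiv q) x = poly (pderiv p) (1 - x)" for x
    by (auto simp: q_def poly_pcompose pderiv_diff pderiv_pcompose pderiv_pCons)
  have "contraction_poly \<eta> q"
    unfolding contraction_poly_def
  proof
    fix x :: real assume "x \<in> {0..1}"
    then have "1 - x \<in> {0..1}" by simp
    with p have "poly p (1 - x) \<in> {0..1} \<and> \<bar>poly (pderiv p) (1 - x)\<bar> \<le> 1 \<and> \<bar>poly p (1 - x) - (1 - x)\<bar> \<le> \<eta>"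
      unfolding contraction_poly_def by blast
    then show "poly q x \<in> {0..1} \<and> \<bar>poly (pderiv q) x\<bar> \<le> 1 \<and> \<bar>poly q x - x\<bar> \<le> \<eta>"
      unfolding q by (auto simp: abs_le_iff)
  qed
  moreover have "(LINT x|M. poly q (u x)) = (LINT x|M. u x)"
  proof -
    have "integrable M u"
      by (rule integrable_const_bound[of _ 1]) (use u01 in \<open>eventually_elim, auto\<close>)
    moreover have "integrable M (\<lambda>x. poly p (1 - u x))"
    proof (rule integrable_const_bound[of _ 1])
      show "AE x in M. norm (poly p (1 - u x)) \<le> 1"
        using u01
      proof eventually_elim
        case (elim x)
        then have "1 - u x \<in> {0..1}" by simp
        then have "poly p (1 - u x) \<in> {0..1}"
          using p unfolding contraction_poly_def by blast
        then show ?case by simp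
      qed
      show "(\<lambda>x. poly p (1 - u x)) \<in> borel_measurable M"
        by (rule measurable_compose[OF _ poly_measurable]) simp
    qed
    ultimately show ?thesis unfolding q using I by simp
  qed
  ultimately have "(LINT x|M. mixing_density \<beta> (u x)) \<le> (LINT x|M. mixing_density \<beta> (poly q (u x)))"
    using stable unfolding poly_stable_def by blast
  then show "(LINT x|M. mixing_density \<beta> (1 - u x)) \<le> (LINT x|M. mixing_density \<beta> (poly p (1 - u x)))"
    unfolding q mixing_density_reflect .
qed

section \<open>Dirichlet energy of polynomial competitors\<close>

text \<open>
  The chosen representative \<open>weak_gradient \<Omega> f\<close> is a priori only locally integrable.  By uniqueness it
  inherits square integrability, and the value of the Dirichlet energy, from any square integrable
  weak gradient.
\<close>

lemma weak_gradient_unique: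
  fixes \<Omega> :: "'a::euclidean_space set"
  assumes \<Omega>: "open \<Omega>" and g: "g \<in> L2 \<Omega>" and w: "has_weak_gradient \<Omega> f g"
  shows "AE x in lebesgue_on \<Omega>. g x = weak_gradient \<Omega> f x"
    and "has_weak_gradient \<Omega> f (weak_gradient \<Omega> f)"
    and "weak_gradient \<Omega> f \<in> L2 \<Omega>"
    and "(LINT x|lebesgue_on \<Omega>. (norm (weak_gradient \<Omega> f x))\<^sup>2) = (LINT x|lebesgue_on \<Omega>. (norm (g x))\<^sup>2)"
proof -
  let ?h = "weak_gradient \<Omega> f"
  show h: "has_weak_gradient \<Omega> f ?h"
    unfolding weak_gradient_def by (rule someI[where P = "has_weak_gradient \<Omega> f", OF w])
  show ae: "AE x in lebesgue_on \<Omega>. g x = ?h x"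
    by (rule has_weak_gradient_unique[OF \<Omega> w h])
  have \<Omega>l: "\<Omega> \<inter> space lebesgue \<in> sets lebesgue" using \<Omega> by simp
  have gm: "g \<in> borel_measurable (lebesgue_on \<Omega>)" using g by (simp add: L2_def)
  have hm: "?h \<in> borel_measurable (lebesgue_on \<Omega>)"
  proof -
    have "(\<lambda>x. indicator \<Omega> x *\<^sub>R g x) \<in> borel_measurable lebesgue"
      using gm borel_measurable_restrict_space_iff[OF \<Omega>l, of g] by simp
    moreover have "AE x in lebesgue. indicator \<Omega> x *\<^sub>R g x = indicator \<Omega> x *\<^sub>R ?h x"
    proof -
      have "AE x in lebesgue. x \<in> \<Omega> \<longrightarrow> g x = ?h x"
        using ae \<Omega> by (subst (asm) AE_restrict_space_iff) auto
      then show ?thesis by eventually_elim (auto simp: indicator_def)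
    qed
    ultimately have "(\<lambda>x. indicator \<Omega> x *\<^sub>R ?h x) \<in> borel_measurable lebesgue"
      by (rule borel_measurable_AE)
    then show ?thesis
      using borel_measurable_restrict_space_iff[OF \<Omega>l, of ?h] by simp
  qed
  have m2: "(\<lambda>x. (norm (k x))\<^sup>2) \<in> borel_measurable (lebesgue_on \<Omega>)" if "k \<in> borel_measurable (lebesgue_on \<Omega>)" for k :: "'a \<Rightarrow> 'a"
    by (rule borel_measurable_power[OF measurable_compose[OF that borel_measurable_norm]])
  have ae2: "AE x in lebesgue_on \<Omega>. (norm (g x))\<^sup>2 = (norm (?h x))\<^sup>2"
    using ae by eventually_elim simp
  show "(LINT x|lebesgue_on \<Omega>. (norm (?h x))\<^sup>2) = (LINT x|lebesgue_on \<Omega>. (norm (g x))\<^sup>2)"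
    using integral_cong_AE[OF m2[OF gm] m2[OF hm] ae2] by (rule sym)
  show "?h \<in> L2 \<Omega>"
    using g hm integrable_cong_AE[OF m2[OF gm] m2[OF hm] ae2] by (simp add: L2_def)
qed

lemma H1_weak_gradient:
  assumes "open \<Omega>" "f \<in> H1 \<Omega>"
  shows "has_weak_gradient \<Omega> f (weak_gradient \<Omega> f)" "weak_gradient \<Omega> f \<in> L2 \<Omega>"
  using assms weak_gradient_unique(2,3)[of \<Omega>] unfolding H1_def by blast+

lemma H1_contraction_poly:
  fixes \<Omega> :: "'a::euclidean_space set"
  assumes \<Omega>: "open \<Omega>" "bounded \<Omega>" and u: "u \<in> H1 \<Omega>"
    and u01: "AE x in lebesgue_on \<Omega>. 0 \<le> u x \<and> u x \<le> 1" and p: "contraction_poly \<eta> p"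
  shows "(\<lambda>x. poly p (u x)) \<in> H1 \<Omega>"
    and "(LINT x|lebesgue_on \<Omega>. (norm (weak_gradient \<Omega> (\<lambda>x. poly p (u x)) x))\<^sup>2)
       \<le> (LINT x|lebesgue_on \<Omega>. (norm (weak_gradient \<Omega> u x))\<^sup>2)"
proof -
  let ?M = "lebesgue_on \<Omega>"
  interpret M: finite_measure ?M
    using \<Omega> by (intro finite_measure_lebesgue_on lmeasurable_open)
  define g where "g = weak_gradient \<Omega> u"
  have g: "has_weak_gradient \<Omega> u g" "g \<in> L2 \<Omega>"
    using H1_weak_gradient[OF \<Omega>(1) u] by (auto simp: g_def)
  have um: "u \<in> borel_measurable ?M" using u by (simp add: H1_def L2_def)
  have gm: "g \<in> borel_measurable ?M" and gi: "integrable ?M (\<lambda>x. (norm (g x))\<^sup>2)"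
    using g by (auto simp: L2_def)
  let ?k = "\<lambda>x. poly (pderiv p) (u x) *\<^sub>R g x"
  have w: "has_weak_gradient \<Omega> (\<lambda>x. poly p (u x)) ?k"
    by (rule has_weak_gradient_poly[OF \<Omega> um _ _ g(2,1), of 1]) (use u01 in auto)
  have km: "?k \<in> borel_measurable ?M"
    by (rule borel_measurable_scaleR[OF measurable_compose[OF um poly_measurable] gm])
  have km2: "(\<lambda>x. (norm (?k x))\<^sup>2) \<in> borel_measurable ?M"
    by (rule borel_measurable_power[OF measurable_compose[OF km borel_measurable_norm]])
  have le: "AE x in ?M. (norm (?k x))\<^sup>2 \<le> (norm (g x))\<^sup>2"
    using u01
  proof eventually_elim
    case (elim x)
    then have "u x \<in> {0..1}" by simp
    then have "\<bar>poly (pderiv p) (u x)\<bar> \<le> 1" using p unfolding contraction_poly_def by blast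
    then have "norm (?k x) \<le> 1 * norm (g x)" unfolding norm_scaleR by (rule mult_right_mono) simp
    then show ?case by (intro power_mono) auto
  qed
  have ki: "integrable ?M (\<lambda>x. (norm (?k x))\<^sup>2)"
    by (rule Bochner_Integration.integrable_bound[OF gi km2]) (use le in auto)
  then have k: "?k \<in> L2 \<Omega>" using km by (simp add: L2_def)
  have pm: "(\<lambda>x. poly p (u x)) \<in> borel_measurable ?M" by (rule measurable_compose[OF um poly_measurable])
  have "integrable ?M (\<lambda>x. (norm (poly p (u x)))\<^sup>2)"
  proof (rule M.integrable_const_bound[of _ 1])
    show "AE x in ?M. norm ((norm (poly p (u x)))\<^sup>2) \<le> 1"
      using u01
    proof eventually_elim
      case (elim x)
      then have "u x \<in> {0..1}" by simp
      then have "poly p (u x) \<in> {0..1}" using p unfolding contraction_poly_def by blast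
      then show ?case by (simp add: power_le_one)
    qed
    show "(\<lambda>x. (norm (poly p (u x)))\<^sup>2) \<in> borel_measurable ?M"
      by (rule borel_measurable_power[OF measurable_compose[OF pm borel_measurable_norm]])
  qed
  then show "(\<lambda>x. poly p (u x)) \<in> H1 \<Omega>"
    unfolding H1_def L2_def using pm k w unfolding L2_def by blast
  have "(LINT x|?M. (norm (weak_gradient \<Omega> (\<lambda>x. poly p (u x)) x))\<^sup>2) = (LINT x|?M. (norm (?k x))\<^sup>2)"
    by (rule weak_gradient_unique(4)[OF \<Omega>(1) k w])
  also have "\<dots> \<le> (LINT x|?M. (norm (g x))\<^sup>2)"
    by (rule integral_mono_AE[OF ki gi le])
  finally show "(LINT x|?M. (norm (weak_gradient \<Omega> (\<lambda>x. poly p (u x)) x))\<^sup>2)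
       \<le> (LINT x|?M. (norm (weak_gradient \<Omega> u x))\<^sup>2)" by (simp add: g_def)
qed

lemma Linf_norm_le:
  assumes "f \<in> borel_measurable (lebesgue_on \<Omega>)" "AE x in lebesgue_on \<Omega>. \<bar>f x\<bar> \<le> c"
  shows "Linf_norm \<Omega> f \<le> ereal c"
  unfolding Linf_norm_def using assms by (intro esssup_I) auto

lemma LinfI:
  assumes "f \<in> borel_measurable (lebesgue_on \<Omega>)" "AE x in lebesgue_on \<Omega>. \<bar>f x\<bar> \<le> c"
  shows "f \<in> Linf \<Omega>"
  using assms Linf_norm_le[OF assms] by (auto simp: Linf_def intro: le_less_trans)

section \<open>Reduction of the mixture to one component\<close>

definition entropy_density :: "real \<Rightarrow> real" where
  "entropy_density x = x * ln x - x + 1"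

lemma entropy_density_measurable [measurable]: "entropy_density \<in> borel_measurable borel"
  unfolding entropy_density_def[abs_def] by measurable

lemma entropy_density_bounded:
  assumes "0 \<le> x" "x \<le> 1"
  shows "\<bar>entropy_density x\<bar> \<le> 2"
  using abs_mult_ln_le[OF assms] assms unfolding entropy_density_def by linarith

lemma entropy_density_convex:
  assumes "0 \<le> a" "0 \<le> b" "0 < t" "t < 1"
  shows "entropy_density ((1 - t) * a + t * b) \<le> (1 - t) * entropy_density a + t * entropy_density b"
proof (cases "a = 0 \<and> b = 0")
  case False
  define v where "v = (1 - t) * a + t * b"
  have v: "0 < v"
    using assms False unfolding v_def by (cases "a = 0") (auto intro: add_pos_nonneg)
  have "0 \<le> (1 - t) * (a * ln a - a * ln v - a + v) + t * (b * ln b - b * ln v - b + v)"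
    using assms
    by (intro add_nonneg_nonneg mult_nonneg_nonneg[OF _ relative_entropy_nonneg(1)[OF assms(1) v]]
        mult_nonneg_nonneg[OF _ relative_entropy_nonneg(1)[OF assms(2) v]]) auto
  also have "\<dots> = (1 - t) * (a * ln a) + t * (b * ln b) - ((1 - t) * a + t * b) * ln v - ((1 - t) * a + t * b) + v"
    by (simp add: algebra_simps)
  also have "\<dots> = (1 - t) * (a * ln a) + t * (b * ln b) - v * ln v"
    by (simp add: v_def[symmetric])
  finally show ?thesis
    unfolding v_def[symmetric] unfolding entropy_density_def by (simp add: v_def algebra_simps)
qed (simp add: entropy_density_def)

locale mixture =
  fixes n :: nat and \<Omega> :: "'a::euclidean_space set" and \<epsilon> \<beta> :: real and m :: "nat \<Rightarrow> real"
  assumes n: "1 \<le> n" and \<Omega>: "open \<Omega>" "bounded \<Omega>" and \<epsilon>: "0 < \<epsilon>" and \<beta>: "0 < \<beta>"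
    and m: "\<And>i. i \<le> n \<Longrightarrow> 0 < m i" and total: "(\<Sum>j\<le>n. m j) = measure lebesgue \<Omega>"
begin

abbreviation "M \<equiv> lebesgue_on \<Omega>"

definition "S = (\<Sum>j\<in>{1..n}. m j)"

definition "c i = m i / S"

text \<open>
  For a given first component \<open>v\<close>, these components minimize the entropy under the mass constraints.
\<close>

definition split_profile :: "('a \<Rightarrow> real) \<Rightarrow> nat \<Rightarrow> 'a \<Rightarrow> real" where
  "split_profile v i x = (if i = 0 then v x else c i * (1 - v x))"

definition "mixture_entropy = (\<Sum>i\<in>{1..n}. c i * ln (c i))"

sublocale finite_measure M
  using \<Omega> by (intro finite_measure_lebesgue_on lmeasurable_open)

lemma sum_atMost: "(\<Sum>i\<le>n. f i) = f 0 + (\<Sum>i\<in>{1..n}. f i :: real)"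
proof -
  have "{..n} = insert 0 {1..n}" by auto
  then show ?thesis by simp
qed

lemma measure_M: "measure M \<Omega> = m 0 + S" "measure M (space M) = m 0 + S"
  using \<Omega> total by (auto simp: S_def sum_atMost measure_restrict_space)

lemma S_pos: "0 < S"
  unfolding S_def using n m by (intro sum_pos) auto

lemma c_pos: "i \<in> {1..n} \<Longrightarrow> 0 < c i"
  using m S_pos by (simp add: c_def)

lemma c_sum: "(\<Sum>i\<in>{1..n}. c i) = 1" "sum c {Suc 0..n} = 1"
  using S_pos by (simp_all add: c_def S_def flip: sum_divide_distrib)

lemma c_le_1: "i \<in> {1..n} \<Longrightarrow> c i \<le> 1"
  using member_le_sum[of i "{1..n}" c] c_pos c_sum(1) by (simp add: less_imp_le)

lemma bounded_integrable:
  "f \<in> borel_measurable M \<Longrightarrow> AE x in M. \<bar>f x\<bar> \<le> B \<Longrightarrow> integrable M (f :: 'a \<Rightarrow> real)"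
  by (rule integrable_const_bound[of _ B]) auto

lemma admissible_measurable: "u \<in> admissible n \<Omega> m \<Longrightarrow> i \<le> n \<Longrightarrow> u i \<in> borel_measurable M"
  by (auto simp: admissible_def Linf_def)

lemma admissible_bounds:
  assumes "u \<in> admissible n \<Omega> m"
  shows "AE x in M. (\<forall>i\<le>n. 0 \<le> u i x \<and> u i x \<le> 1) \<and> (\<Sum>j\<le>n. u j x) = 1"
proof -
  have "AE x in M. \<forall>i\<in>{..n}. 0 \<le> u i x"
    using assms by (intro AE_finite_allI) (auto simp: admissible_def)
  moreover have "AE x in M. (\<Sum>j\<le>n. u j x) = 1"
    using assms by (auto simp: admissible_def)
  ultimately show ?thesis
  proof eventually_elim
    case (elim x)
    have "u i x \<le> 1" if "i \<le> n" for i
      using member_le_sum[of i "{..n}" "\<lambda>j. u j x"] elim that by auto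
    then show ?case using elim by auto
  qed
qed

lemma admissible_integral: "u \<in> admissible n \<Omega> m \<Longrightarrow> i \<le> n \<Longrightarrow> (LINT x|M. u i x) = m i"
  by (auto simp: admissible_def)

lemma admissible_H1: "u \<in> admissible n \<Omega> m \<Longrightarrow> u 0 \<in> H1 \<Omega>"
  by (auto simp: admissible_def)

text \<open>
  The factors \<open>c i\<close> are such that the masses of all components come out right as soon as that of \<open>v\<close> does.
\<close>

lemma split_profile_admissible:
  assumes v: "v \<in> borel_measurable M" "AE x in M. 0 \<le> v x \<and> v x \<le> 1" "(LINT x|M. v x) = m 0" "v \<in> H1 \<Omega>"
  shows "split_profile v \<in> admissible n \<Omega> m"
proof -
  have iv: "integrable M v" by (rule bounded_integrable[OF v(1), of 1]) (use v(2) in auto)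
  have "split_profile v i \<in> Linf \<Omega>" "AE x in M. 0 \<le> split_profile v i x" "(LINT x|M. split_profile v i x) = m i"
    if i: "i \<le> n" for i
  proof -
    have c: "i = 0 \<or> (0 < c i \<and> c i \<le> 1)" using i c_pos c_le_1 by (cases "i = 0") auto
    have b: "AE x in M. 0 \<le> split_profile v i x \<and> split_profile v i x \<le> 1"
      using v(2)
    proof eventually_elim
      case (elim x)
      then show ?case using c mult_le_one[of "c i" "1 - v x"] by (auto simp: split_profile_def)
    qed
    then show "AE x in M. 0 \<le> split_profile v i x" by auto
    show "split_profile v i \<in> Linf \<Omega>"
      by (rule LinfI[of _ _ 1]) (use b v(1) in \<open>auto simp: split_profile_def[abs_def]\<close>)
    show "(LINT x|M. split_profile v i x) = m i"
    proof (cases "i = 0")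
      case False
      then have "(LINT x|M. split_profile v i x) = c i * ((m 0 + S) - m 0)"
        using iv v(3) by (simp add: split_profile_def measure_M)
      then show ?thesis using S_pos by (simp add: c_def)
    qed (simp add: split_profile_def v(3))
  qed
  moreover have "(\<Sum>j\<le>n. split_profile v j x) = 1" for x
    by (simp add: sum_atMost split_profile_def c_sum flip: sum_distrib_right)
  moreover have "split_profile v 0 \<in> H1 \<Omega>"
    using v(4) by (simp add: split_profile_def[abs_def])
  ultimately show ?thesis unfolding admissible_def by auto
qed

text \<open>
  Splitting the energy into integrals needs integrability of every summand, as otherwise the integral
  takes the default value \<open>0\<close>.
\<close>

lemma energy_decompose:
  assumes w: "\<And>i. i \<le> n \<Longrightarrow> w i \<in> borel_measurable M" "AE x in M. \<forall>i\<le>n. 0 \<le> w i x \<and> w i x \<le> 1" "w 0 \<in> H1 \<Omega>"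
  shows "energy n \<Omega> \<epsilon> \<beta> w = (LINT x|M. (\<Sum>i\<le>n. entropy_density (w i x)) + \<beta> * w 0 x * (1 - w 0 x))
      + \<epsilon> / 2 * (LINT x|M. (norm (weak_gradient \<Omega> (w 0) x))\<^sup>2)"
    and "integrable M (\<lambda>x. \<Sum>i\<le>n. entropy_density (w i x))"
    and "integrable M (\<lambda>x. \<beta> * w 0 x * (1 - w 0 x))"
proof -
  have "integrable M (\<lambda>x. entropy_density (w i x))" if "i \<le> n" for i
  proof (rule bounded_integrable)
    show "AE x in M. \<bar>entropy_density (w i x)\<bar> \<le> 2"
      using w(2) by eventually_elim (use that entropy_density_bounded in auto)
  qed (rule measurable_compose[OF w(1)[OF that] entropy_density_measurable])
  then show e: "integrable M (\<lambda>x. \<Sum>i\<le>n. entropy_density (w i x))" by auto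
  have w0: "w 0 \<in> borel_measurable M" using w(1) by simp
  show b: "integrable M (\<lambda>x. \<beta> * w 0 x * (1 - w 0 x))"
  proof (rule bounded_integrable)
    show "AE x in M. \<bar>\<beta> * w 0 x * (1 - w 0 x)\<bar> \<le> \<beta> * 1 * 1"
      using w(2)
    proof eventually_elim
      case (elim x)
      then have "0 \<le> w 0 x" "w 0 x \<le> 1" by auto
      then show ?case using \<beta> unfolding abs_mult by (intro mult_mono) auto
    qed
  qed (use w0 in measurable)
  have g: "integrable M (\<lambda>x. (norm (weak_gradient \<Omega> (w 0) x))\<^sup>2)"
    using H1_weak_gradient(2)[OF \<Omega>(1) w(3)] by (simp add: L2_def)
  have "energy n \<Omega> \<epsilon> \<beta> w = (LINT x|M. ((\<Sum>i\<le>n. entropy_density (w i x)) + \<beta> * w 0 x * (1 - w 0 x))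
       + \<epsilon> / 2 * (norm (weak_gradient \<Omega> (w 0) x))\<^sup>2)"
    unfolding energy_def entropy_density_def by (rule Bochner_Integration.integral_cong) (auto simp: algebra_simps)
  also have "\<dots> = (LINT x|M. (\<Sum>i\<le>n. entropy_density (w i x)) + \<beta> * w 0 x * (1 - w 0 x))
       + (LINT x|M. \<epsilon> / 2 * (norm (weak_gradient \<Omega> (w 0) x))\<^sup>2)"
    using e b g by (intro Bochner_Integration.integral_add Bochner_Integration.integrable_add integrable_mult_right) auto
  finally show "energy n \<Omega> \<epsilon> \<beta> w = (LINT x|M. (\<Sum>i\<le>n. entropy_density (w i x)) + \<beta> * w 0 x * (1 - w 0 x))
      + \<epsilon> / 2 * (LINT x|M. (norm (weak_gradient \<Omega> (w 0) x))\<^sup>2)" by simp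
qed

text \<open>
  For proportional components the logarithms \<open>ln (c i * (1 - v))\<close> split, and the terms \<open>ln (c i)\<close> only
  contribute a constant because the mass of \<open>1 - v\<close> is fixed.
\<close>

lemma energy_split_profile:
  assumes w: "w \<in> admissible n \<Omega> m" and eq: "AE x in M. \<forall>i\<le>n. w i x = split_profile (w 0) i x"
  shows "energy n \<Omega> \<epsilon> \<beta> w = (LINT x|M. mixing_density \<beta> (w 0 x)) + (S * mixture_entropy + real n * (m 0 + S))
      + \<epsilon> / 2 * (LINT x|M. (norm (weak_gradient \<Omega> (w 0) x))\<^sup>2)"
proof -
  have w0[measurable]: "w 0 \<in> borel_measurable M" using admissible_measurable[OF w] by simp
  have b: "AE x in M. \<forall>i\<le>n. 0 \<le> w i x \<and> w i x \<le> 1" using admissible_bounds[OF w] by auto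
  note dec = energy_decompose[OF admissible_measurable[OF w] b admissible_H1[OF w]]
  have iw: "integrable M (w 0)"
    by (rule bounded_integrable[of _ 1]) (use b in auto)
  have iF: "integrable M (\<lambda>x. mixing_density \<beta> (w 0 x))"
  proof (rule bounded_integrable)
    show "AE x in M. \<bar>mixing_density \<beta> (w 0 x)\<bar> \<le> 2 + \<beta>"
      using b by eventually_elim (use \<beta> mixing_density_bounded in auto)
  qed simp
  have "(LINT x|M. (\<Sum>i\<le>n. entropy_density (w i x)) + \<beta> * w 0 x * (1 - w 0 x))
      = (LINT x|M. mixing_density \<beta> (w 0 x) + ((1 - w 0 x) * mixture_entropy + real n))"
  proof (rule integral_cong_AE)
    show "AE x in M. (\<Sum>i\<le>n. entropy_density (w i x)) + \<beta> * w 0 x * (1 - w 0 x)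
        = mixing_density \<beta> (w 0 x) + ((1 - w 0 x) * mixture_entropy + real n)"
      using eq b
    proof eventually_elim
      case (elim x)
      define y where "y = 1 - w 0 x"
      have y: "0 \<le> y" using elim(2)[rule_format, of 0] by (simp add: y_def)
      have "entropy_density (w i x) = c i * (y * ln y) + y * (c i * ln (c i)) - c i * y + 1" if "i \<in> {1..n}" for i
      proof -
        have "w i x = c i * y"
          using elim(1)[rule_format, of i] that by (simp add: split_profile_def y_def)
        then show ?thesis
          using c_pos[OF that] y by (cases "y = 0") (auto simp: entropy_density_def ln_mult algebra_simps)
      qed
      then have "(\<Sum>i\<in>{1..n}. entropy_density (w i x))
          = (\<Sum>i\<in>{1..n}. c i * (y * ln y) + y * (c i * ln (c i)) - c i * y + 1)"
        by (intro sum.cong) auto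
      also have "\<dots> = y * ln y + y * mixture_entropy - y + real n"
        by (simp add: sum.distrib sum_subtractf mixture_entropy_def c_sum flip: sum_distrib_left sum_distrib_right)
      finally show ?case
        unfolding sum_atMost mixing_density_def by (simp add: y_def entropy_density_def algebra_simps)
    qed
    show "(\<lambda>x. (\<Sum>i\<le>n. entropy_density (w i x)) + \<beta> * w 0 x * (1 - w 0 x)) \<in> borel_measurable M"
      using dec(2,3) by (intro borel_measurable_add borel_measurable_integrable)
  qed simp
  also have "\<dots> = (LINT x|M. mixing_density \<beta> (w 0 x)) + (S * mixture_entropy + real n * (m 0 + S))"
    using iF iw admissible_integral[OF w, of 0] measure_M by (simp add: mult_ac)
  finally show ?thesis using dec(1) by simp
qed

lemma minimizer_le:
  assumes min: "\<forall>v\<in>admissible n \<Omega> m. (MAX i\<in>{..n}. Linf_norm \<Omega> (\<lambda>x. v i x - u i x)) \<le> ereal \<eta>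
          \<longrightarrow> energy n \<Omega> \<epsilon> \<beta> v \<ge> energy n \<Omega> \<epsilon> \<beta> u"
    and u: "u \<in> admissible n \<Omega> m" and v: "v \<in> admissible n \<Omega> m"
    and close: "AE x in M. \<forall>i\<le>n. \<bar>v i x - u i x\<bar> \<le> \<eta>"
  shows "energy n \<Omega> \<epsilon> \<beta> u \<le> energy n \<Omega> \<epsilon> \<beta> v"
proof -
  have "Linf_norm \<Omega> (\<lambda>x. v i x - u i x) \<le> ereal \<eta>" if "i \<le> n" for i
    by (rule Linf_norm_le[OF borel_measurable_diff[OF admissible_measurable[OF v that] admissible_measurable[OF u that]]])
       (use close that in auto)
  then have "(MAX i\<in>{..n}. Linf_norm \<Omega> (\<lambda>x. v i x - u i x)) \<le> ereal \<eta>"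
    by (subst Max_le_iff) auto
  then show ?thesis using min v by blast
qed

text \<open>
  Moving a fraction \<open>t\<close> of the way towards \<open>split_profile (u 0)\<close> leaves the first component alone and stays
  within the prescribed distance.  By convexity the entropy of \<open>u\<close> is therefore at most that of
  \<open>split_profile (u 0)\<close>.  As the masses agree, the difference of the two is the integral of a relative
  entropy, which is nonnegative and vanishes only if both agree.
\<close>

lemma minimizer_split_profile:
  assumes \<eta>: "0 < \<eta>" and u: "u \<in> admissible n \<Omega> m"
    and min: "\<forall>v\<in>admissible n \<Omega> m. (MAX i\<in>{..n}. Linf_norm \<Omega> (\<lambda>x. v i x - u i x)) \<le> ereal \<eta>
          \<longrightarrow> energy n \<Omega> \<epsilon> \<beta> v \<ge> energy n \<Omega> \<epsilon> \<beta> u"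
  shows "AE x in M. \<forall>i\<le>n. u i x = split_profile (u 0) i x"
proof -
  define w where "w = split_profile (u 0)"
  have w0: "w 0 = u 0" by (simp add: w_def split_profile_def[abs_def])
  have ub: "AE x in M. (\<forall>i\<le>n. 0 \<le> u i x \<and> u i x \<le> 1) \<and> (\<Sum>j\<le>n. u j x) = 1"
    by (rule admissible_bounds[OF u])
  have um: "u i \<in> borel_measurable M" if "i \<le> n" for i using admissible_measurable[OF u that] .
  have w: "w \<in> admissible n \<Omega> m"
    unfolding w_def
    by (rule split_profile_admissible) (use ub um admissible_integral[OF u] admissible_H1[OF u] in auto)
  have wb: "AE x in M. (\<forall>i\<le>n. 0 \<le> w i x \<and> w i x \<le> 1) \<and> (\<Sum>j\<le>n. w j x) = 1"
    by (rule admissible_bounds[OF w])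
  have wm: "w i \<in> borel_measurable M" if "i \<le> n" for i using admissible_measurable[OF w that] .
  define t where "t = min \<eta> (1 / 2)"
  have t: "0 < t" "t < 1" "t \<le> \<eta>" using \<eta> by (auto simp: t_def)
  define v where "v i x = (1 - t) * u i x + t * w i x" for i x
  have v0: "v 0 = u 0" by (simp add: v_def[abs_def] w0 algebra_simps)
  have vm: "v i \<in> borel_measurable M" if "i \<le> n" for i
    using um[OF that] wm[OF that] unfolding v_def[abs_def] by measurable
  have vb: "AE x in M. (\<forall>i\<le>n. 0 \<le> v i x \<and> v i x \<le> 1) \<and> (\<Sum>j\<le>n. v j x) = 1"
    using ub wb
  proof eventually_elim
    case (elim x)
    have "0 \<le> v i x \<and> v i x \<le> 1" if "i \<le> n" for i
    proof -
      have "(1 - t) * u i x + t * w i x \<le> (1 - t) * 1 + t * 1"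
        using elim that t by (intro add_mono mult_left_mono) auto
      then show ?thesis using elim that t by (simp add: v_def)
    qed
    moreover have "(\<Sum>j\<le>n. v j x) = 1"
      using elim by (simp add: v_def sum.distrib flip: sum_distrib_left)
    ultimately show ?case by blast
  qed
  have int: "integrable M (u i)" "integrable M (w i)" if "i \<le> n" for i
    by (rule bounded_integrable[OF um[OF that], of 1], use ub that in auto)
       (rule bounded_integrable[OF wm[OF that], of 1], use wb that in auto)
  have v: "v \<in> admissible n \<Omega> m"
  proof -
    have "v i \<in> Linf \<Omega>" if "i \<le> n" for i
      by (rule LinfI[OF vm[OF that], of 1]) (use vb that in auto)
    moreover have "(LINT x|M. v i x) = m i" if "i \<le> n" for i
      using int[OF that] admissible_integral[OF u that] admissible_integral[OF w that]
      by (simp add: v_def algebra_simps)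
    ultimately show ?thesis
      using vb admissible_H1[OF u] v0 by (auto simp: admissible_def)
  qed
  have energy_le: "energy n \<Omega> \<epsilon> \<beta> u \<le> energy n \<Omega> \<epsilon> \<beta> v"
  proof (rule minimizer_le[OF min u v])
    show "AE x in M. \<forall>i\<le>n. \<bar>v i x - u i x\<bar> \<le> \<eta>"
      using ub wb
    proof eventually_elim
      case (elim x)
      show ?case
      proof (intro allI impI)
        fix i assume i: "i \<le> n"
        have "v i x - u i x = t * (w i x - u i x)" by (simp add: v_def algebra_simps)
        moreover have "\<bar>w i x - u i x\<bar> \<le> 1"
        proof -
          have "0 \<le> u i x" "u i x \<le> 1" "0 \<le> w i x" "w i x \<le> 1" using elim i by auto
          then show ?thesis by linarith
        qed
        ultimately have "\<bar>v i x - u i x\<bar> \<le> t * 1" using t by (simp add: abs_mult mult_left_le)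
        then show "\<bar>v i x - u i x\<bar> \<le> \<eta>" using t by simp
      qed
    qed
  qed
  have b: "AE x in M. \<forall>i\<le>n. 0 \<le> z i x \<and> z i x \<le> 1" if "z \<in> {u, v, w}" for z
    using that ub vb wb by auto
  have decu: "energy n \<Omega> \<epsilon> \<beta> u = (LINT x|M. (\<Sum>i\<le>n. entropy_density (u i x))) + (LINT x|M. \<beta> * u 0 x * (1 - u 0 x))
      + \<epsilon> / 2 * (LINT x|M. (norm (weak_gradient \<Omega> (u 0) x))\<^sup>2)" "integrable M (\<lambda>x. \<Sum>i\<le>n. entropy_density (u i x))"
    using energy_decompose[OF um b[of u] admissible_H1[OF u]] by simp_all
  have decv: "energy n \<Omega> \<epsilon> \<beta> v = (LINT x|M. (\<Sum>i\<le>n. entropy_density (v i x))) + (LINT x|M. \<beta> * u 0 x * (1 - u 0 x))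
      + \<epsilon> / 2 * (LINT x|M. (norm (weak_gradient \<Omega> (u 0) x))\<^sup>2)" "integrable M (\<lambda>x. \<Sum>i\<le>n. entropy_density (v i x))"
    using energy_decompose[OF vm b[of v] admissible_H1[OF v]] by (simp_all add: v0)
  have decw: "integrable M (\<lambda>x. \<Sum>i\<le>n. entropy_density (w i x))"
    using energy_decompose(2)[OF wm b[of w] admissible_H1[OF w]] by simp
  have "(LINT x|M. (\<Sum>i\<le>n. entropy_density (u i x))) \<le> (LINT x|M. (\<Sum>i\<le>n. entropy_density (v i x)))"
    using energy_le unfolding decu(1) decv(1) by simp
  also have "\<dots> \<le> (LINT x|M. (1 - t) * (\<Sum>i\<le>n. entropy_density (u i x)) + t * (\<Sum>i\<le>n. entropy_density (w i x)))"
  proof (rule integral_mono_AE[OF decv(2)])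
    show "AE x in M. (\<Sum>i\<le>n. entropy_density (v i x)) \<le> (1 - t) * (\<Sum>i\<le>n. entropy_density (u i x)) + t * (\<Sum>i\<le>n. entropy_density (w i x))"
      using ub wb
    proof eventually_elim
      case (elim x)
      have "(\<Sum>i\<le>n. entropy_density (v i x)) \<le> (\<Sum>i\<le>n. (1 - t) * entropy_density (u i x) + t * entropy_density (w i x))"
        unfolding v_def by (intro sum_mono entropy_density_convex) (use elim t in auto)
      then show ?case by (simp add: sum.distrib sum_distrib_left)
    qed
  qed (use decu decw in auto)
  also have "\<dots> = (1 - t) * (LINT x|M. (\<Sum>i\<le>n. entropy_density (u i x))) + t * (LINT x|M. (\<Sum>i\<le>n. entropy_density (w i x)))"
    using decu decw by simp
  finally have "t * (LINT x|M. (\<Sum>i\<le>n. entropy_density (u i x))) \<le> t * (LINT x|M. (\<Sum>i\<le>n. entropy_density (w i x)))"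
    by (simp add: algebra_simps)
  then have le: "(LINT x|M. (\<Sum>i\<le>n. entropy_density (u i x))) \<le> (LINT x|M. (\<Sum>i\<le>n. entropy_density (w i x)))"
    using t by simp
  \<comment> \<open>Subtracting the terms with \<open>ln (c i)\<close>, which integrate to \<open>0\<close> by the mass constraints, turns the entropy difference into a relative entropy.\<close>
  define D where "D x = (\<Sum>i\<le>n. entropy_density (u i x)) - (\<Sum>i\<le>n. entropy_density (w i x))
      - (\<Sum>i\<in>{1..n}. (u i x - w i x) * ln (c i))" for x
  have iL: "integrable M (\<lambda>x. \<Sum>i\<in>{1..n}. (u i x - w i x) * ln (c i))"
    using int by (intro Bochner_Integration.integrable_sum integrable_mult_left Bochner_Integration.integrable_diff) auto
  note iuw = Bochner_Integration.integrable_diff[OF decu(2) decw]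
  have iD: "integrable M D"
    unfolding D_def by (rule Bochner_Integration.integrable_diff[OF iuw iL])
  have "(LINT x|M. (\<Sum>i\<in>{1..n}. (u i x - w i x) * ln (c i))) = (\<Sum>i\<in>{1..n}. (LINT x|M. (u i x - w i x) * ln (c i)))"
    using int by (intro Bochner_Integration.integral_sum) auto
  also have "\<dots> = 0"
    using int admissible_integral[OF u] admissible_integral[OF w] by (intro sum.neutral) auto
  finally have "(LINT x|M. D x) \<le> 0"
    unfolding D_def Bochner_Integration.integral_diff[OF iuw iL] Bochner_Integration.integral_diff[OF decu(2) decw]
    using le by simp
  have D: "AE x in M. 0 \<le> D x \<and> (D x = 0 \<longrightarrow> (\<forall>i\<le>n. u i x = w i x))"
    using ub wb
  proof eventually_elim
    case (elim x)
    define y where "y = 1 - u 0 x"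
    have wi: "w i x = c i * y" if "i \<in> {1..n}" for i
      using that by (auto simp: w_def split_profile_def y_def)
    have sums: "(\<Sum>i\<in>{1..n}. u i x) = y" "(\<Sum>i\<in>{1..n}. w i x) = y"
      using elim by (auto simp: sum_atMost y_def w0)
    define r where "r i = u i x * ln (u i x) - u i x * ln (w i x) - u i x + w i x" for i
    have u0: "0 \<le> u i x" if "i \<in> {1..n}" for i using elim that by auto
    show ?case
    proof (cases "y = 0")
      case True
      have "u i x = w i x" if "i \<in> {1..n}" for i
      proof -
        have "u i x \<le> (\<Sum>i\<in>{1..n}. u i x)" using u0 that by (intro member_le_sum) auto
        then show ?thesis using True sums u0[OF that] wi[OF that] by simp
      qed
      then have all: "u i x = w i x" if "i \<le> n" for i using w0 that by (cases "i = 0") auto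
      then have "D x = 0" by (simp add: D_def)
      then show ?thesis using all by simp
    next
      case False
      moreover have "0 \<le> y" using elim by (simp add: y_def)
      ultimately have y: "0 < y" by simp
      have w_pos: "0 < w i x" if "i \<in> {1..n}" for i using wi[OF that] c_pos[OF that] y by simp
      have r0: "0 \<le> r i" if "i \<in> {1..n}" for i
        unfolding r_def by (rule relative_entropy_nonneg(1)[OF u0[OF that] w_pos[OF that]])
      have "D x = (\<Sum>i\<in>{1..n}. entropy_density (u i x) - entropy_density (w i x) - (u i x - w i x) * ln (c i))"
        by (simp add: D_def sum_atMost w0 sum_subtractf)
      also have "\<dots> = (\<Sum>i\<in>{1..n}. r i + (u i x - w i x) * ln y)"
      proof (rule sum.cong)
        fix i assume i: "i \<in> {1..n}"
        have "ln (w i x) = ln (c i) + ln y" using wi[OF i] c_pos[OF i] y by (simp add: ln_mult)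
        then show "entropy_density (u i x) - entropy_density (w i x) - (u i x - w i x) * ln (c i) = r i + (u i x - w i x) * ln y"
          by (simp add: entropy_density_def r_def algebra_simps)
      qed simp
      also have "\<dots> = (\<Sum>i\<in>{1..n}. r i)"
        using sums by (simp add: sum.distrib sum_subtractf flip: sum_distrib_right)
      finally have Dr: "D x = (\<Sum>i\<in>{1..n}. r i)" .
      have "u i x = w i x" if "D x = 0" "i \<in> {1..n}" for i
      proof -
        have "r i = 0" using that r0 unfolding Dr by (subst (asm) sum_nonneg_eq_0_iff) auto
        then show ?thesis
          unfolding r_def using relative_entropy_nonneg(2)[OF u0[OF that(2)] w_pos[OF that(2)]] by simp
      qed
      then have "u i x = w i x" if "D x = 0" "i \<le> n" for i
        using that w0 by (cases "i = 0") auto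
      moreover have "0 \<le> D x" unfolding Dr using r0 by (intro sum_nonneg) auto
      ultimately show ?thesis by blast
    qed
  qed
  have D0: "AE x in M. 0 \<le> D x" using D by auto
  have "(LINT x|M. D x) = 0"
    using \<open>(LINT x|M. D x) \<le> 0\<close> integral_nonneg_AE[OF D0] by simp
  then have "AE x in M. D x = 0"
    using integral_nonneg_eq_0_iff_AE[OF iD D0] by simp
  then show ?thesis using D by eventually_elim (auto simp: w_def)
qed

text \<open>
  Replace \<open>u 0\<close> by \<open>p (u 0)\<close> and let the other components follow proportionally; as \<open>c i \<le> 1\<close>, they move no
  further than the first one.
\<close>

lemma minimizer_poly_stable:
  assumes \<eta>: "0 < \<eta>" and u: "u \<in> admissible n \<Omega> m"
    and min: "\<forall>v\<in>admissible n \<Omega> m. (MAX i\<in>{..n}. Linf_norm \<Omega> (\<lambda>x. v i x - u i x)) \<le> ereal \<eta>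
          \<longrightarrow> energy n \<Omega> \<epsilon> \<beta> v \<ge> energy n \<Omega> \<epsilon> \<beta> u"
  shows "poly_stable M \<beta> \<eta> (u 0)"
  unfolding poly_stable_def
proof (intro allI impI)
  fix p assume p: "contraction_poly \<eta> p" and I: "(LINT x|M. poly p (u 0 x)) = (LINT x|M. u 0 x)"
  let ?q = "\<lambda>x. poly p (u 0 x)"
  have split: "AE x in M. \<forall>i\<le>n. u i x = split_profile (u 0) i x"
    by (rule minimizer_split_profile[OF \<eta> u min])
  have u01: "AE x in M. 0 \<le> u 0 x \<and> u 0 x \<le> 1" using admissible_bounds[OF u] by auto
  have pu: "AE x in M. poly p (u 0 x) \<in> {0..1} \<and> \<bar>poly p (u 0 x) - u 0 x\<bar> \<le> \<eta>"
    using u01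
  proof eventually_elim
    case (elim x)
    then have "u 0 x \<in> {0..1}" by simp
    then show ?case using p unfolding contraction_poly_def by blast
  qed
  have um: "u 0 \<in> borel_measurable M" using admissible_measurable[OF u] by simp
  note H = H1_contraction_poly[OF \<Omega> admissible_H1[OF u] u01 p]
  define v where "v = split_profile ?q"
  have v0: "v 0 = ?q" by (simp add: v_def split_profile_def[abs_def])
  have v: "v \<in> admissible n \<Omega> m"
    unfolding v_def
  proof (rule split_profile_admissible)
    show "?q \<in> borel_measurable M" by (rule measurable_compose[OF um poly_measurable])
    show "AE x in M. 0 \<le> ?q x \<and> ?q x \<le> 1" using pu by auto
    show "(LINT x|M. ?q x) = m 0" using I admissible_integral[OF u] by simp
  qed (rule H(1))
  have "energy n \<Omega> \<epsilon> \<beta> u \<le> energy n \<Omega> \<epsilon> \<beta> v"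
  proof (rule minimizer_le[OF min u v])
    show "AE x in M. \<forall>i\<le>n. \<bar>v i x - u i x\<bar> \<le> \<eta>"
      using split pu
    proof eventually_elim
      case (elim x)
      show ?case
      proof (intro allI impI)
        fix i assume i: "i \<le> n"
        show "\<bar>v i x - u i x\<bar> \<le> \<eta>"
        proof (cases "i = 0")
          case True
          then show ?thesis using elim(2) v0 by simp
        next
          case False
          then have ci: "0 < c i" "c i \<le> 1" using i c_pos c_le_1 by auto
          have "u i x = c i * (1 - u 0 x)" using elim(1)[rule_format, OF i] False by (simp add: split_profile_def)
          then have "v i x - u i x = c i * (u 0 x - ?q x)"
            using False by (simp add: v_def split_profile_def algebra_simps)
          then have "\<bar>v i x - u i x\<bar> = c i * \<bar>?q x - u 0 x\<bar>"
            using ci by (simp add: abs_mult abs_minus_commute)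
          also have "\<dots> \<le> 1 * \<eta>" using ci elim(2) by (intro mult_mono) auto
          finally show ?thesis by simp
        qed
      qed
    qed
  qed
  also have "energy n \<Omega> \<epsilon> \<beta> v = (LINT x|M. mixing_density \<beta> (?q x)) + (S * mixture_entropy + real n * (m 0 + S))
      + \<epsilon> / 2 * (LINT x|M. (norm (weak_gradient \<Omega> ?q x))\<^sup>2)"
    using energy_split_profile[OF v] v0 by (simp add: v_def)
  also have "energy n \<Omega> \<epsilon> \<beta> u = (LINT x|M. mixing_density \<beta> (u 0 x)) + (S * mixture_entropy + real n * (m 0 + S))
      + \<epsilon> / 2 * (LINT x|M. (norm (weak_gradient \<Omega> (u 0) x))\<^sup>2)"
    by (rule energy_split_profile[OF u split])
  also have "\<epsilon> / 2 * (LINT x|M. (norm (weak_gradient \<Omega> ?q x))\<^sup>2) \<le> \<epsilon> / 2 * (LINT x|M. (norm (weak_gradient \<Omega> (u 0) x))\<^sup>2)"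
    by (rule mult_left_mono[OF H(2)]) (use \<epsilon> in simp)
  finally show "(LINT x|M. mixing_density \<beta> (u 0 x)) \<le> (LINT x|M. mixing_density \<beta> (?q x))"
    by simp
qed

definition "uniform_floor = min (lower_threshold \<beta> (m 0 + S) (m 0)) (Min (c ` {1..n}) * lower_threshold \<beta> (m 0 + S) S)"

lemma uniform_floor_pos: "0 < uniform_floor"
proof -
  have "0 < Min (c ` {1..n})" using n c_pos by (subst Min_gr_iff) auto
  then show ?thesis by (simp add: uniform_floor_def lower_threshold_def)
qed

text \<open>
  The first component is bounded below directly, the others through the lower bound for \<open>1 - u 0\<close>.
\<close>

lemma minimizer_lower_bound:
  assumes "Linf_local_minimizer n \<Omega> m \<epsilon> \<beta> u"
  shows "AE x in M. \<forall>i\<le>n. uniform_floor \<le> u i x"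
proof -
  obtain \<eta> where \<eta>: "0 < \<eta>" and u: "u \<in> admissible n \<Omega> m"
    and min: "\<forall>v\<in>admissible n \<Omega> m. (MAX i\<in>{..n}. Linf_norm \<Omega> (\<lambda>x. v i x - u i x)) \<le> ereal \<eta>
          \<longrightarrow> energy n \<Omega> \<epsilon> \<beta> v \<ge> energy n \<Omega> \<epsilon> \<beta> u"
    using assms unfolding Linf_local_minimizer_def by blast
  note stable = minimizer_poly_stable[OF \<eta> u min]
  have um: "u 0 \<in> borel_measurable M" using admissible_measurable[OF u] by simp
  have u01: "AE x in M. 0 \<le> u 0 x \<and> u 0 x \<le> 1" using admissible_bounds[OF u] by auto
  have iu: "integrable M (u 0)" by (rule bounded_integrable[OF um, of 1]) (use u01 in auto)
  have mass: "(LINT x|M. u 0 x) = m 0" using admissible_integral[OF u] by simp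
  have mass': "(LINT x|M. 1 - u 0 x) = S" using iu mass measure_M by simp
  have m0: "0 < m 0" using m by simp
  have "AE x in M. lower_threshold \<beta> (m 0 + S) (m 0) \<le> u 0 x"
    using poly_stable_lower_bound[OF finite_measure_axioms um u01 _ _ _ \<eta> stable, unfolded mass measure_M] S_pos m0 \<beta>
    by simp
  moreover have "AE x in M. lower_threshold \<beta> (m 0 + S) S \<le> 1 - u 0 x"
    using poly_stable_lower_bound[OF finite_measure_axioms _ _ _ _ _ \<eta> poly_stable_reflect[OF finite_measure_axioms um u01 stable],
        unfolded mass' measure_M] um u01 S_pos m0 \<beta>
    by (simp add: conj_commute)
  moreover note minimizer_split_profile[OF \<eta> u min]
  ultimately show ?thesis
  proof eventually_elim
    case (elim x)
    show ?case
    proof (intro allI impI)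
      fix i assume i: "i \<le> n"
      show "uniform_floor \<le> u i x"
      proof (cases "i = 0")
        case True
        then show ?thesis using elim(1) by (simp add: uniform_floor_def)
      next
        case False
        then have i1: "i \<in> {1..n}" using i by simp
        have "uniform_floor \<le> Min (c ` {1..n}) * lower_threshold \<beta> (m 0 + S) S"
          by (simp add: uniform_floor_def)
        also have "\<dots> \<le> c i * (1 - u 0 x)"
          using i1 c_pos[OF i1] elim(2) by (intro mult_mono) (auto simp: lower_threshold_def)
        also have "\<dots> = u i x" using elim(3)[rule_format, OF i] False by (simp add: split_profile_def)
        finally show ?thesis .
      qed
    qed
  qed
qed

end

theorem theorem2p3:
  fixes n :: nat and \<Omega> :: "'a::euclidean_space set"
    and \<epsilon> \<beta> :: real and m :: "nat \<Rightarrow> real"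
  assumes "n \<ge> 1"
    and "DIM('a) \<in> {1, 2, 3}"
    and "smooth_bounded_domain \<Omega>"
    and "\<epsilon> > 0" and "\<beta> > 0"
    and "\<And>i. i \<le> n \<Longrightarrow> m i > 0"
    and "(\<Sum>j\<le>n. m j) = measure lebesgue \<Omega>"
  shows "\<exists>\<delta>>0. \<forall>u. Linf_local_minimizer n \<Omega> m \<epsilon> \<beta> u \<longrightarrow>
           (\<forall>i\<le>n. AE x in lebesgue_on \<Omega>. \<delta> \<le> u i x) \<and>
           (\<forall>i\<le>n. AE x in lebesgue_on \<Omega>. u i x \<le> 1 - real n * \<delta>)"
proof -
  interpret mixture n \<Omega> \<epsilon> \<beta> m
    using assms by unfold_locales (auto simp: smooth_bounded_domain_def)
  have "(\<forall>i\<le>n. AE x in M. uniform_floor \<le> u i x) \<and> (\<forall>i\<le>n. AE x in M. u i x \<le> 1 - real n * uniform_floor)"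
    if min: "Linf_local_minimizer n \<Omega> m \<epsilon> \<beta> u" for u
  proof -
    have u: "u \<in> admissible n \<Omega> m" using min by (simp add: Linf_local_minimizer_def)
    note low = minimizer_lower_bound[OF min]
    have "AE x in M. u i x \<le> 1 - real n * uniform_floor" if i: "i \<le> n" for i
      using low admissible_bounds[OF u]
    proof eventually_elim
      case (elim x)
      have "real n * uniform_floor = (\<Sum>j\<in>{..n} - {i}. uniform_floor)"
        using i by simp
      also have "\<dots> \<le> (\<Sum>j\<in>{..n} - {i}. u j x)" using elim by (intro sum_mono) auto
      also have "\<dots> = 1 - u i x" using elim i by (simp add: sum_diff1)
      finally show ?case by simp
    qed
    then show ?thesis using low by auto
  qed
  then show ?thesis using uniform_floor_pos by blast
qed

end
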